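(* Let $\Sigma$ be an alphabet. Suppose that the $\Sigma^*$-HDAs $\mathcal{B}_i$ $(i=1,\dots,n)$ are independent in the $\Sigma^*$-HDA $\mathcal{A}$, and consider homology classes $\beta_i\in H_*(\mathcal{B}_i)$ $(i=1,\dots,n)$. Then there exists a homology class $\alpha\in H_*(\mathcal{A})$ such that $$\ell_{\mathcal{A}}(\alpha)=\ell_{\mathcal{B}_1}(\beta_1)\wedge\cdots\wedge\ell_{\mathcal{B}_n}(\beta_n).$$
   Context: Fix a principal ideal domain $R$; all modules, chain complexes and exterior algebras are over $R$. All spaces are compactly generated Hausdorff, and products are formed in this category. Precubical sets. A precubical set is a graded set $P=(P_n)_{n\geq 0}$ with boundary operators $d^k_i\colon P_n\to P_{n-1}$ ($n>0$, $k\in\{0,1\}$, $1\le i\le n$) satisfying $d^k_i\circ d^l_j=d^l_{j-1}\circ d^k_i$ for $k,l\in\{0,1\}$, $i<j$. Morphisms are degree-preserving maps commuting with the boundary operators; a precubical subset is a graded subset stable under the boundary operators. For integers $k\le l$, the interval $[\![k,l]\!]$ has vertices $k,\dots,l$, edges $[j-1,j]$ ($k<j\le l$) with $d_1^0[j-1,j]=j-1$, $d_1^1[j-1,j]=j$, and no cubes of degree $\geq 2$. The tensor product is $(P\otimes Q)_n=\coprod_{p+q=n}P_p\times Q_q$ with $d_i^k(x,y)=(d_i^kx,y)$ for $i\le\deg(x)$ and $(x,d^k_{i-\deg(x)}y)$ for $i>\deg(x)$; $P^{\otimes 0}=[\![0,0]\!]$. The only element of degree $n$ of $[\![0,1]\!]^{\otimes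 n}$ is denoted $\iota_n$; for $x\in P_n$, $x_\sharp\colon[\![0,1]\!]^{\otimes n}\to P$ is the unique morphism with $x_\sharp(\iota_n)=x$. A path of length $k$ in $P$ is a morphism $\omega\colon[\![0,k]\!]\to P$; for $k\ge1$ it is uniquely a concatenation $x_{1\sharp}\cdots x_{k\sharp}$ with $x_j\in P_1$, $d_1^0x_{j+1}=d_1^1x_j$. The set of paths is $P^{\mathbb{I}}$. Geometric realization. $|P|=(\coprod_n P_n\times[0,1]^n)/\!\sim$ with $(d^k_ix,u)\sim(x,\delta^k_i(u))$, where $\delta^k_i(u_1,\dots,u_n)=(u_1,\dots,u_{i-1},k,u_i,\dots,u_n)$; for a morphism $g$, $|g|([x,u])=[g(x),u]$. One identifies $|P\otimes Q|=|P|\times|Q|$ (splitting coordinates) and $|[\![k,l]\!]|=[k,l]$ via $[[j-1,j],t]\mapsto j-1+t$. For $\sigma\in S_n$, $t_\sigma\colon|P_1\otimes\cdots\otimes P_n|\to|P_{\sigma(1)}\otimes\cdots\otimes P_{\sigma(n)}|$ is $(a_1,\dots,a_n)\mapsto(a_{\sigma(1)},\dots,a_{\sigma(n)})$. Cubical dimaps of precubical sets. An elementary cubical dimap from $Q$ to $P$ is a continuous map $f\colon|Q|\to|P|$ such that (1) for every $v\in Q_0$ there is a (unique) $w\in P_0$ with $f([v,()])=[w,()]$; (2) for every $x\in Q_n$, $n>0$, there exist integers $l_1,\dots,l_n\ge1$, a morphism $\chi\colon[\![0,l_1]\!]\otimes\cdots\otimes[\![0,l_n]\!]\to P$, a permutation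 $\sigma\in S_n$, and increasing homeomorphisms $\phi_i\colon[0,1]\to[0,l_i]$ with $f\circ|x_\sharp|=|\chi|\circ(\phi_1\times\cdots\times\phi_n)\circ t_\sigma$. A cubical dimap is a finite composite of elementary ones. It induces a vertex map $f_0\colon Q_0\to P_0$ by $f([v,()])=[f_0(v),()]$, and a map $f^{\mathbb{I}}\colon Q^{\mathbb{I}}\to P^{\mathbb{I}}$: for a path $\omega\colon[\![0,k]\!]\to Q$, $f^{\mathbb{I}}(\omega)$ is the unique path $\nu\colon[\![0,l]\!]\to P$ for which there is an increasing homeomorphism $\phi\colon[0,k]\to[0,l]$ with $|\nu|\circ\phi=f\circ|\omega|$. HDAs. For a monoid $M$, an $M$-HDA is a tuple $\mathcal{A}=(P_{\mathcal{A}},I_{\mathcal{A}},F_{\mathcal{A}},\lambda_{\mathcal{A}})$ with $P_{\mathcal{A}}$ a precubical set (also written $\mathcal{A}$), $I_{\mathcal{A}},F_{\mathcal{A}}\subseteq\mathcal{A}_0$, and $\lambda_{\mathcal{A}}\colon\mathcal{A}_1\to M$ with $\lambda_{\mathcal{A}}(d^0_ix)=\lambda_{\mathcal{A}}(d^1_ix)$ for $x\in\mathcal{A}_2$, $i\in\{1,2\}$. $\mathcal{B}$ is a subautomaton of $\mathcal{A}$ if $\mathcal{B}$ is a precubical subset of $\mathcal{A}$, $I_{\mathcal{B}}\subseteq I_{\mathcal{A}}$, $F_{\mathcal{B}}\subseteq F_{\mathcal{A}}$, and $\lambda_{\mathcal{B}}=\lambda_{\mathcal{A}}$ on $\mathcal{B}_1$.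 The tensor product $\mathcal{A}\otimes\mathcal{B}$ has precubical set $P_{\mathcal{A}}\otimes P_{\mathcal{B}}$, initial states $I_{\mathcal{A}}\times I_{\mathcal{B}}$, final states $F_{\mathcal{A}}\times F_{\mathcal{B}}$, and labels $\lambda(x,v)=\lambda_{\mathcal{A}}(x)$ on $\mathcal{A}_1\times\mathcal{B}_0$, $\lambda(v,y)=\lambda_{\mathcal{B}}(y)$ on $\mathcal{A}_0\times\mathcal{B}_1$. The extended labeling function $\overline{\lambda}_{\mathcal{A}}\colon\mathcal{A}^{\mathbb{I}}\to M$ is $\overline{\lambda}_{\mathcal{A}}(x_{1\sharp}\cdots x_{k\sharp})=\lambda_{\mathcal{A}}(x_1)\cdots\lambda_{\mathcal{A}}(x_k)$, and $1$ on paths of length $0$. An elementary cubical dimap of $M$-HDAs from $\mathcal{B}$ to $\mathcal{A}$ is an elementary cubical dimap of precubical sets $f\colon|\mathcal{B}|\to|\mathcal{A}|$ with $f_0(I_{\mathcal{B}})\subseteq I_{\mathcal{A}}$, $f_0(F_{\mathcal{B}})\subseteq F_{\mathcal{A}}$, $\overline{\lambda}_{\mathcal{A}}\circ f^{\mathbb{I}}=\overline{\lambda}_{\mathcal{B}}$; a cubical dimap of $M$-HDAs is a finite composite of elementary cubical dimaps of $M$-HDAs. Independence. $M$-HDAs $\mathcal{B}_1,\dots,\mathcal{B}_n$ are independent in the $M$-HDA $\mathcal{A}$ if there exist a subautomaton $\mathcal{B}$ of $\mathcal{A}$ and a cubical dimap of $M$-HDAs $|\mathcal{B}_1\otimes\cdots\otimes\mathcal{B}_n|\to|\mathcal{B}|$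 that is a homeomorphism. Labeled homology. $C_n(P)$ is the free module on $P_n$, $dx=\sum_{i=1}^n(-1)^i(d^0_ix-d^1_ix)$, and $H_*(P)=H(C_*(P))$. $\Sigma^*$ is the free monoid on the set $\Sigma$; $|m|$ is the length of $m\in\Sigma^*$ and $m=m_1\cdots m_{|m|}$, $m_j\in\Sigma$. $\Lambda(\Sigma)$ is the exterior algebra on the free module on $\Sigma$. For $x\in P_n$, $n>0$, $e^0_ix=x$ if $n=1$ and $e^0_ix=d_1^{1}\cdots d_{i-1}^{1}d_{i+1}^{1}\cdots d_n^{1}x$ if $n>1$. The $n$th labeling cochain $\mathfrak{l}^n_{\mathcal{A}}\colon C_*(\mathcal{A})\to\Lambda(\Sigma)$ vanishes outside $C_n(\mathcal{A})$ and on $x\in\mathcal{A}_n$ equals $1$ if $n=0$, and $\sum_{j_1=1}^{|\lambda_{\mathcal{A}}(e^0_1x)|}\cdots\sum_{j_n=1}^{|\lambda_{\mathcal{A}}(e^0_nx)|}\lambda_{\mathcal{A}}(e^0_1x)_{j_1}\wedge\cdots\wedge\lambda_{\mathcal{A}}(e^0_nx)_{j_n}$ if $n>0$. It is a cocycle. The labeling homomorphism $\ell_{\mathcal{A}}$ on $H_*(\mathcal{A})$ is given on $H_n(\mathcal{A})$ by $\ell_{\mathcal{A}}([z])=\ell^n_{\mathcal{A}}([z])=\mathfrak{l}^n_{\mathcal{A}}(z)$. *)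

theory Defs
  imports "HOL-Analysis.Analysis" "HOL-Library.Poly_Mapping"
begin

section \<open>Precubical sets\<close>

text \<open>
  A graded set is encoded as one carrier set together with a degree function. In boundary
  operators \<open>bd P k i\<close>, the Boolean \<open>k\<close> stands for the number \<open>of_bool k\<close>, so that
  \<open>bd P False i\<close> is \<open>d\<^sup>0\<^sub>i\<close> and \<open>bd P True i\<close> is \<open>d\<^sup>1\<^sub>i\<close>. Only the values for
  \<open>x \<in> cubes P\<close> and \<open>1 \<le> i \<le> deg P x\<close> are relevant.
\<close>

record 'a precubical =
  cubes :: "'a set"
  deg :: "'a \<Rightarrow> nat"
  bd :: "bool \<Rightarrow> nat \<Rightarrow> 'a \<Rightarrow> 'a"

definition cubes_of_deg :: "('a, 'z) precubical_scheme \<Rightarrow> nat \<Rightarrow> 'a set" where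
  "cubes_of_deg P n = {x \<in> cubes P. deg P x = n}"

definition precubical_set :: "('a, 'z) precubical_scheme \<Rightarrow> bool" where
  "precubical_set P \<longleftrightarrow>
     (\<forall>x \<in> cubes P. \<forall>k. \<forall>i \<in> {1..deg P x}.
        bd P k i x \<in> cubes P \<and> deg P (bd P k i x) = deg P x - 1) \<and>
     (\<forall>x \<in> cubes P. \<forall>k l i j. 1 \<le> i \<and> i < j \<and> j \<le> deg P x \<longrightarrow>
        bd P k i (bd P l j x) = bd P l (j - 1) (bd P k i x))"

definition precubical_morphism ::
    "('a, 'y) precubical_scheme \<Rightarrow> ('b, 'z) precubical_scheme \<Rightarrow> ('a \<Rightarrow> 'b) \<Rightarrow> bool" where
  "precubical_morphism P Q g \<longleftrightarrow>
     (\<forall>x \<in> cubes P. g x \<in> cubes Q \<and> deg Q (g x) = deg P x \<and>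
        (\<forall>k. \<forall>i \<in> {1..deg P x}. g (bd P k i x) = bd Q k i (g x)))"

text \<open>\<open>Edge j\<close> is the edge \<open>[j - 1, j]\<close>.\<close>

datatype icube = Vertex int | Edge int

definition interval_pcs :: "int \<Rightarrow> int \<Rightarrow> icube precubical" where
  "interval_pcs k l =
     \<lparr> cubes = Vertex ` {k..l} \<union> Edge ` {k<..l},
       deg = (\<lambda>c. case c of Vertex _ \<Rightarrow> 0 | Edge _ \<Rightarrow> 1),
       bd = (\<lambda>b i c. case c of Vertex j \<Rightarrow> Vertex j | Edge j \<Rightarrow> Vertex (if b then j else j - 1)) \<rparr>"

text \<open>
  The cubes of \<open>P\<^sub>1 \<otimes> \<dots> \<otimes> P\<^sub>n\<close> are lists of length \<open>n\<close>. The functions below implement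
  \<open>P\<^sub>1 \<otimes> (P\<^sub>2 \<otimes> \<dots>)\<close>, the pair \<open>(x, xs)\<close> being written \<open>x # xs\<close>. The empty tensor product
  is a single vertex.
\<close>

fun tensor_deg :: "('a, 'z) precubical_scheme list \<Rightarrow> 'a list \<Rightarrow> nat" where
  "tensor_deg (P # Ps) (x # xs) = deg P x + tensor_deg Ps xs"
| "tensor_deg _ _ = 0"

fun tensor_bd :: "('a, 'z) precubical_scheme list \<Rightarrow> bool \<Rightarrow> nat \<Rightarrow> 'a list \<Rightarrow> 'a list" where
  "tensor_bd (P # Ps) k i (x # xs) =
     (if i \<le> deg P x then bd P k i x # xs else x # tensor_bd Ps k (i - deg P x) xs)"
| "tensor_bd _ _ _ xs = xs"

definition tensor_pcs :: "('a, 'z) precubical_scheme list \<Rightarrow> 'a list precubical" where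
  "tensor_pcs Ps =
     \<lparr> cubes = listset (map cubes Ps), deg = tensor_deg Ps, bd = tensor_bd Ps \<rparr>"


section \<open>Geometric realization\<close>

text \<open>Points of \<open>[0,1]\<^sup>n\<close> are lists of length \<open>n\<close>.\<close>

definition unit_cube :: "nat \<Rightarrow> real list set" where
  "unit_cube n = {u. length u = n \<and> set u \<subseteq> {0..1}}"

definition unit_cube_topology :: "nat \<Rightarrow> real list topology" where
  "unit_cube_topology n =
     pullback_topology (unit_cube n) (\<lambda>u. \<lambda>i\<in>{..<n}. u ! i) (powertop_real {..<n})"

definition coface :: "bool \<Rightarrow> nat \<Rightarrow> real list \<Rightarrow> real list" where
  "coface k i u = take (i - 1) u @ of_bool k # drop (i - 1) u"

definition realization_rel ::
    "('a, 'z) precubical_scheme \<Rightarrow> (('a \<times> real list) \<times> ('a \<times> real list)) set" where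
  "realization_rel P =
     {((bd P k i x, u), (x, coface k i u)) | k i x u.
        x \<in> cubes P \<and> i \<in> {1..deg P x} \<and> u \<in> unit_cube (deg P x - 1)}"

definition realization_equiv ::
    "('a, 'z) precubical_scheme \<Rightarrow> (('a \<times> real list) \<times> ('a \<times> real list)) set" where
  "realization_equiv P = (realization_rel P \<union> (realization_rel P)\<inverse>)\<^sup>*"

text \<open>The point \<open>[x, u]\<close> of the geometric realization.\<close>

definition pt :: "('a, 'z) precubical_scheme \<Rightarrow> 'a \<Rightarrow> real list \<Rightarrow> ('a \<times> real list) set" where
  "pt P x u = realization_equiv P `` {(x, u)}"

definition realization_coproduct ::
    "('a, 'z) precubical_scheme \<Rightarrow> ('a \<times> real list) topology" where
  "realization_coproduct P = sum_topology (\<lambda>x. unit_cube_topology (deg P x)) (cubes P)"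

text \<open>
  The quotient topology. The realization is a CW complex, so forming the quotient in
  compactly generated Hausdorff spaces gives the same space.
\<close>

definition realization :: "('a, 'z) precubical_scheme \<Rightarrow> ('a \<times> real list) set topology" where
  "realization P = topology (\<lambda>U.
     U \<subseteq> topspace (realization_coproduct P) // realization_equiv P \<and>
     openin (realization_coproduct P)
       {(x, u) \<in> topspace (realization_coproduct P). pt P x u \<in> U})"

lemma topspace_unit_cube_topology [simp]: "topspace (unit_cube_topology n) = unit_cube n"
  by (auto simp: unit_cube_topology_def topspace_pullback_topology)

lemma topspace_realization_coproduct:
  "topspace (realization_coproduct P) = (SIGMA x:cubes P. unit_cube (deg P x))"
  by (simp add: realization_coproduct_def o_def)

lemma openin_realization:
  "openin (realization P) U \<longleftrightarrow>
     U \<subseteq> topspace (realization_coproduct P) // realization_equiv P \<and>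
     openin (realization_coproduct P)
       {(x, u) \<in> topspace (realization_coproduct P). pt P x u \<in> U}"
proof -
  let ?X = "realization_coproduct P"
  let ?p = "\<lambda>U. {(x, u) \<in> topspace ?X. pt P x u \<in> U}"
  have "istopology (\<lambda>U. U \<subseteq> topspace ?X // realization_equiv P \<and> openin ?X (?p U))"
    unfolding istopology_def
  proof (intro conjI allI impI)
    fix S T
    assume S: "S \<subseteq> topspace ?X // realization_equiv P \<and> openin ?X (?p S)"
      and T: "T \<subseteq> topspace ?X // realization_equiv P \<and> openin ?X (?p T)"
    show "S \<inter> T \<subseteq> topspace ?X // realization_equiv P" using S by blast
    have "?p (S \<inter> T) = ?p S \<inter> ?p T" by auto
    then show "openin ?X (?p (S \<inter> T))" using S T by auto
  next
    fix \<K>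
    assume K: "\<forall>K\<in>\<K>. K \<subseteq> topspace ?X // realization_equiv P \<and> openin ?X (?p K)"
    show "\<Union>\<K> \<subseteq> topspace ?X // realization_equiv P" using K by blast
    have "?p (\<Union>\<K>) = (\<Union>K\<in>\<K>. ?p K)" by auto
    then show "openin ?X (?p (\<Union>\<K>))" using K by auto
  qed
  then show ?thesis by (simp add: realization_def)
qed

lemma topspace_realization:
  "topspace (realization P) = topspace (realization_coproduct P) // realization_equiv P"
proof -
  let ?X = "realization_coproduct P"
  have "{(x, u) \<in> topspace ?X. pt P x u \<in> topspace ?X // realization_equiv P} = topspace ?X"
    by (auto simp: pt_def intro: quotientI)
  then have "openin (realization P) (topspace ?X // realization_equiv P)"
    by (simp add: openin_realization)
  then show ?thesis
    by (meson openin_realization openin_subset openin_topspace subset_antisym)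
qed

lemma quotient_map_realization:
  "quotient_map (realization_coproduct P) (realization P) (\<lambda>(x, u). pt P x u)"
proof -
  have "(\<lambda>(x, u). pt P x u) ` topspace (realization_coproduct P) = topspace (realization P)"
    unfolding topspace_realization by (auto simp: quotient_def pt_def)
  moreover have "{p \<in> topspace (realization_coproduct P). (case p of (x, u) \<Rightarrow> pt P x u) \<in> U}
      = {(x, u) \<in> topspace (realization_coproduct P). pt P x u \<in> U}" for U
    by auto
  ultimately show ?thesis
    by (auto simp: quotient_map_def openin_realization topspace_realization)
qed

text \<open>The map \<open>|g| : |P| \<rightarrow> |Q|\<close>; a point of \<open>|P|\<close> is a class of pairs, and \<open>|g|\<close> sends
  the class \<open>[x, u]\<close> to \<open>[g x, u]\<close>.\<close>

definition realization_map ::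
    "('b, 'z) precubical_scheme \<Rightarrow> ('a \<Rightarrow> 'b) \<Rightarrow> ('a \<times> real list) set \<Rightarrow> ('b \<times> real list) set" where
  "realization_map Q g p = the_elem ((\<lambda>(x, u). pt Q (g x) u) ` p)"

text \<open>
  The identification \<open>[k, l] = |[[k, l]]|\<close> inverse to \<open>[[j - 1, j], t] \<mapsto> j - 1 + t\<close>: an integer
  is a vertex, any other real \<open>t\<close> lies in the interior of the edge \<open>[\<lceil>t\<rceil> - 1, \<lceil>t\<rceil>]\<close>.
  \<open>grid_point [l\<^sub>1, \<dots>, l\<^sub>n]\<close> is the resulting identification
  \<open>[0, l\<^sub>1] \<times> \<dots> \<times> [0, l\<^sub>n] = |[[0, l\<^sub>1]] \<otimes> \<dots> \<otimes> [[0, l\<^sub>n]]|\<close>.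
\<close>

definition real_cell :: "real \<Rightarrow> icube" where
  "real_cell t = (if t \<in> \<int> then Vertex \<lfloor>t\<rfloor> else Edge \<lceil>t\<rceil>)"

definition real_coords :: "real \<Rightarrow> real list" where
  "real_coords t = (if t \<in> \<int> then [] else [frac t])"

definition interval_point :: "int \<Rightarrow> int \<Rightarrow> real \<Rightarrow> (icube \<times> real list) set" where
  "interval_point k l t = pt (interval_pcs k l) (real_cell t) (real_coords t)"

definition grid :: "int list \<Rightarrow> icube list precubical" where
  "grid ls = tensor_pcs (map (interval_pcs 0) ls)"

definition grid_point :: "int list \<Rightarrow> real list \<Rightarrow> (icube list \<times> real list) set" where
  "grid_point ls ts = pt (grid ls) (map real_cell ts) (concat (map real_coords ts))"


section \<open>Elementary cubical dimaps of precubical sets\<close>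

definition increasing_homeo :: "real \<Rightarrow> real \<Rightarrow> (real \<Rightarrow> real) \<Rightarrow> bool" where
  "increasing_homeo a b \<phi> \<longleftrightarrow>
     homeomorphic_map (top_of_set {0..a}) (top_of_set {0..b}) \<phi> \<and> strict_mono_on {0..a} \<phi>"

text \<open>
  In the last clause \<open>u\<close> runs over \<open>[0,1]\<^sup>n = |[[0,1]]\<^sup>\<otimes>\<^sup>n|\<close>, whose points are the
  \<open>[\<iota>\<^sub>n, u]\<close>; so \<open>|x\<^sub>\<sharp>|\<close> takes \<open>u\<close> to \<open>[x, u]\<close>, and \<open>(\<phi>\<^sub>1 \<times> \<dots> \<times> \<phi>\<^sub>n) \<circ> t\<^sub>\<sigma>\<close> takes \<open>u\<close> to
  \<open>(\<phi>\<^sub>1 u\<^sub>\<sigma>\<^sub>(\<^sub>1\<^sub>), \<dots>, \<phi>\<^sub>n u\<^sub>\<sigma>\<^sub>(\<^sub>n\<^sub>))\<close>. Indices are shifted to \<open>0, \<dots>, n - 1\<close>.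
\<close>

definition elementary_cubical_dimap ::
    "('a, 'y) precubical_scheme \<Rightarrow> ('b, 'z) precubical_scheme \<Rightarrow>
     (('a \<times> real list) set \<Rightarrow> ('b \<times> real list) set) \<Rightarrow> bool" where
  "elementary_cubical_dimap Q P f \<longleftrightarrow>
     precubical_set Q \<and> precubical_set P \<and>
     continuous_map (realization Q) (realization P) f \<and>
     (\<forall>v \<in> cubes_of_deg Q 0. \<exists>w \<in> cubes_of_deg P 0. f (pt Q v []) = pt P w []) \<and>
     (\<forall>n>0. \<forall>x \<in> cubes_of_deg Q n. \<exists>ls g \<sigma> \<phi>.
        length ls = n \<and> (\<forall>l \<in> set ls. 1 \<le> l) \<and>
        precubical_morphism (grid ls) P g \<and>
        \<sigma> permutes {..<n} \<and>
        (\<forall>i<n. increasing_homeo 1 (of_int (ls ! i)) (\<phi> i)) \<and>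
        (\<forall>u \<in> unit_cube n.
           f (pt Q x u) =
           realization_map P g (grid_point ls (map (\<lambda>i. \<phi> i (u ! \<sigma> i)) [0..<n]))))"

definition vertex_map ::
    "('a, 'y) precubical_scheme \<Rightarrow> ('b, 'z) precubical_scheme \<Rightarrow>
     (('a \<times> real list) set \<Rightarrow> ('b \<times> real list) set) \<Rightarrow> 'a \<Rightarrow> 'b" where
  "vertex_map Q P f v = (THE w. w \<in> cubes_of_deg P 0 \<and> f (pt Q v []) = pt P w [])"

text \<open>Paths are pairs of a length and a morphism; the morphism is required to be
  \<open>undefined\<close> outside the cubes of the interval so that equal paths are equal functions.\<close>

definition paths :: "('a, 'z) precubical_scheme \<Rightarrow> (nat \<times> (icube \<Rightarrow> 'a)) set" where
  "paths P = {(k, \<omega>). precubical_morphism (interval_pcs 0 (int k)) P \<omega> \<and>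
                      \<omega> \<in> extensional (cubes (interval_pcs 0 (int k)))}"

definition realization_path ::
    "('a, 'z) precubical_scheme \<Rightarrow> nat \<times> (icube \<Rightarrow> 'a) \<Rightarrow> real \<Rightarrow> ('a \<times> real list) set" where
  "realization_path P = (\<lambda>(k, \<omega>) t. realization_map P \<omega> (interval_point 0 (int k) t))"

definition path_map ::
    "('a, 'y) precubical_scheme \<Rightarrow> ('b, 'z) precubical_scheme \<Rightarrow>
     (('a \<times> real list) set \<Rightarrow> ('b \<times> real list) set) \<Rightarrow>
     nat \<times> (icube \<Rightarrow> 'a) \<Rightarrow> nat \<times> (icube \<Rightarrow> 'b)" where
  "path_map Q P f \<omega> = (THE \<nu>. \<nu> \<in> paths P \<and>
     (\<exists>\<phi>. increasing_homeo (real (fst \<omega>)) (real (fst \<nu>)) \<phi> \<and>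
          (\<forall>t \<in> {0..real (fst \<omega>)}. realization_path P \<nu> (\<phi> t) = f (realization_path Q \<omega> t))))"


section \<open>Higher-dimensional automata\<close>

text \<open>Monoids of labels are written additively. The free monoid \<open>\<Sigma>\<^sup>*\<close> on a type
  is the type of lists over it.\<close>

instantiation list :: (type) monoid_add
begin
definition zero_list :: "'a list" where "zero_list = []"
definition plus_list :: "'a list \<Rightarrow> 'a list \<Rightarrow> 'a list" where "plus_list xs ys = xs @ ys"
instance by standard (auto simp: zero_list_def plus_list_def)
end

record ('a, 'm) hda = "'a precubical" +
  initial :: "'a set"
  final :: "'a set"
  label :: "'a \<Rightarrow> 'm"

definition is_hda :: "('a, 'm::monoid_add) hda \<Rightarrow> bool" where
  "is_hda A \<longleftrightarrow>
     precubical_set A \<and> initial A \<subseteq> cubes_of_deg A 0 \<and> final A \<subseteq> cubes_of_deg A 0 \<and>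
     (\<forall>x \<in> cubes_of_deg A 2. \<forall>i \<in> {1, 2}. label A (bd A False i x) = label A (bd A True i x))"

definition subautomaton :: "('a, 'm::monoid_add) hda \<Rightarrow> ('a, 'm) hda \<Rightarrow> bool" where
  "subautomaton B A \<longleftrightarrow>
     is_hda B \<and> is_hda A \<and> cubes B \<subseteq> cubes A \<and>
     (\<forall>x \<in> cubes B. deg B x = deg A x \<and> (\<forall>k. \<forall>i \<in> {1..deg A x}. bd B k i x = bd A k i x)) \<and>
     initial B \<subseteq> initial A \<and> final B \<subseteq> final A \<and>
     (\<forall>x \<in> cubes_of_deg B 1. label B x = label A x)"

fun tensor_label :: "('a, 'm::monoid_add) hda list \<Rightarrow> 'a list \<Rightarrow> 'm" where
  "tensor_label (A # As) (x # xs) = (if deg A x = 1 then label A x else tensor_label As xs)"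
| "tensor_label _ _ = 0"

definition tensor_hda :: "('a, 'm::monoid_add) hda list \<Rightarrow> ('a list, 'm) hda" where
  "tensor_hda As =
     \<lparr> cubes = cubes (tensor_pcs As), deg = deg (tensor_pcs As), bd = bd (tensor_pcs As),
       initial = listset (map initial As), final = listset (map final As),
       label = tensor_label As \<rparr>"

definition ext_label :: "('a, 'm::monoid_add) hda \<Rightarrow> nat \<times> (icube \<Rightarrow> 'a) \<Rightarrow> 'm" where
  "ext_label A = (\<lambda>(k, \<omega>). sum_list (map (\<lambda>j. label A (\<omega> (Edge j))) [1..int k]))"

definition elementary_hda_dimap ::
    "('a, 'm::monoid_add) hda \<Rightarrow> ('b, 'm) hda \<Rightarrow>
     (('a \<times> real list) set \<Rightarrow> ('b \<times> real list) set) \<Rightarrow> bool" where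
  "elementary_hda_dimap B A f \<longleftrightarrow>
     is_hda B \<and> is_hda A \<and> elementary_cubical_dimap B A f \<and>
     vertex_map B A f ` initial B \<subseteq> initial A \<and>
     vertex_map B A f ` final B \<subseteq> final A \<and>
     (\<forall>\<omega> \<in> paths B. ext_label A (path_map B A f \<omega>) = ext_label B \<omega>)"

text \<open>
  A cubical dimap is a finite composite of elementary ones. The intermediate automata are
  not bounded by the given ones, so the type \<open>'c\<close> of their cubes is a parameter, passed as
  \<open>TYPE('c)\<close>. One type suffices for all intermediate automata in a composite, since finitely
  many types embed in a common one; a theorem that assumes \<open>cubical_dimap TYPE('c) B A f\<close> for
  a type variable \<open>'c\<close> applies to all cubical dimaps.
\<close>

inductive dimap_chain ::
    "('b, 'm::monoid_add) hda \<Rightarrow> ('c, 'm) hda \<Rightarrow>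
     (('b \<times> real list) set \<Rightarrow> ('c \<times> real list) set) \<Rightarrow> bool"
  for B where
  single: "elementary_hda_dimap B C f \<Longrightarrow> dimap_chain B C f"
| comp: "dimap_chain B C f \<Longrightarrow> elementary_hda_dimap C D g \<Longrightarrow> dimap_chain B D (g \<circ> f)"

definition cubical_dimap ::
    "'c itself \<Rightarrow> ('b, 'm::monoid_add) hda \<Rightarrow> ('a, 'm) hda \<Rightarrow>
     (('b \<times> real list) set \<Rightarrow> ('a \<times> real list) set) \<Rightarrow> bool" where
  "cubical_dimap T B A f \<longleftrightarrow>
     elementary_hda_dimap B A f \<or>
     (\<exists>(C :: ('c, 'm) hda) g h. dimap_chain B C g \<and> elementary_hda_dimap C A h \<and> f = h \<circ> g)"

definition independent_in ::
    "'c itself \<Rightarrow> ('b, 'm::monoid_add) hda list \<Rightarrow> ('a, 'm) hda \<Rightarrow> bool" where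
  "independent_in T Bs A \<longleftrightarrow>
     (\<exists>B f. subautomaton B A \<and> cubical_dimap T (tensor_hda Bs) B f \<and>
            homeomorphic_map (realization (tensor_hda Bs)) (realization B) f)"


section \<open>Homology\<close>

class pid = idom +
  assumes ideal_principal:
    "0 \<in> I \<Longrightarrow> (\<And>a b. a \<in> I \<Longrightarrow> b \<in> I \<Longrightarrow> a + b \<in> I) \<Longrightarrow> (\<And>r a. a \<in> I \<Longrightarrow> r * a \<in> I)
     \<Longrightarrow> \<exists>g. I = range (\<lambda>r. r * g)"

text \<open>
  The chain complex is taken as a whole: \<open>chains P\<close> is the direct sum of the free modules
  \<open>C\<^sub>n(P)\<close> and \<open>homology P\<close> the direct sum of the \<open>H\<^sub>n(P)\<close>, given by its cosets.
\<close>

definition chains :: "('a, 'z) precubical_scheme \<Rightarrow> ('a \<Rightarrow>\<^sub>0 'r::comm_ring_1) set" where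
  "chains P = {c. Poly_Mapping.keys c \<subseteq> cubes P}"

definition boundary_cube :: "('a, 'z) precubical_scheme \<Rightarrow> 'a \<Rightarrow> ('a \<Rightarrow>\<^sub>0 'r::comm_ring_1)" where
  "boundary_cube P x = (\<Sum>i = 1..deg P x.
     Poly_Mapping.single (bd P False i x) ((-1) ^ i) -
     Poly_Mapping.single (bd P True i x) ((-1) ^ i))"

definition boundary ::
    "('a, 'z) precubical_scheme \<Rightarrow> ('a \<Rightarrow>\<^sub>0 'r::comm_ring_1) \<Rightarrow> ('a \<Rightarrow>\<^sub>0 'r)" where
  "boundary P c = (\<Sum>x \<in> Poly_Mapping.keys c.
     Poly_Mapping.map ((*) (Poly_Mapping.lookup c x)) (boundary_cube P x))"

definition cycles :: "('a, 'z) precubical_scheme \<Rightarrow> ('a \<Rightarrow>\<^sub>0 'r::comm_ring_1) set" where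
  "cycles P = {c \<in> chains P. boundary P c = 0}"

definition boundaries :: "('a, 'z) precubical_scheme \<Rightarrow> ('a \<Rightarrow>\<^sub>0 'r::comm_ring_1) set" where
  "boundaries P = boundary P ` chains P"

definition homology :: "('a, 'z) precubical_scheme \<Rightarrow> ('a \<Rightarrow>\<^sub>0 'r::comm_ring_1) set set" where
  "homology P =
     cycles P // {(z, z'). z \<in> cycles P \<and> z' \<in> cycles P \<and> z - z' \<in> boundaries P}"


section \<open>The exterior algebra on a free module\<close>

text \<open>
  The tensor algebra of the free module on \<open>'s\<close> is the monoid algebra \<open>'s list \<Rightarrow>\<^sub>0 'r\<close> of the
  free monoid, with the multiplication of theory \<^theory>\<open>HOL-Library.Poly_Mapping\<close>; the free
  module itself is spanned by the words of length 1. The exterior algebra is the quotient by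
  the two-sided ideal generated by the squares \<open>v \<otimes> v\<close> of elements \<open>v\<close> of the free module.
  Its multiplication \<open>*\<close> is the wedge product.
\<close>

inductive_set exterior_ideal :: "('s list \<Rightarrow>\<^sub>0 'r::comm_ring_1) set" where
  zero: "0 \<in> exterior_ideal"
| add: "p \<in> exterior_ideal \<Longrightarrow> q \<in> exterior_ideal \<Longrightarrow> p + q \<in> exterior_ideal"
| square: "Poly_Mapping.keys v \<subseteq> {m. length m = 1} \<Longrightarrow> p * (v * v) * q \<in> exterior_ideal"

lemma exterior_ideal_mult_left: "p \<in> exterior_ideal \<Longrightarrow> r * p \<in> exterior_ideal"
proof (induction rule: exterior_ideal.induct)
  case (square v p q)
  then show ?case
    using exterior_ideal.square[of v "r * p" q] by (simp add: mult.assoc)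
qed (auto simp: distrib_left intro: exterior_ideal.intros)

lemma exterior_ideal_mult_right: "p \<in> exterior_ideal \<Longrightarrow> p * r \<in> exterior_ideal"
proof (induction rule: exterior_ideal.induct)
  case (square v p q)
  then show ?case
    using exterior_ideal.square[of v p "q * r"] by (simp add: mult.assoc)
qed (auto simp: distrib_right intro: exterior_ideal.intros)

lemma exterior_ideal_minus: "p \<in> exterior_ideal \<Longrightarrow> - p \<in> exterior_ideal"
  using exterior_ideal_mult_left[of p "- 1"] by simp

lemma exterior_ideal_add_diff:
  "p - p' \<in> exterior_ideal \<Longrightarrow> q - q' \<in> exterior_ideal \<Longrightarrow> (p + q) - (p' + q') \<in> exterior_ideal"
  using exterior_ideal.add[of "p - p'" "q - q'"] by (simp add: algebra_simps)

lemma exterior_ideal_diff_diff: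
  assumes "p - p' \<in> exterior_ideal" "q - q' \<in> exterior_ideal"
  shows "(p - q) - (p' - q') \<in> exterior_ideal"
proof -
  have "(p - q) - (p' - q') = (p - p') + - (q - q')"
    by (simp add: algebra_simps)
  then show ?thesis
    using exterior_ideal.add[OF assms(1) exterior_ideal_minus[OF assms(2)]] by (simp only:)
qed

lemma exterior_ideal_mult_diff:
  assumes "p - p' \<in> exterior_ideal" "q - q' \<in> exterior_ideal"
  shows "p * q - p' * q' \<in> exterior_ideal"
proof -
  have "p * q - p' * q' = (p - p') * q + p' * (q - q')"
    by (simp add: algebra_simps)
  then show ?thesis
    using assms
    by (auto intro: exterior_ideal.add exterior_ideal_mult_left exterior_ideal_mult_right)
qed

definition exterior_rel :: "('s list \<Rightarrow>\<^sub>0 'r::comm_ring_1) \<Rightarrow> ('s list \<Rightarrow>\<^sub>0 'r) \<Rightarrow> bool" where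
  "exterior_rel p q \<longleftrightarrow> p - q \<in> exterior_ideal"

lemma equivp_exterior_rel:
  "equivp (exterior_rel :: ('a list \<Rightarrow>\<^sub>0 'b::comm_ring_1) \<Rightarrow> _)"
proof (rule equivpI)
  show "reflp (exterior_rel :: ('a list \<Rightarrow>\<^sub>0 'b) \<Rightarrow> _)"
    by (simp add: reflp_def exterior_rel_def exterior_ideal.zero)
  show "symp (exterior_rel :: ('a list \<Rightarrow>\<^sub>0 'b) \<Rightarrow> _)"
    unfolding symp_def exterior_rel_def by (metis exterior_ideal_minus minus_diff_eq)
  show "transp (exterior_rel :: ('a list \<Rightarrow>\<^sub>0 'b) \<Rightarrow> _)"
  proof (rule transpI)
    fix p q r :: "'a list \<Rightarrow>\<^sub>0 'b"
    assume "exterior_rel p q" "exterior_rel q r"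
    then have "(p - q) + (q - r) \<in> exterior_ideal"
      unfolding exterior_rel_def by (rule exterior_ideal.add)
    then show "exterior_rel p r" by (simp add: exterior_rel_def)
  qed
qed

quotient_type (overloaded) ('s, 'r) exterior = "'s list \<Rightarrow>\<^sub>0 'r::comm_ring_1" / exterior_rel
  by (rule equivp_exterior_rel)

instantiation exterior :: (type, comm_ring_1) ring
begin

lift_definition zero_exterior :: "('a, 'b) exterior" is 0 .

lift_definition plus_exterior :: "('a, 'b) exterior \<Rightarrow> ('a, 'b) exterior \<Rightarrow> ('a, 'b) exterior"
  is "(+)" by (simp add: exterior_rel_def exterior_ideal_add_diff)

lift_definition uminus_exterior :: "('a, 'b) exterior \<Rightarrow> ('a, 'b) exterior" is uminus
  unfolding exterior_rel_def by (drule exterior_ideal_minus) simp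

lift_definition minus_exterior :: "('a, 'b) exterior \<Rightarrow> ('a, 'b) exterior \<Rightarrow> ('a, 'b) exterior"
  is "(-)"
  by (simp add: exterior_rel_def exterior_ideal_diff_diff)

lift_definition times_exterior :: "('a, 'b) exterior \<Rightarrow> ('a, 'b) exterior \<Rightarrow> ('a, 'b) exterior"
  is "(*)" by (simp add: exterior_rel_def exterior_ideal_mult_diff)

instance
  by standard
    (transfer, simp add: exterior_rel_def exterior_ideal.zero algebra_simps)+

end

instantiation exterior :: (type, comm_ring_1) monoid_mult
begin

lift_definition one_exterior :: "('a, 'b) exterior" is 1 .

instance
  by standard (transfer, simp add: exterior_rel_def exterior_ideal.zero)+

end

lift_definition exterior_gen :: "'s \<Rightarrow> ('s, 'r::comm_ring_1) exterior" is
  "\<lambda>s. Poly_Mapping.single [s] 1" .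

lift_definition exterior_scale ::
    "'r::comm_ring_1 \<Rightarrow> ('s, 'r) exterior \<Rightarrow> ('s, 'r) exterior" is
  "\<lambda>r p. Poly_Mapping.single [] r * p"
  by (simp add: exterior_rel_def exterior_ideal_mult_left flip: right_diff_distrib)


section \<open>The labeling homomorphism\<close>

text \<open>\<open>e\<^sup>0\<^sub>i x = d\<^sup>1\<^sub>1 \<dots> d\<^sup>1\<^sub>i\<^sub>-\<^sub>1 d\<^sup>1\<^sub>i\<^sub>+\<^sub>1 \<dots> d\<^sup>1\<^sub>n x\<close>, the operator with the largest index acting first\<close>

definition edge0 :: "('a, 'z) precubical_scheme \<Rightarrow> nat \<Rightarrow> 'a \<Rightarrow> 'a" where
  "edge0 P i x = foldr (bd P True) (filter (\<lambda>j. j \<noteq> i) [1..<Suc (deg P x)]) x"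

text \<open>The multi-index \<open>js\<close> below runs over \<open>(j\<^sub>1, \<dots>, j\<^sub>n)\<close>, counted from 0. For a vertex \<open>x\<close>
  the value is the empty product 1.\<close>

definition label_value :: "('a, 's list) hda \<Rightarrow> 'a \<Rightarrow> ('s, 'r::comm_ring_1) exterior" where
  "label_value A x =
     (let ms = map (\<lambda>i. label A (edge0 A i x)) [1..<Suc (deg A x)]
      in \<Sum>js \<in> listset (map (\<lambda>m. {..<length m}) ms).
           prod_list (map2 (\<lambda>m j. exterior_gen (m ! j)) ms js))"

definition label_cochain ::
    "('a, 's list) hda \<Rightarrow> nat \<Rightarrow> ('a \<Rightarrow>\<^sub>0 'r::comm_ring_1) \<Rightarrow> ('s, 'r) exterior" where
  "label_cochain A n c = (\<Sum>x \<in> {x \<in> Poly_Mapping.keys c. deg A x = n}.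
     exterior_scale (Poly_Mapping.lookup c x) (label_value A x))"

text \<open>On a class \<open>\<alpha> = [z]\<close>, with \<open>z\<close> the sum of its components in degrees \<open>n\<close>, the value is
  \<open>\<Sum>\<^sub>n \<ll>\<^sup>n(z)\<close>; all representatives \<open>z\<close> give the same value, as each \<open>\<ll>\<^sup>n\<close> is a cocycle.\<close>

definition labeling_hom ::
    "('a, 's list) hda \<Rightarrow> ('a \<Rightarrow>\<^sub>0 'r::comm_ring_1) set \<Rightarrow> ('s, 'r) exterior" where
  "labeling_hom A \<alpha> =
     the_elem ((\<lambda>z. \<Sum>n \<in> deg A ` Poly_Mapping.keys z. label_cochain A n z) ` \<alpha>)"

end

theory Submission
  imports Defs "HOL-Library.Confluence" "Jordan_Normal_Form.Determinant"
begin

text \<open>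
  An elementary cubical dimap \<open>f\<close> subdivides every cube \<open>x\<close> into a grid, up to a permutation
  \<open>\<sigma>\<close> of the coordinates. Sending \<open>x\<close> to \<open>sgn \<sigma>\<close> times the sum of the top cubes of its grid is a
  chain map: interior faces cancel in pairs, and the remaining ones are the subdivided faces of
  \<open>x\<close>, because the subdivision data of a cube are determined by \<open>f\<close> (the normal form of a point
  of the realization is unique). Since the labels along the edges of the grid concatenate to the
  labels of the edges of \<open>x\<close>, expanding the exterior product of the letter sums shows that this
  chain map preserves labels. So labels of homology classes are carried along every cubical dimap,
  whether or not it is a homeomorphism, and the class \<open>\<alpha>\<close> is the image of the cross product of
  representatives of the \<open>\<beta>\<^sub>i\<close>, on which the label is multiplicative.
\<close>

text \<open>An elementary cubical dimap comes with subdivision data for each cube separately.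
  Nothing in the definition says that the data of a face are cut out of the data of the cube, and a
  chain map needs exactly that. Uniqueness also governs labels: a dimap respects labels through the
  image of a path, and that image is given by a definite description. The sign is forced by
  orientation. Direction \<open>i\<close> of the grid is direction \<open>\<sigma> i\<close> of the
  cube, and matching (-1)^i with (-1)^(\<sigma> i) is the cofactor rule for the sign of a
  permutation with one entry deleted. Reordering the factors of an exterior product produces the
  same sign once more, so it cancels on labels. The label of an n-cube is read off n edges, those
  that end in its last vertex, whereas a dimap controls labels edge by edge all over the grid. The
  bridge is that parallel edges of a cube carry equal labels, which the axioms grant only for
  squares.\<close>

section \<open>Inserting and deleting a coordinate\<close>

definition insert_at :: "nat \<Rightarrow> 'a \<Rightarrow> 'a list \<Rightarrow> 'a list" where
  "insert_at i v xs = take i xs @ v # drop i xs"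

definition delete_at :: "nat \<Rightarrow> 'a list \<Rightarrow> 'a list" where
  "delete_at i xs = take i xs @ drop (Suc i) xs"

lemma length_insert_at [simp]: "length (insert_at i v xs) = Suc (length xs)"
  by (simp add: insert_at_def)

lemma length_delete_at: "i < length xs \<Longrightarrow> length (delete_at i xs) = length xs - 1"
  by (simp add: delete_at_def)

lemma set_insert_at [simp]: "set (insert_at i v xs) = insert v (set xs)"
proof -
  have "set xs = set (take i xs) \<union> set (drop i xs)"
    by (metis append_take_drop_id set_append)
  then show ?thesis
    by (auto simp: insert_at_def)
qed

lemma map_insert_at: "map h (insert_at i v xs) = insert_at i (h v) (map h xs)"
  by (simp add: insert_at_def take_map drop_map)

lemma nth_insert_at:
  "i \<le> length xs \<Longrightarrow> insert_at i v xs ! j = (if j < i then xs ! j else if j = i then v else xs !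
      (j - 1))"
  by (auto simp: insert_at_def nth_append nth_Cons' min_def)

lemma nth_delete_at:
  "i < length xs \<Longrightarrow> j < length xs - 1 \<Longrightarrow>
    delete_at i xs ! j = xs ! (if j < i then j else Suc j)"
  by (auto simp: delete_at_def nth_append min_def)

text \<open>\<open>insert_index i\<close> is the increasing enumeration of the numbers other than
  \<open>i\<close>. It tells where the old entries land, and it is also the renumbering built into
  \<open>permutation_delete\<close>.\<close>

lemma nth_insert_at_insert_index:
  "i \<le> length xs \<Longrightarrow> j < length xs \<Longrightarrow> insert_at i v xs ! insert_index i j = xs ! j"
  by (auto simp: nth_insert_at insert_index_def)

lemma nth_delete_at_insert_index:
  "i < length xs \<Longrightarrow> j < length xs - 1 \<Longrightarrow> delete_at i xs ! j = xs ! insert_index i j"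
  by (simp add: nth_delete_at insert_index_def)

lemma insert_at_Suc_Cons [simp]: "insert_at (Suc i) v (x # xs) = x # insert_at i v xs"
  by (simp add: insert_at_def)

lemma insert_at_0 [simp]: "insert_at 0 v xs = v # xs"
  by (simp add: insert_at_def)

lemma delete_at_Suc_Cons [simp]: "delete_at (Suc i) (x # xs) = x # delete_at i xs"
  by (simp add: delete_at_def)

lemma delete_at_0_Cons [simp]: "delete_at 0 (x # xs) = xs"
  by (simp add: delete_at_def)

lemma insert_at_delete_at: "i < length xs \<Longrightarrow> insert_at i (xs ! i) (delete_at i xs) = xs"
  by (simp add: insert_at_def delete_at_def min_def id_take_nth_drop[symmetric])

lemma delete_at_insert_at [simp]: "i \<le> length xs \<Longrightarrow> delete_at i (insert_at i v xs) = xs"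
  by (simp add: insert_at_def delete_at_def min_def)

text \<open>Geometrically, a point on two faces of a cube in different directions lies on their
  common face of codimension two, and \<open>w\<close> collects its coordinates there.\<close>

lemma insert_at_eq_insert_at:
  assumes "insert_at a p u = insert_at b q v" "a < b" "b \<le> length v"
  obtains w where "u = insert_at (b - 1) q w" "v = insert_at a p w" "length w = length v - 1"
proof -
  have len: "length u = length v"
    using arg_cong[OF assms(1), of length] by simp
  have nth: "insert_at a p u ! j = insert_at b q v ! j" for j
    using assms(1) by simp
  have va: "v ! a = p"
    using nth[of a] assms(2,3) len by (simp add: nth_insert_at)
  define w where "w = delete_at a v"
  have v: "v = insert_at a p w"
    unfolding w_def va[symmetric] using assms by (simp add: insert_at_delete_at)
  have lw: "length w = length v - 1"
    using assms by (simp add: w_def length_delete_at)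
  have "u = insert_at (b - 1) q w"
  proof (rule nth_equalityI)
    show "length u = length (insert_at (b - 1) q w)"
      using lw len assms by simp
    fix j assume j: "j < length u"
    show "u ! j = insert_at (b - 1) q w ! j"
    proof (cases "j < a")
      case True
      moreover have "j < b - 1"
        using True assms(2) by linarith
      ultimately show ?thesis
        using nth[of j] assms(2,3) len lw j by (simp add: nth_insert_at w_def nth_delete_at)
    next
      case False
      then have "u ! j = insert_at b q v ! Suc j"
        using nth[of "Suc j"] assms(2,3) len j by (simp add: nth_insert_at)
      moreover obtain c where "b = Suc c"
        using assms(2) by (cases b) auto
      ultimately show ?thesis
        using False assms(2,3) len lw j by (auto simp: nth_insert_at w_def nth_delete_at)
    qed
  qed
  with v lw that show thesis by blast
qed

lemma coface_eq_insert_at: "coface k i u = insert_at (i - 1) (of_bool k) u"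
  by (simp add: coface_def insert_at_def)

lemma unit_cube_iff: "u \<in> unit_cube n \<longleftrightarrow> length u = n \<and> set u \<subseteq> {0..1}"
  by (simp add: unit_cube_def)


section \<open>Normal forms in the geometric realization\<close>

text \<open>The gluing relation oriented as a rewrite step: a coordinate 0 or 1 is dropped and the
  cube replaced by its face. Irreducible pairs then serve as normal forms of points.\<close>

definition face_step ::
    "('a, 'z) precubical_scheme \<Rightarrow> 'a \<times> real list \<Rightarrow> 'a \<times> real list \<Rightarrow> bool" where
  "face_step P p q \<longleftrightarrow> (q, p) \<in> realization_rel P"

lemma face_stepE:
  assumes "face_step P p q"
  obtains k i x u where "p = (x, coface k i u)" "q = (bd P k i x, u)"
    "x \<in> cubes P" "1 \<le> i" "i \<le> deg P x" "u \<in> unit_cube (deg P x - 1)"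
  using assms by (auto simp: face_step_def realization_rel_def)

lemma face_stepI:
  "x \<in> cubes P \<Longrightarrow> 1 \<le> i \<Longrightarrow> i \<le> deg P x \<Longrightarrow> u \<in> unit_cube (deg P x - 1) \<Longrightarrow>
    face_step P (x, coface k i u) (bd P k i x, u)"
  by (auto simp: face_step_def realization_rel_def)

lemma precubical_set_bd:
  assumes "precubical_set P" "x \<in> cubes P" "1 \<le> i" "i \<le> deg P x"
  shows "bd P k i x \<in> cubes P" "deg P (bd P k i x) = deg P x - 1"
  using assms by (auto simp: precubical_set_def)

lemma precubical_set_bd_bd:
  assumes "precubical_set P" "x \<in> cubes P" "1 \<le> i" "i < j" "j \<le> deg P x"
  shows "bd P k i (bd P l j x) = bd P l (j - 1) (bd P k i x)"
  using assms by (auto simp: precubical_set_def)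

text \<open>Dropping two different coordinates in either order ends in the same pair, the cubes
  agreeing by the precubical identity. If both steps drop the same coordinate, its value determines
  which of the two faces is taken, so the steps coincide.\<close>

lemma face_step_diamond:
  assumes P: "precubical_set P" and "face_step P p q" "face_step P p r"
  shows "\<exists>s. (face_step P)\<^sup>=\<^sup>= q s \<and> (face_step P)\<^sup>=\<^sup>= r s"
proof -
  have *: "\<exists>s. face_step P (bd P k i x, u) s \<and> face_step P (bd P l j x, v) s"
    if x: "x \<in> cubes P" and ij: "1 \<le> i" "i < j" "j \<le> deg P x"
      and u: "u \<in> unit_cube (deg P x - 1)" and v: "v \<in> unit_cube (deg P x - 1)"
      and eq: "coface k i u = coface l j v"
    for k l i j x u v
  proof -
    have len: "length u = deg P x - 1" "length v = deg P x - 1"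
      using u v by (auto simp: unit_cube_iff)
    have "i - 1 < j - 1" "j - 1 \<le> length v"
      using ij len by auto
    then obtain w where w: "u = insert_at (j - 1 - 1) (of_bool l) w"
        "v = insert_at (i - 1) (of_bool k) w" "length w = length v - 1"
      by (rule insert_at_eq_insert_at[OF eq[unfolded coface_eq_insert_at]])
    have ww: "w \<in> unit_cube (deg P x - 1 - 1)"
      using v len(2) unfolding w(2) by (auto simp: unit_cube_iff)
    have "face_step P (bd P k i x, u) (bd P l (j - 1) (bd P k i x), w)"
      unfolding w(1) coface_eq_insert_at[symmetric]
      using x ij ww P by (intro face_stepI) (auto simp: precubical_set_bd)
    moreover have "face_step P (bd P l j x, v) (bd P k i (bd P l j x), w)"
      unfolding w(2) coface_eq_insert_at[symmetric]
      using x ij ww P by (intro face_stepI) (auto simp: precubical_set_bd)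
    ultimately show ?thesis
      unfolding precubical_set_bd_bd[OF P x ij] by (intro exI conjI)
  qed
  obtain k i x u where q: "p = (x, coface k i u)" "q = (bd P k i x, u)"
    "x \<in> cubes P" "1 \<le> i" "i \<le> deg P x" "u \<in> unit_cube (deg P x - 1)"
    using assms(2) by (rule face_stepE)
  obtain l j v where r: "p = (x, coface l j v)" "r = (bd P l j x, v)"
    "1 \<le> j" "j \<le> deg P x" "v \<in> unit_cube (deg P x - 1)"
    using assms(3) q(1) by (auto elim: face_stepE)
  have eq: "coface k i u = coface l j v"
    using q r by simp
  consider "i < j" | "j < i" | "i = j" by linarith
  then show ?thesis
  proof cases
    case 1
    then show ?thesis using *[OF q(3,4) 1 r(4) q(6) r(5) eq] q(2) r(2) by auto
  next
    case 2
    then show ?thesis using *[OF q(3) r(3) 2 q(5) r(5) q(6) eq[symmetric]] q(2) r(2) by auto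
  next
    case 3
    have len: "length u = deg P x - 1" "length v = deg P x - 1"
      using q r by (auto simp: unit_cube_iff)
    have "(of_bool k :: real) = of_bool l"
      using arg_cong[OF eq, of "\<lambda>w. w ! (i - 1)"] q len 3
      by (simp add: coface_eq_insert_at nth_insert_at)
    then have "k = l" by (simp add: of_bool_eq_iff)
    moreover have "u = v"
      using arg_cong[OF eq, of "delete_at (i - 1)"] q len 3
      by (simp add: coface_eq_insert_at)
    ultimately show ?thesis using q r 3 by auto
  qed
qed

text \<open>The diamond closes with at most one step on each side, so strong confluence applies and
  no termination argument enters.\<close>

lemma face_step_confluent:
  assumes "precubical_set P"
  shows "confluentp (face_step P)"
proof (rule strong_confluentp_imp_confluentp, rule strong_confluentpI)
  fix p q r assume "face_step P p q" "face_step P p r"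
  then obtain s where "(face_step P)\<^sup>=\<^sup>= q s" "(face_step P)\<^sup>=\<^sup>= r s"
    using face_step_diamond[OF assms] by blast
  then show "\<exists>s. (face_step P)\<^sup>*\<^sup>* q s \<and> (face_step P)\<^sup>=\<^sup>= r s"
    by blast
qed

lemma realization_equiv_iff: "(p, q) \<in> realization_equiv P \<longleftrightarrow> equivclp (face_step P) p q"
proof -
  have eq: "{(p, q). symclp (face_step P) p q} = realization_rel P \<union> (realization_rel P)\<inverse>"
    by (auto simp: symclp_def face_step_def)
  show ?thesis
    unfolding equivclp_def realization_equiv_def rtranclp_rtrancl_eq eq ..
qed

lemma pt_eq_iff: "pt P x u = pt P y v \<longleftrightarrow> ((x, u), (y, v)) \<in> realization_equiv P"
proof
  assume "pt P x u = pt P y v"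
  moreover have "(y, v) \<in> pt P y v"
    by (simp add: pt_def realization_equiv_iff)
  ultimately have "(y, v) \<in> pt P x u"
    by simp
  then show "((x, u), (y, v)) \<in> realization_equiv P"
    by (simp add: pt_def)
next
  assume "((x, u), (y, v)) \<in> realization_equiv P"
  then show "pt P x u = pt P y v"
    unfolding pt_def realization_equiv_iff Image_def
    by (auto simp: realization_equiv_iff intro: equivclp_trans equivclp_sym)
qed

lemma face_step_normal:
  assumes "face_step P (x, u) q" "set u \<subseteq> {0<..<1}"
  shows False
  using assms by (elim face_stepE) (auto simp: coface_eq_insert_at)

text \<open>By the Church-Rosser property two equivalent pairs have a common reduct. Coordinates
  strictly between 0 and 1 admit no step, so both pairs equal that reduct.\<close>

lemma pt_inject:
  assumes P: "precubical_set P" and "set u \<subseteq> {0<..<1}" "set v \<subseteq> {0<..<1}"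
    and "pt P x u = pt P y v"
  shows "x = y \<and> u = v"
proof -
  have "equivclp (face_step P) (x, u) (y, v)"
    using assms(4) by (simp add: pt_eq_iff realization_equiv_iff)
  then have "((face_step P)\<^sup>*\<^sup>* OO (face_step P)\<inverse>\<inverse>\<^sup>*\<^sup>*) (x, u) (y, v)"
    using semiconfluentp_equivclp confluentp_imp_semiconfluentp face_step_confluent[OF P] by metis
  then obtain s where s: "(face_step P)\<^sup>*\<^sup>* (x, u) s" "(face_step P)\<^sup>*\<^sup>* (y, v) s"
    by (auto simp: rtranclp_conversep)
  have "s = (x, u)"
    using s(1) assms(2) by (cases rule: converse_rtranclpE) (auto dest: face_step_normal)
  moreover have "s = (y, v)"
    using s(2) assms(3) by (cases rule: converse_rtranclpE) (auto dest: face_step_normal)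
  ultimately show ?thesis by simp
qed

lemma pt_bd:
  assumes "x \<in> cubes P" "1 \<le> i" "i \<le> deg P x" "u \<in> unit_cube (deg P x - 1)"
  shows "pt P (bd P k i x) u = pt P x (coface k i u)"
  using face_stepI[OF assms, of k]
  by (auto simp: pt_eq_iff realization_equiv_iff intro: equivclp_sym)

text \<open>A morphism carries face steps to face steps, so all representatives of a point have the
  same image and \<open>the_elem\<close> is applied to a singleton.\<close>

lemma realization_map_pt:
  assumes g: "precubical_morphism P Q g"
  shows "realization_map Q g (pt P x u) = pt Q (g x) u"
proof -
  have "face_step Q (g y, v) (g z, w)" if "face_step P (y, v) (z, w)" for y z v w
    using that g by (auto elim!: face_stepE simp: precubical_morphism_def intro!: face_stepI)
  then have step: "equivclp (face_step Q) (g y, v) (g z, w)"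
    if "symclp (face_step P) (y, v) (z, w)" for y z v w
    using that by (auto simp: symclp_def intro: equivclp_sym)
  have *: "equivclp (face_step Q) (g x, u) (g (fst q), snd q)"
    if "equivclp (face_step P) (x, u) q" for q
    using that unfolding equivclp_def[of "face_step P"]
  proof (induction rule: rtranclp_induct)
    case (step q r)
    then show ?case
      using \<open>\<And>z y w v. symclp (face_step P) (y, v) (z, w) \<Longrightarrow> _\<close>[of "fst q" "snd q" "fst r" "snd r"]
      by (auto intro: equivclp_trans)
  qed simp
  have "(\<lambda>(y, v). pt Q (g y) v) ` pt P x u = (\<lambda>_. pt Q (g x) u) ` pt P x u"
  proof (rule image_cong[OF refl])
    fix q assume "q \<in> pt P x u"
    then have "equivclp (face_step Q) (g x, u) (g (fst q), snd q)"
      using *[of q] by (simp add: pt_def realization_equiv_iff)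
    from equivclp_sym[OF this] show "(case q of (y, v) \<Rightarrow> pt Q (g y) v) = pt Q (g x) u"
      by (simp only: pt_eq_iff realization_equiv_iff case_prod_unfold)
  qed
  also have "\<dots> = {pt Q (g x) u}"
    by (rule image_constant[of "(x, u)"]) (simp add: pt_def realization_equiv_iff)
  finally have "(\<lambda>(y, v). pt Q (g y) v) ` pt P x u = {pt Q (g x) u}" .
  then show ?thesis
    by (simp add: realization_map_def)
qed

section \<open>Grids\<close>

lemma cubes_grid_Nil [simp]: "cubes (grid []) = {[]}"
  by (simp add: grid_def tensor_pcs_def)

lemma deg_grid_Nil [simp]: "deg (grid ls) [] = 0"
  by (simp add: grid_def tensor_pcs_def)

lemma Cons_in_cubes_grid [simp]:
  "c # cs \<in> cubes (grid (l # ls)) \<longleftrightarrow> c \<in> cubes (interval_pcs 0 l) \<and> cs \<in> cubes (grid ls)"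
  by (simp add: grid_def tensor_pcs_def set_Cons_def)

lemma Nil_notin_cubes_grid [simp]: "[] \<notin> cubes (grid (l # ls))"
  by (simp add: grid_def tensor_pcs_def set_Cons_def)

lemma deg_grid_Cons [simp]:
  "deg (grid (l # ls)) (c # cs) = (case c of Vertex _ \<Rightarrow> 0 | Edge _ \<Rightarrow> 1) + deg (grid ls) cs"
  by (simp add: grid_def tensor_pcs_def interval_pcs_def)

lemma bd_grid_Vertex [simp]:
  "0 < i \<Longrightarrow> bd (grid (l # ls)) k i (Vertex v # cs) = Vertex v # bd (grid ls) k i cs"
  by (simp add: grid_def tensor_pcs_def interval_pcs_def)

lemma bd_grid_Edge_1 [simp]:
  "bd (grid (l # ls)) k (Suc 0) (Edge j # cs) = Vertex (if k then j else j - 1) # cs"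
  by (simp add: grid_def tensor_pcs_def interval_pcs_def)

lemma bd_grid_Edge_Suc [simp]:
  "0 < i \<Longrightarrow> bd (grid (l # ls)) k (Suc i) (Edge j # cs) = Edge j # bd (grid ls) k i cs"
  by (simp add: grid_def tensor_pcs_def interval_pcs_def)

lemma cubes_interval [simp]:
  "Vertex v \<in> cubes (interval_pcs k l) \<longleftrightarrow> k \<le> v \<and> v \<le> l"
  "Edge v \<in> cubes (interval_pcs k l) \<longleftrightarrow> k < v \<and> v \<le> l"
  by (auto simp: interval_pcs_def)

lemma insert_Vertex_in_grid:
  "i < length ls \<Longrightarrow> 0 \<le> v \<Longrightarrow> v \<le> ls ! i \<Longrightarrow> c \<in> cubes (grid (delete_at i ls)) \<Longrightarrow>
    insert_at i (Vertex v) c \<in> cubes (grid ls)"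
proof (induction i arbitrary: ls c)
  case 0
  then show ?case by (cases ls) auto
next
  case (Suc i)
  then show ?case by (cases ls; cases c) auto
qed

lemma deg_insert_Vertex:
  "i < length ls \<Longrightarrow> c \<in> cubes (grid (delete_at i ls)) \<Longrightarrow>
    deg (grid ls) (insert_at i (Vertex v) c) = deg (grid (delete_at i ls)) c"
proof (induction i arbitrary: ls c)
  case 0
  then show ?case by (cases ls) auto
next
  case (Suc i)
  then show ?case by (cases ls; cases c) auto
qed

lemma bd_insert_Vertex:
  "i < length ls \<Longrightarrow> c \<in> cubes (grid (delete_at i ls)) \<Longrightarrow> 0 < m \<Longrightarrow>
    m \<le> deg (grid (delete_at i ls)) c \<Longrightarrow>
    bd (grid ls) k m (insert_at i (Vertex v) c) =
      insert_at i (Vertex v) (bd (grid (delete_at i ls)) k m c)"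
proof (induction i arbitrary: ls c m)
  case 0
  then show ?case by (cases ls) auto
next
  case (Suc i)
  show ?case
  proof (cases ls)
    case (Cons l ls')
    show ?thesis
    proof (cases c)
      case Nil
      then show ?thesis using Suc.prems Cons by auto
    next
      case c: (Cons a cs)
      show ?thesis
      proof (cases a)
        case (Vertex w)
        then show ?thesis using Suc Cons c by auto
      next
        case (Edge w)
        obtain m' where "m = Suc m'" using Suc.prems by (cases m) auto
        then show ?thesis using Suc Cons c Edge by (cases m') auto
      qed
    qed
  qed (use Suc.prems in auto)
qed

text \<open>This is the inclusion of the slice of the grid on which coordinate \<open>i\<close> is
  constantly \<open>v\<close>. The slices with \<open>v\<close> equal to 0 or \<open>ls ! i\<close>
  subdivide the faces of a cube.\<close>

lemma precubical_morphism_insert_Vertex: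
  assumes "i < length ls" "0 \<le> v" "v \<le> ls ! i"
  shows "precubical_morphism (grid (delete_at i ls)) (grid ls) (insert_at i (Vertex v))"
  using assms
  by (auto simp: precubical_morphism_def insert_Vertex_in_grid deg_insert_Vertex bd_insert_Vertex)

lemma precubical_morphism_comp:
  assumes "precubical_morphism P Q g" "precubical_morphism Q R h"
  shows "precubical_morphism P R (h \<circ> g)"
  using assms by (auto simp: precubical_morphism_def)

text \<open>The index set of the top cubes of a grid: \<open>js\<close> stands for
  \<open>map Edge js\<close>, the product of the edges from \<open>js ! i - 1\<close> to
  \<open>js ! i\<close>.\<close>

definition grid_box :: "int list \<Rightarrow> int list set" where
  "grid_box ls = listset (map (\<lambda>l. {1..l}) ls)"

lemma grid_box_Nil [simp]: "grid_box [] = {[]}"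
  by (simp add: grid_box_def)

lemma Cons_in_grid_box [simp]: "j # js \<in> grid_box (l # ls) \<longleftrightarrow> 1 \<le> j \<and> j \<le> l \<and> js \<in> grid_box ls"
  by (auto simp: grid_box_def set_Cons_def)

lemma grid_box_Cons: "grid_box (l # ls) = (\<lambda>(j, js). j # js) ` ({1..l} \<times> grid_box ls)"
  by (auto simp: grid_box_def set_Cons_def)

lemma finite_grid_box [simp]: "finite (grid_box ls)"
  by (induction ls) (auto simp: grid_box_Cons)

lemma in_grid_box_iff:
  "js \<in> grid_box ls \<longleftrightarrow> length js = length ls \<and> (\<forall>i < length ls. 1 \<le> js ! i \<and> js ! i \<le> ls ! i)"
proof (induction ls arbitrary: js)
  case (Cons l ls)
  show ?case
  proof (cases js)
    case Nil
    then show ?thesis by (auto simp: grid_box_def set_Cons_def)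
  next
    case (Cons j js')
    then show ?thesis using Cons.IH[of js'] by (auto simp: All_less_Suc2)
  qed
qed auto

lemma map_Edge_in_grid:
  "js \<in> grid_box ls \<Longrightarrow> map Edge js \<in> cubes (grid ls) \<and> deg (grid ls) (map Edge js) = length ls"
proof (induction ls arbitrary: js)
  case (Cons l ls)
  then show ?case by (auto simp: grid_box_Cons)
qed auto

text \<open>Every factor of a top cube has degree 1, so list position \<open>i\<close> is direction
  \<open>Suc i\<close>.\<close>

lemma bd_top_cube:
  "i \<le> length js \<Longrightarrow> length ls = Suc (length js) \<Longrightarrow>
    bd (grid ls) k (Suc i) (map Edge (insert_at i j js)) =
      insert_at i (Vertex (if k then j else j - 1)) (map Edge js)"
proof (induction i arbitrary: ls js)
  case 0
  then show ?case by (cases ls) auto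
next
  case (Suc i)
  then show ?case by (cases ls; cases js) auto
qed

lemma insert_at_in_grid_box:
  assumes "i < length ls"
  shows "insert_at i j js \<in> grid_box ls \<longleftrightarrow> 1 \<le> j \<and> j \<le> ls ! i \<and> js \<in> grid_box (delete_at i ls)"
  using assms
proof (induction i arbitrary: ls js)
  case 0
  then show ?case by (cases ls) auto
next
  case (Suc i)
  then obtain l ls' where ls: "ls = l # ls'" by (cases ls) auto
  show ?case
  proof (cases js)
    case Nil
    then show ?thesis
      using Suc.prems ls by (auto simp: in_grid_box_iff length_delete_at)
  next
    case (Cons a js')
    then show ?thesis using Suc ls by auto
  qed
qed

text \<open>The top cubes are grouped into rows parallel to direction \<open>i\<close>; along such a
  row the boundary telescopes.\<close>

lemma sum_grid_box_insert_at:
  fixes h :: "int list \<Rightarrow> 'b :: comm_monoid_add"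
  assumes i: "i < length ls"
  shows "(\<Sum>js \<in> grid_box ls. h js) = (\<Sum>js \<in> grid_box (delete_at i ls). \<Sum>j = 1..ls ! i. h
      (insert_at i j js))"
proof -
  have "(\<Sum>js \<in> grid_box (delete_at i ls). \<Sum>j = 1..ls ! i. h (insert_at i j js))
      = (\<Sum>(js, j) \<in> grid_box (delete_at i ls) \<times> {1..ls ! i}. h (insert_at i j js))"
    by (simp add: sum.cartesian_product)
  also have "\<dots> = (\<Sum>js \<in> grid_box ls. h js)"
  proof (rule sum.reindex_bij_witness[of _ "\<lambda>js. (delete_at i js, js ! i)" "\<lambda>(js, j). insert_at i
      j js"])
    fix p assume p: "p \<in> grid_box (delete_at i ls) \<times> {1..ls ! i}"
    then have "length (fst p) = length ls - 1"
      using i by (auto simp: in_grid_box_iff length_delete_at)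
    then show "(delete_at i (case p of (js, j) \<Rightarrow> insert_at i j js), (case p of (js, j) \<Rightarrow> insert_at
        i j js) ! i) = p"
      using i by (cases p) (auto simp: nth_insert_at)
    show "(case p of (js, j) \<Rightarrow> insert_at i j js) \<in> grid_box ls"
      using p i by (auto simp: insert_at_in_grid_box)
  next
    fix js assume js: "js \<in> grid_box ls"
    then have len: "length js = length ls" by (simp add: in_grid_box_iff)
    then show eq: "(case (delete_at i js, js ! i) of (js, j) \<Rightarrow> insert_at i j js) = js"
      using i by (simp add: insert_at_delete_at)
    then show "(delete_at i js, js ! i) \<in> grid_box (delete_at i ls) \<times> {1..ls ! i}"
      using js i insert_at_in_grid_box[OF i, of "js ! i" "delete_at i js"] by simp
  qed auto
  finally show ?thesis by simp
qed

lemma real_cell_of_int [simp]: "real_cell (of_int v) = Vertex v"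
  by (simp add: real_cell_def)

lemma real_coords_of_int [simp]: "real_coords (of_int v) = []"
  by (simp add: real_coords_def)

lemma real_cell_in_interval:
  assumes "0 \<le> t" "t \<le> of_int l"
  shows "real_cell t \<in> cubes (interval_pcs 0 l)"
proof -
  have "0 < t" if "t \<notin> \<int>" using that assms by (cases "t = 0") auto
  then show ?thesis
    using assms by (auto simp: real_cell_def floor_le_iff ceiling_le_iff)
qed

lemma concat_insert_at_Nil: "concat (insert_at i [] xss) = concat xss"
proof -
  have "concat (insert_at i [] xss) = concat (take i xss) @ concat (drop i xss)"
    by (simp add: insert_at_def)
  also have "\<dots> = concat xss"
    by (metis append_take_drop_id concat_append)
  finally show ?thesis .
qed

text \<open>An integer coordinate contributes no entry and any other its nonzero fractional part.
  Hence the points of a grid are presented in normal form.\<close>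

lemma set_concat_real_coords: "set (concat (map real_coords ts)) \<subseteq> {0<..<1}"
proof -
  have "set (real_coords t) \<subseteq> {0<..<1}" for t
    by (auto simp: real_coords_def frac_lt_1)
  then show ?thesis by (force simp: subset_iff)
qed


section \<open>Subdivision data of elementary cubical dimaps\<close>

lemma increasing_homeoD:
  assumes "increasing_homeo a b \<phi>" "0 \<le> a" "0 \<le> b"
  shows "continuous_on {0..a} \<phi>" "\<phi> ` {0..a} = {0..b}" "inj_on \<phi> {0..a}"
    "\<phi> 0 = 0" "\<phi> a = b"
proof -
  have hom: "homeomorphic_map (top_of_set {0..a}) (top_of_set {0..b}) \<phi>"
    using assms by (simp add: increasing_homeo_def)
  show "continuous_on {0..a} \<phi>"
    using homeomorphic_imp_continuous_map[OF hom] by (simp add: continuous_map_in_subtopology)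
  show im: "\<phi> ` {0..a} = {0..b}" and "inj_on \<phi> {0..a}"
    using homeomorphic_imp_surjective_map[OF hom] homeomorphic_imp_injective_map[OF hom] by auto
  have mono: "strict_mono_on {0..a} \<phi>" using assms by (simp add: increasing_homeo_def)
  then have le: "\<phi> s \<le> \<phi> t" if "0 \<le> s" "s \<le> t" "t \<le> a" for s t
    using that by (cases "s = t") (auto intro!: less_imp_le dest!: strict_mono_onD[of _ _ s t])
  obtain s where s: "s \<in> {0..a}" "\<phi> s = 0"
    using im assms by (metis atLeastAtMost_iff image_iff order_refl)
  have "\<phi> 0 \<in> {0..b}"
    unfolding im[symmetric] by (rule imageI) (use assms in auto)
  with s le[of 0 s] show "\<phi> 0 = 0" by simp
  obtain t where t: "t \<in> {0..a}" "\<phi> t = b"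
    using im assms by (metis atLeastAtMost_iff image_iff order_refl)
  have "\<phi> a \<in> {0..b}"
    unfolding im[symmetric] by (rule imageI) (use assms in auto)
  with t le[of t a] show "\<phi> a = b" by simp
qed

text \<open>The subdivision clause of a dimap with the realization of \<open>g\<close> evaluated, so
  that its right-hand side is the normal form of f [x, u]. The homeomorphisms stay hidden because
  the chain map depends only on \<open>ls\<close>, \<open>g\<close> and
  \<open>\<sigma>\<close>.\<close>

definition dimap_data ::
    "(('a \<times> real list) set \<Rightarrow> ('b \<times> real list) set) \<Rightarrow> ('a, 'y) precubical_scheme \<Rightarrow>
     ('b, 'z) precubical_scheme \<Rightarrow> 'a \<Rightarrow> int list \<Rightarrow> (icube list \<Rightarrow> 'b) \<Rightarrow> (nat \<Rightarrow> nat) \<Rightarrow> bool" where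
  "dimap_data f Q P x ls g \<sigma> \<longleftrightarrow>
     length ls = deg Q x \<and> (\<forall>l \<in> set ls. 1 \<le> l) \<and> precubical_morphism (grid ls) P g \<and>
     \<sigma> permutes {..<deg Q x} \<and>
     (\<exists>\<phi>. (\<forall>i < deg Q x. increasing_homeo 1 (of_int (ls ! i)) (\<phi> i)) \<and>
       (\<forall>u \<in> unit_cube (deg Q x).
         f (pt Q x u) = pt P (g (map real_cell (map (\<lambda>i. \<phi> i (u ! \<sigma> i)) [0..<deg Q x])))
           (concat (map real_coords (map (\<lambda>i. \<phi> i (u ! \<sigma> i)) [0..<deg Q x])))))"

text \<open>Vertices have a clause of their own in the definition. Giving them the empty grid, whose
  only cube is \<open>[]\<close>, lets the faces of edges be treated like all others.\<close>

lemma elementary_cubical_dimap_data: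
  assumes f: "elementary_cubical_dimap Q P f" and x: "x \<in> cubes Q"
  shows "\<exists>ls g \<sigma>. dimap_data f Q P x ls g \<sigma>"
proof (cases "deg Q x = 0")
  case True
  then obtain w where w: "w \<in> cubes_of_deg P 0" "f (pt Q x []) = pt P w []"
    using f x unfolding elementary_cubical_dimap_def cubes_of_deg_def by blast
  have "dimap_data f Q P x [] (\<lambda>_. w) id"
    using w True
    by (auto simp: dimap_data_def precubical_morphism_def cubes_of_deg_def unit_cube_iff
        permutes_id)
  then show ?thesis by blast
next
  case False
  then have "0 < deg Q x" and x': "x \<in> cubes_of_deg Q (deg Q x)"
    using x by (auto simp: cubes_of_deg_def)
  note f[unfolded elementary_cubical_dimap_def, THEN conjunct2, THEN conjunct2, THEN conjunct2,
      THEN conjunct2, THEN spec, THEN mp, OF this(1), THEN bspec, OF this(2)]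
  then obtain ls g \<sigma> \<phi> where *: "length ls = deg Q x" "\<forall>l \<in> set ls. 1 \<le> l"
    "precubical_morphism (grid ls) P g" "\<sigma> permutes {..<deg Q x}"
    "\<forall>i<deg Q x. increasing_homeo 1 (of_int (ls ! i)) (\<phi> i)"
    "\<forall>u \<in> unit_cube (deg Q x). f (pt Q x u) =
       realization_map P g (grid_point ls (map (\<lambda>i. \<phi> i (u ! \<sigma> i)) [0..<deg Q x]))"
    by (elim exE conjE) (rule that)
  then have "dimap_data f Q P x ls g \<sigma>"
    unfolding dimap_data_def grid_point_def realization_map_pt[OF *(3)] by blast
  then show ?thesis by blast
qed

text \<open>The positions of a list are \<open>i\<close> and the values of
  \<open>insert_index i\<close>.\<close>

lemma eq_insert_atI:
  assumes "length xs = Suc (length ys)" "i \<le> length ys" "xs ! i = v"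
    and "\<And>j. j < length ys \<Longrightarrow> xs ! insert_index i j = ys ! j"
  shows "xs = insert_at i v ys"
proof (rule nth_equalityI)
  fix j assume j: "j < length xs"
  show "xs ! j = insert_at i v ys ! j"
  proof (cases j i rule: linorder_cases)
    case less
    then show ?thesis
      using assms(1,2) assms(4)[of j] by (simp add: nth_insert_at insert_index_def)
  next
    case equal
    then show ?thesis
      using assms(2,3) by (simp add: nth_insert_at)
  next
    case greater
    then obtain m where "j = Suc m" by (cases j) auto
    then show ?thesis
      using greater assms(1,2) assms(4)[of m] j by (simp add: nth_insert_at insert_index_def)
  qed
qed (use assms in simp)

lemma permutation_insert_insert_index:
  "permutation_insert i j p (insert_index i m) = insert_index j (p m)"
  by (simp add: permutation_insert_expand insert_index_def)

lemma permutation_delete_insert_index: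
  assumes "p permutes {0..<Suc n}" "i < Suc n"
  shows "p (insert_index i m) = insert_index (p i) (permutation_delete p i m)"
  using permutation_insert_insert_index[of i "p i" "permutation_delete p i" m]
  by (simp add: permutation_insert_delete[OF assms])

text \<open>Grid coordinate \<open>i\<close> is \<open>\<phi> i\<close> of cube coordinate
  \<open>\<sigma> i\<close>. Fixing the latter at 0 or 1 therefore fixes the former at the
  corresponding end of its range, and the other coordinates are related as before, up to renumbering
  on both sides.\<close>

lemma dimap_data_face:
  assumes D: "dimap_data f Q P x ls g \<sigma>" and Q: "precubical_set Q" and x: "x \<in> cubes Q"
    and i: "i < deg Q x"
  shows "dimap_data f Q P (bd Q k (Suc (\<sigma> i)) x) (delete_at i ls)
    (g \<circ> insert_at i (Vertex (if k then ls ! i else 0))) (permutation_delete \<sigma> i)"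
proof -
  obtain n where n: "deg Q x = Suc n" using i by (cases "deg Q x") auto
  obtain \<phi> where len: "length ls = Suc n" and ls: "\<forall>l \<in> set ls. 1 \<le> l"
    and g: "precubical_morphism (grid ls) P g" and s: "\<sigma> permutes {0..<Suc n}"
    and hom: "\<And>i. i < Suc n \<Longrightarrow> increasing_homeo 1 (of_int (ls ! i)) (\<phi> i)"
    and f: "\<And>u. u \<in> unit_cube (Suc n) \<Longrightarrow> f (pt Q x u) =
       pt P (g (map real_cell (map (\<lambda>i. \<phi> i (u ! \<sigma> i)) [0..<Suc n])))
           (concat (map real_coords (map (\<lambda>i. \<phi> i (u ! \<sigma> i)) [0..<Suc n])))"
    using D unfolding dimap_data_def n lessThan_atLeast0 by blast
  define v where "v = (if k then ls ! i else 0)"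
  define m where "m = Suc (\<sigma> i)"
  have si: "\<sigma> i < Suc n" using s i n by auto
  have m: "1 \<le> m" "m \<le> deg Q x" using si n by (auto simp: m_def)
  have li: "1 \<le> ls ! i" using ls len i n by simp
  have degb: "deg Q (bd Q k m x) = n"
    using precubical_set_bd[OF Q x m] n by simp
  have idx: "insert_index i j < Suc n" if "j < n" for j
    using that by (simp add: insert_index_def)
  have "set (delete_at i ls) \<subseteq> set ls"
    using set_take_subset[of i ls] set_drop_subset[of "Suc i" ls] by (auto simp: delete_at_def)
  moreover have "precubical_morphism (grid (delete_at i ls)) P (g \<circ> insert_at i (Vertex v))"
    using li i n len
    by (intro precubical_morphism_comp[OF precubical_morphism_insert_Vertex g]) (auto simp: v_def)
  moreover have "permutation_delete \<sigma> i permutes {0..<n}"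
    using permutation_delete_permutes[OF s] i n by simp
  moreover have "increasing_homeo 1 (of_int (delete_at i ls ! j)) (\<phi> (insert_index i j))" if "j <
      n" for j
    using hom[OF idx[OF that]] that len i n by (simp add: nth_delete_at_insert_index)
  moreover have "f (pt Q (bd Q k m x) u) =
       pt P ((g \<circ> insert_at i (Vertex v)) (map real_cell (map (\<lambda>j. \<phi> (insert_index i j)
           (u ! permutation_delete \<sigma> i j)) [0..<n])))
           (concat (map real_coords (map (\<lambda>j. \<phi> (insert_index i j) (u ! permutation_delete \<sigma> i j))
               [0..<n])))"
    if u: "u \<in> unit_cube n" for u
  proof -
    let ?u = "insert_at (\<sigma> i) (of_bool k) u"
    let ?ts = "map (\<lambda>j. \<phi> (insert_index i j) (u ! permutation_delete \<sigma> i j)) [0..<n]"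
    have lu: "length u = n" using u by (simp add: unit_cube_iff)
    have u': "?u \<in> unit_cube (Suc n)"
      using u by (auto simp: unit_cube_iff)
    \<comment> \<open>Increasing homeomorphisms preserve end points, so the restricted coordinate
      sits at a grid vertex and contributes no real coordinate.\<close>
    have "\<phi> i (of_bool k) = of_int v"
      using increasing_homeoD(4,5)[OF hom[of i]] i n li by (simp add: v_def)
    have "map (\<lambda>i. \<phi> i (?u ! \<sigma> i)) [0..<Suc n] = insert_at i (of_int v) ?ts"
    proof (rule eq_insert_atI)
      show "map (\<lambda>i. \<phi> i (?u ! \<sigma> i)) [0..<Suc n] ! i = of_int v"
        using i n si lu \<open>\<phi> i (of_bool k) = of_int v\<close> by (simp add: nth_insert_at del: upt_Suc)
      fix j assume "j < length ?ts"
      then have j: "j < n" by simp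
      have "permutation_delete \<sigma> i j < n"
        using permutation_delete_permutes[OF s] i n j by (metis atLeastLessThan_iff
            permutes_in_image zero_le)
      then show "map (\<lambda>i. \<phi> i (?u ! \<sigma> i)) [0..<Suc n] ! insert_index i j = ?ts ! j"
        using idx[OF j] j i n lu si permutation_delete_insert_index[OF s, of i j]
        by (simp add: nth_insert_at_insert_index del: upt_Suc)
    qed (use i n in auto)
    then have "f (pt Q x ?u) = pt P (g (insert_at i (Vertex v) (map real_cell ?ts)))
        (concat (map real_coords ?ts))"
      unfolding f[OF u'] by (simp add: map_insert_at concat_insert_at_Nil del: upt_Suc)
    moreover have "pt Q (bd Q k m x) u = pt Q x ?u"
      using pt_bd[OF x m, of u k] u n by (simp add: coface_eq_insert_at m_def)
    ultimately show ?thesis by simp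
  qed
  ultimately show ?thesis
    unfolding dimap_data_def m_def[symmetric] v_def[symmetric] degb lessThan_atLeast0
    using len ls i n
    by (intro conjI exI[of _ "\<lambda>j. \<phi> (insert_index i j)"]) (blast | simp add: length_delete_at)+
qed


section \<open>Uniqueness of subdivision data\<close>

lemma finite_increasing_homeo_vimage:
  assumes \<phi>: "increasing_homeo 1 (of_int l) \<phi>" "1 \<le> l" and S: "finite (S \<inter> {0..of_int l})"
  shows "finite {t \<in> {0..1}. \<phi> t \<in> S}"
proof (rule finite_imageD)
  show "finite (\<phi> ` {t \<in> {0..1}. \<phi> t \<in> S})"
    by (rule finite_subset[OF _ S]) (use increasing_homeoD(2)[OF \<phi>(1)] \<phi>(2) in auto)
  show "inj_on \<phi> {t \<in> {0..1}. \<phi> t \<in> S}"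
    by (rule inj_on_subset[OF increasing_homeoD(3)[OF \<phi>(1)]]) (use \<phi>(2) in auto)
qed

lemma finite_frac_vimage: "finite ({x. frac x = c} \<inter> {0..of_int l :: real})"
proof (rule finite_subset)
  show "{x. frac x = c} \<inter> {0..of_int l} \<subseteq> (\<lambda>z. c + of_int z) ` {0..l}"
  proof
    fix x assume x: "x \<in> {x. frac x = c} \<inter> {0..of_int l}"
    then have "x = c + of_int \<lfloor>x\<rfloor>" by (auto simp: frac_def)
    moreover have "\<lfloor>x\<rfloor> \<in> {0..l}" using x by (auto simp: floor_le_iff)
    ultimately show "x \<in> (\<lambda>z. c + of_int z) ` {0..l}" by blast
  qed
qed auto

text \<open>The difference of the two functions is an integer off a finite set. It is an integer
  everywhere, because the integers are closed and every point of the interval is a limit of other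
  points. Being continuous it is then constant, with value 0 at 0.\<close>

lemma frac_eq_imp_eq:
  fixes f g :: "real \<Rightarrow> real"
  assumes f: "continuous_on {0..1} f" and g: "continuous_on {0..1} g" and "f 0 = g 0"
    and fin: "finite ({0..1} - G)" and frac: "\<And>t. t \<in> G \<Longrightarrow> frac (f t) = frac (g t)"
    and t: "t \<in> {0..1}"
  shows "f t = g t"
proof -
  define h where "h = (\<lambda>t. f t - g t)"
  have h: "continuous_on {0..1} h"
    unfolding h_def by (intro continuous_on_diff f g)
  have hG: "h t \<in> \<int>" if "t \<in> G" for t
  proof -
    have "h t = of_int (\<lfloor>f t\<rfloor> - \<lfloor>g t\<rfloor>)"
      using frac[OF that] by (simp add: h_def frac_def)
    then show ?thesis by (simp only: Ints_of_int)
  qed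
  have hZ: "h t \<in> \<int>" if t: "t \<in> {0..1}" for t
  proof -
    have "closed ({0..1} \<inter> h -` \<int>)"
      by (rule continuous_closed_preimage[OF h]) (auto simp: closed_Ints)
    moreover have "t islimpt {0..1} \<inter> h -` \<int>"
    proof -
      have "t islimpt {0..1}"
        using t by (intro connected_imp_perfect) auto
      moreover have "{0..1} = ({0..1} - G) \<union> ({0..1} \<inter> G)" by blast
      ultimately have "t islimpt {0..1} \<inter> G"
        using islimpt_Un_finite[OF fin] by metis
      then show ?thesis
        by (rule islimpt_subset) (use hG in auto)
    qed
    ultimately show ?thesis
      by (auto simp: closed_limpt)
  qed
  have "h constant_on {0..1}"
  proof (rule continuous_discrete_range_constant[OF _ h])
    fix x :: real assume x: "x \<in> {0..1}"
    have "1 \<le> norm (h y - h x)" if "y \<in> {0..1}" "h y \<noteq> h x" for y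
      using hZ[OF x] hZ[OF that(1)] that(2)
      by (auto elim!: Ints_cases simp flip: of_int_diff of_int_abs)
    then show "\<exists>e>0. \<forall>y. y \<in> {0..1} \<and> h y \<noteq> h x \<longrightarrow> e \<le> norm (h y - h x)"
      by (intro exI[of _ 1]) auto
  qed simp
  then have "h t = h 0"
    using t by (auto simp: constant_on_def)
  then show ?thesis
    using assms(3) by (simp add: h_def)
qed

lemma concat_real_coords_generic:
  assumes "\<And>t. t \<in> set ts \<Longrightarrow> t \<notin> \<int>"
  shows "concat (map real_coords ts) = map frac ts"
  using assms by (induction ts) (auto simp: real_coords_def)

text \<open>
  On the generic points, where no coordinate of either subdivision is an integer, the point
  \<open>f [x, u]\<close> determines the fractional parts of all coordinates; these determine the
  permutation and, by continuity, the homeomorphisms.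
\<close>

lemma dimap_data_unique:
  assumes P: "precubical_set P" and D: "dimap_data f Q P x ls g \<sigma>"
    and D': "dimap_data f Q P x ls' g' \<sigma>'"
  shows "\<sigma> = \<sigma>'" "ls = ls'" "\<And>js. js \<in> grid_box ls \<Longrightarrow> g (map Edge js) = g' (map Edge js)"
proof -
  define n where "n = deg Q x"
  obtain \<phi> where len: "length ls = n" and ls: "\<forall>l \<in> set ls. 1 \<le> l"
    and s: "\<sigma> permutes {..<n}"
    and hom: "\<And>i. i < n \<Longrightarrow> increasing_homeo 1 (of_int (ls ! i)) (\<phi> i)"
    and f: "\<And>u. u \<in> unit_cube n \<Longrightarrow> f (pt Q x u) =
       pt P (g (map real_cell (map (\<lambda>i. \<phi> i (u ! \<sigma> i)) [0..<n])))
           (concat (map real_coords (map (\<lambda>i. \<phi> i (u ! \<sigma> i)) [0..<n])))"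
    using D unfolding dimap_data_def n_def by blast
  obtain \<phi>' where len': "length ls' = n" and ls': "\<forall>l \<in> set ls'. 1 \<le> l"
    and s': "\<sigma>' permutes {..<n}"
    and hom': "\<And>i. i < n \<Longrightarrow> increasing_homeo 1 (of_int (ls' ! i)) (\<phi>' i)"
    and f': "\<And>u. u \<in> unit_cube n \<Longrightarrow> f (pt Q x u) =
       pt P (g' (map real_cell (map (\<lambda>i. \<phi>' i (u ! \<sigma>' i)) [0..<n])))
           (concat (map real_coords (map (\<lambda>i. \<phi>' i (u ! \<sigma>' i)) [0..<n])))"
    using D' unfolding dimap_data_def n_def by blast
  define T where "T u = map (\<lambda>i. \<phi> i (u ! \<sigma> i)) [0..<n]" for u
  define T' where "T' u = map (\<lambda>i. \<phi>' i (u ! \<sigma>' i)) [0..<n]" for u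
  have l1: "1 \<le> ls ! i" "1 \<le> ls' ! i" if "i < n" for i
    using ls ls' len len' that by auto
  \<comment> \<open>Both sides are normal forms of the same point, so cubes and coordinates can be
    compared separately.\<close>
  have key: "g (map real_cell (T u)) = g' (map real_cell (T' u))"
      "concat (map real_coords (T u)) = concat (map real_coords (T' u))" if "u \<in> unit_cube n" for u
    using pt_inject[OF P set_concat_real_coords set_concat_real_coords
        trans[OF f[OF that, symmetric] f'[OF that]]]
    unfolding T_def T'_def by auto
  define G where "G = {t \<in> {0..1}. \<forall>i<n. \<phi> i t \<notin> \<int> \<and> \<phi>' i t \<notin> \<int>}"
  have finZ: "finite (\<int> \<inter> {0..real_of_int l})" for l
    using finite_int_segment[of 0 "real_of_int l"] by (rule finite_subset[rotated]) auto
  have finG: "finite ({0..1} - G)"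
  proof (rule finite_subset)
    show "{0..1} - G \<subseteq> (\<Union>i<n. {t \<in> {0..1}. \<phi> i t \<in> \<int>} \<union> {t \<in> {0..1}. \<phi>' i t \<in> \<int>})"
      by (auto simp: G_def)
    show "finite (\<Union>i<n. {t \<in> {0..1}. \<phi> i t \<in> \<int>} \<union> {t \<in> {0..1}. \<phi>' i t \<in> \<int>})"
      using finite_increasing_homeo_vimage[OF hom l1(1) finZ]
        finite_increasing_homeo_vimage[OF hom' l1(2) finZ] by auto
  qed
  have infG: "infinite G"
  proof
    assume "finite G"
    then have "finite ({0..1} - G \<union> G)" using finG by blast
    then have "finite {0..1 :: real}" by (rule finite_subset[rotated]) blast
    then show False using infinite_Icc[of 0 "1 :: real"] by simp
  qed
  then obtain t0 where t0: "t0 \<in> G" by fastforce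
  \<comment> \<open>With all entries in \<open>G\<close> no coordinate is dropped by
    \<open>real_coords\<close>. The two coordinate lists then have full length and can be compared
    entry by entry.\<close>
  have gen: "frac (\<phi> i (u ! \<sigma> i)) = frac (\<phi>' i (u ! \<sigma>' i))"
    if u: "length u = n" "set u \<subseteq> G" and i: "i < n" for u i
  proof -
    have "u ! \<sigma> j \<in> G" "u ! \<sigma>' j \<in> G" if "j < n" for j
      using u that permutes_in_image[OF s, of j] permutes_in_image[OF s', of j] by auto
    then have "t \<notin> \<int>" if "t \<in> set (T u) \<or> t \<in> set (T' u)" for t
      using that by (auto simp: T_def T'_def G_def)
    moreover have "u \<in> unit_cube n"
      using u by (auto simp: unit_cube_iff G_def)
    ultimately have "map frac (T u) = map frac (T' u)"
      using key(2) concat_real_coords_generic by metis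
    from arg_cong[OF this, of "\<lambda>xs. xs ! i"] show ?thesis
      using i by (simp add: T_def T'_def)
  qed
  have "\<sigma> i = \<sigma>' i" if i: "i < n" for i
  proof (rule ccontr)
    assume ne: "\<sigma> i \<noteq> \<sigma>' i"
    have si: "\<sigma> i < n" "\<sigma>' i < n"
      using permutes_in_image[OF s, of i] permutes_in_image[OF s', of i] i by auto
    \<comment> \<open>Only entry \<open>\<sigma> i\<close> varies, and the right-hand side reads a
      different entry, which stays \<open>t0\<close>. So \<open>\<phi> i\<close> would map the
      infinite set \<open>G\<close> into points with one fixed fractional part, of which its range
      has finitely many.\<close>
    have "frac (\<phi> i t) = frac (\<phi>' i t0)" if "t \<in> G" for t
    proof -
      have "set ((replicate n t0)[\<sigma> i := t]) \<subseteq> G"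
        using set_update_subset_insert[of "replicate n t0" "\<sigma> i" t] that t0 by auto
      from gen[OF _ this i] show ?thesis
        using si ne by (simp add: nth_list_update)
    qed
    then have "G \<subseteq> {t \<in> {0..1}. \<phi> i t \<in> {x. frac x = frac (\<phi>' i t0)}}"
      by (auto simp: G_def)
    then have "finite G"
      using finite_increasing_homeo_vimage[OF hom[OF i] l1(1)[OF i] finite_frac_vimage]
      by (rule finite_subset)
    with infG show False by blast
  qed
  moreover have "\<sigma> i = i" "\<sigma>' i = i" if "\<not> i < n" for i
    using s s' that by (auto simp: permutes_def)
  ultimately show \<sigma>: "\<sigma> = \<sigma>'"
    by (metis ext)
  have \<phi>: "\<phi> i t = \<phi>' i t" if i: "i < n" and t: "t \<in> {0..1}" for i t
  proof (rule frac_eq_imp_eq[OF _ _ _ finG _ t])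
    show "continuous_on {0..1} (\<phi> i)" "continuous_on {0..1} (\<phi>' i)"
      using increasing_homeoD(1)[OF hom[OF i]] increasing_homeoD(1)[OF hom'[OF i]] l1[OF i] by auto
    show "\<phi> i 0 = \<phi>' i 0"
      using increasing_homeoD(4)[OF hom[OF i]] increasing_homeoD(4)[OF hom'[OF i]] l1[OF i] by auto
    fix t assume "t \<in> G"
    then have "set (replicate n t) \<subseteq> G" by auto
    moreover have "\<sigma> i < n" "\<sigma>' i < n"
      using permutes_in_image[OF s, of i] permutes_in_image[OF s', of i] i by auto
    ultimately show "frac (\<phi> i t) = frac (\<phi>' i t)"
      using gen[of "replicate n t" i] i by simp
  qed
  show "ls = ls'"
  proof (rule nth_equalityI)
    fix i assume "i < length ls"
    then have i: "i < n" by (simp add: len)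
    have "\<phi> i 1 = of_int (ls ! i)" "\<phi>' i 1 = of_int (ls' ! i)"
      using increasing_homeoD(5)[OF hom[OF i]] increasing_homeoD(5)[OF hom'[OF i]] l1[OF i] by auto
    then show "ls ! i = ls' ! i"
      using \<phi>[OF i, of 1] by simp
  qed (simp add: len len')
  show "g (map Edge js) = g' (map Edge js)" if js: "js \<in> grid_box ls" for js
  proof -
    \<comment> \<open>The target is the midpoint of the edge that ends in \<open>js ! i\<close>. A
      point with these grid coordinates is interior to the top cube \<open>map Edge js\<close>, so
      \<open>real_cell\<close> recovers that cube.\<close>
    have "\<exists>t \<in> {0..1}. \<phi> i t = of_int (js ! i) - 1 / 2" if i: "i < n" for i
    proof -
      have "1 \<le> js ! i" "js ! i \<le> ls ! i" using js i len by (auto simp: in_grid_box_iff)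
      then have "of_int (js ! i) - 1 / 2 \<in> {0..real_of_int (ls ! i)}" by auto
      also have "\<dots> = \<phi> i ` {0..1}"
        using increasing_homeoD(2)[OF hom[OF i]] l1[OF i] by auto
      finally show ?thesis by (metis imageE)
    qed
    then obtain \<tau> where \<tau>: "\<And>i. i < n \<Longrightarrow> \<tau> i \<in> {0..1} \<and> \<phi> i (\<tau> i) = of_int (js ! i) - 1 / 2"
      by metis
    define u where "u = map (\<lambda>m. \<tau> (inv_into UNIV \<sigma> m)) [0..<n]"
    have si: "\<sigma> i < n" if "i < n" for i
      using permutes_in_image[OF s, of i] that by auto
    have si': "inv_into UNIV \<sigma> i < n" if "i < n" for i
      using permutes_in_image[OF permutes_inv[OF s], of i] that by auto
    have u\<sigma>: "u ! \<sigma> i = \<tau> i" if "i < n" for i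
      using si[OF that] permutes_inverses(2)[OF s] by (simp add: u_def)
    have "u \<in> unit_cube n"
      using \<tau> si' by (auto simp: u_def unit_cube_iff)
    then have "g (map real_cell (T u)) = g' (map real_cell (T' u))"
      by (rule key)
    moreover have "T' u = T u"
      unfolding T_def T'_def \<sigma>[symmetric] using u\<sigma> \<phi> \<tau> by auto
    moreover have "map real_cell (T u) = map Edge js"
    proof (rule nth_equalityI)
      show "length (map real_cell (T u)) = length (map Edge js)"
        using js len by (simp add: T_def in_grid_box_iff)
      fix i assume "i < length (map real_cell (T u))"
      then have i: "i < n" by (simp add: T_def)
      have "real_of_int (js ! i) - 1 / 2 \<notin> \<int>"
      proof
        assume "real_of_int (js ! i) - 1 / 2 \<in> \<int>"
        then obtain z where "real_of_int (js ! i) - 1 / 2 = of_int z" by (auto elim: Ints_cases)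
        then have "real_of_int (2 * js ! i - 1) = of_int (2 * z)" by simp
        then have "2 * js ! i - 1 = 2 * z" by (simp only: of_int_eq_iff)
        then show False by presburger
      qed
      moreover have "\<lceil>real_of_int (js ! i) - 1 / 2\<rceil> = js ! i"
        by (rule ceiling_unique) auto
      ultimately have "real_cell (of_int (js ! i) - 1 / 2) = Edge (js ! i)"
        by (simp add: real_cell_def)
      then show "map real_cell (T u) ! i = map Edge js ! i"
        using i u\<sigma>[OF i] \<tau>[OF i] js len by (simp add: T_def in_grid_box_iff)
    qed
    ultimately show ?thesis by simp
  qed
qed

section \<open>Linear extension\<close>

abbreviation pm_scale :: "'r::comm_ring_1 \<Rightarrow> ('a \<Rightarrow>\<^sub>0 'r) \<Rightarrow> ('a \<Rightarrow>\<^sub>0 'r)" where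
  "pm_scale r \<equiv> Poly_Mapping.map ((*) r)"

lemma lookup_pm_scale [simp]: "Poly_Mapping.lookup (pm_scale r c) x = r * Poly_Mapping.lookup c x"
  by (simp add: map.rep_eq when_def)

lemma module_pm_scale: "Modules.module pm_scale"
  by standard (auto intro!: poly_mapping_eqI simp: lookup_add algebra_simps)

text \<open>The scalar action is a parameter because both chains and the exterior algebra occur as
  targets: the boundary, the chain map of a dimap and the label of a chain are all
  instances.\<close>

definition linear_extension ::
    "('r \<Rightarrow> 'm \<Rightarrow> 'm) \<Rightarrow> ('a \<Rightarrow> 'm) \<Rightarrow> ('a \<Rightarrow>\<^sub>0 'r::comm_ring_1) \<Rightarrow> 'm::ab_group_add" where
  "linear_extension s h c = (\<Sum>x \<in> Poly_Mapping.keys c. s (Poly_Mapping.lookup c x) (h x))"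

context Modules.module
begin

lemma linear_extension_superset:
  assumes "finite S" "Poly_Mapping.keys c \<subseteq> S"
  shows "linear_extension scale h c = (\<Sum>x \<in> S. scale (Poly_Mapping.lookup c x) (h x))"
  unfolding linear_extension_def
  by (rule sum.mono_neutral_left[OF assms]) (auto simp: in_keys_iff)

lemma linear_extension_0 [simp]: "linear_extension scale h 0 = 0"
  by (simp add: linear_extension_def)

lemma linear_extension_add:
  "linear_extension scale h (c + d) = linear_extension scale h c + linear_extension scale h d"
  using linear_extension_superset[of "Poly_Mapping.keys c \<union> Poly_Mapping.keys d" c]
    linear_extension_superset[of "Poly_Mapping.keys c \<union> Poly_Mapping.keys d" d]
    linear_extension_superset[of "Poly_Mapping.keys c \<union> Poly_Mapping.keys d" "c + d"]
    keys_add[of c d]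
  by (simp add: lookup_add scale_left_distrib sum.distrib)

lemma linear_extension_pm_scale:
  "linear_extension scale h (pm_scale r c) = scale r (linear_extension scale h c)"
proof -
  have "Poly_Mapping.keys (pm_scale r c) \<subseteq> Poly_Mapping.keys c"
    by (auto simp: in_keys_iff)
  from linear_extension_superset[OF _ this] show ?thesis
    by (simp add: linear_extension_def scale_sum_right)
qed

lemma linear_extension_uminus: "linear_extension scale h (- c) = - linear_extension scale h c"
  using linear_extension_add[of h c "- c"] by (simp add: eq_neg_iff_add_eq_0 add.commute)

lemma linear_extension_diff:
  "linear_extension scale h (c - d) = linear_extension scale h c - linear_extension scale h d"
  using linear_extension_add[of h c "- d"] by (simp add: linear_extension_uminus)

lemma linear_extension_sum:
  "linear_extension scale h (\<Sum>i \<in> I. c i) = (\<Sum>i \<in> I. linear_extension scale h (c i))"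
  by (induction I rule: infinite_finite_induct) (auto simp: linear_extension_add)

lemma linear_extension_single: "linear_extension scale h (Poly_Mapping.single x r) = scale r (h x)"
  by (simp add: linear_extension_def)

text \<open>Identities between composites of linear maps are reduced to single cubes by this
  rule.\<close>

lemma linear_extension_linear_extension:
  "linear_extension scale h (linear_extension pm_scale k c) =
    linear_extension scale (\<lambda>x. linear_extension scale h (k x)) c"
  by (simp add: linear_extension_def[of pm_scale] linear_extension_def[of _ _ c]
      linear_extension_sum linear_extension_pm_scale)

lemma linear_extension_zero_fun: "linear_extension scale (\<lambda>_. 0) c = 0"
  by (simp add: linear_extension_def)

end

lemma linear_extension_cong:
  "(\<And>x. x \<in> Poly_Mapping.keys c \<Longrightarrow> h x = k x) \<Longrightarrow> linear_extension s h c = linear_extension s k c"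
  by (simp add: linear_extension_def)

lemma boundary_eq: "boundary P = linear_extension pm_scale (boundary_cube P)"
  by (simp add: fun_eq_iff boundary_def linear_extension_def)

lemma keys_pm_scale: "Poly_Mapping.keys (pm_scale r c) \<subseteq> Poly_Mapping.keys c"
  by (auto simp: in_keys_iff)

lemma keys_linear_extension:
  "Poly_Mapping.keys (linear_extension pm_scale h c) \<subseteq> (\<Union>x \<in> Poly_Mapping.keys c.
      Poly_Mapping.keys (h x))"
  unfolding linear_extension_def by (rule order_trans[OF keys_sum UN_mono[OF order_refl
      keys_pm_scale]])


section \<open>The exterior algebra\<close>

lemma poly_mapping_add_induct [case_names zero single add]:
  assumes zero: "P 0" and single: "\<And>x r. P (Poly_Mapping.single x r)"
    and add: "\<And>c d. P c \<Longrightarrow> P d \<Longrightarrow> P (c + d)"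
  shows "P (c :: 'a \<Rightarrow>\<^sub>0 'b::comm_monoid_add)"
proof (induction c rule: update_induct)
  case (update c a b)
  have "Poly_Mapping.update a b c = Poly_Mapping.single a b + c"
    using update(1)
    by (intro poly_mapping_eqI) (auto simp: lookup_update lookup_add lookup_single when_def
        in_keys_iff)
  then show ?case
    using single add update by metis
qed (rule zero)

text \<open>The empty word is the unit of the free monoid, so its multiples are central although the
  monoid algebra is not commutative.\<close>

lemma single_Nil_commute:
  "Poly_Mapping.single ([] :: 's list) (r :: 'r::comm_ring_1) * p = p * Poly_Mapping.single [] r"
proof (induction p rule: poly_mapping_add_induct)
  case (single k v)
  then show ?case
    by (simp add: mult_single mult.commute plus_list_def)
next
  case (add f g)
  then show ?case by (simp add: algebra_simps)
qed simp

lemma exterior_rel_refl [simp]: "exterior_rel p p"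
  by (simp add: exterior_rel_def exterior_ideal.zero)

lemma module_exterior_scale:
  "Modules.module (exterior_scale :: 'r::comm_ring_1 \<Rightarrow> ('s, 'r) exterior \<Rightarrow> _)"
proof
  fix r t :: 'r and x y :: "('s, 'r) exterior"
  show "exterior_scale r (x + y) = exterior_scale r x + exterior_scale r y"
    by transfer (simp add: distrib_left)
  show "exterior_scale (r + t) x = exterior_scale r x + exterior_scale t x"
    by transfer (simp add: distrib_right single_add)
  show "exterior_scale r (exterior_scale t x) = exterior_scale (r * t) x"
    by transfer (simp add: mult_single plus_list_def flip: mult.assoc)
  show "exterior_scale 1 x = x"
    by transfer (simp add: zero_list_def[symmetric])
qed

lemma exterior_scale_mult_left: "exterior_scale r x * y = exterior_scale r (x * y)"
  by transfer (simp add: mult.assoc)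

lemma exterior_scale_mult_right:
  "x * exterior_scale r y = exterior_scale r (x * (y :: ('s, 'r::comm_ring_1) exterior))"
proof (transfer fixing: r)
  fix p q :: "'s list \<Rightarrow>\<^sub>0 'r"
  have "p * (Poly_Mapping.single [] r * q) = Poly_Mapping.single [] r * (p * q)"
    by (metis mult.assoc single_Nil_commute)
  then show "exterior_rel (p * (Poly_Mapping.single [] r * q)) (Poly_Mapping.single [] r * (p * q))"
    by simp
qed

text \<open>The image of a word under the monoid homomorphism from words to the additive group of
  the exterior algebra that sends a letter to its generator. Concatenated labels thus become
  sums.\<close>

definition letter_sum :: "'s list \<Rightarrow> ('s, 'r::comm_ring_1) exterior" where
  "letter_sum w = sum_list (map exterior_gen w)"

lemma letter_sum_conv_sum: "letter_sum w = (\<Sum>j < length w. exterior_gen (w ! j))"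
  by (simp add: letter_sum_def sum_list_sum_nth atLeast0LessThan)

lemma letter_sum_append: "letter_sum (u @ v) = letter_sum u + letter_sum v"
  by (simp add: letter_sum_def)

lemma letter_sum_sum_list: "letter_sum (sum_list ws) = sum_list (map letter_sum ws)"
  by (induction ws) (simp_all add: letter_sum_append plus_list_def zero_list_def letter_sum_def[of
      "[]"])

lemma letter_sum_eq_abs:
  "letter_sum w = abs_exterior (sum_list (map (\<lambda>s. Poly_Mapping.single [s] 1) w))"
  by (induction w)
    (simp_all add: letter_sum_def zero_exterior_def exterior_gen.abs_eq plus_exterior.abs_eq)

lemma letter_sum_square: "letter_sum w * letter_sum w = (0 :: ('s, 'r::comm_ring_1) exterior)"
proof -
  define v :: "'s list \<Rightarrow>\<^sub>0 'r" where "v = sum_list (map (\<lambda>s. Poly_Mapping.single [s] 1) w)"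
  have "Poly_Mapping.keys v \<subseteq> {m. length m = 1}"
    unfolding v_def
  proof (induction w)
    case (Cons s w)
    then show ?case
      using keys_add[of "Poly_Mapping.single [s] (1 :: 'r)" "sum_list
          (map (\<lambda>s. Poly_Mapping.single [s] 1) w)"]
      by (auto split: if_splits)
  qed simp
  from exterior_ideal.square[OF this, of 1 1] have "exterior_rel (v * v) 0"
    by (simp add: exterior_rel_def)
  then have "abs_exterior (v * v) = abs_exterior 0"
    by (simp add: exterior.abs_eq_iff)
  then show ?thesis
    by (simp add: letter_sum_eq_abs v_def[symmetric] times_exterior.abs_eq zero_exterior_def)
qed

text \<open>Polarization: the square belonging to \<open>u @ v\<close> vanishes, and so do the
  squares of the two summands.\<close>

lemma letter_sum_anticommute: "letter_sum u * letter_sum v = - (letter_sum v * letter_sum u)"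
  using letter_sum_square[of "u @ v"]
  by (simp add: letter_sum_append distrib_left distrib_right letter_sum_square
      eq_neg_iff_add_eq_0 add.commute)

lemma mult_prod_list_anticommute:
  assumes "\<And>y. y \<in> set ys \<Longrightarrow> x * y = - (y * x)"
  shows "x * prod_list ys = exterior_scale ((- 1) ^ length ys) (prod_list ys * x)"
  using assms
proof (induction ys)
  case Nil
  then show ?case by (simp add: Modules.module.scale_one[OF module_exterior_scale])
next
  case (Cons y ys)
  have "x * (y * prod_list ys) = - (y * (x * prod_list ys))"
    using Cons.prems[of y] by (simp flip: mult.assoc)
  also have "\<dots> = exterior_scale ((- 1) ^ length (y # ys)) (y * prod_list ys * x)"
    using Cons
    by (simp add: exterior_scale_mult_right mult.assoc
        Modules.module.scale_minus_left[OF module_exterior_scale])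
  finally show ?case by simp
qed

text \<open>Induction on the number of factors. The first factor \<open>a m\<close>, with
  \<open>m\<close> equal to \<open>\<sigma> 0\<close>, is moved past \<open>m\<close> others to its
  place; the remaining ones are permuted by \<open>permutation_delete \<sigma> 0\<close>. The two
  signs multiply to the sign of \<open>\<sigma>\<close>, as in expanding a determinant along a
  row.\<close>

lemma prod_list_permute_anticommuting:
  fixes a :: "nat \<Rightarrow> ('s, 'r::comm_ring_1) exterior"
  assumes "\<And>i j. a i * a j = - (a j * a i)" and "\<sigma> permutes {0..<n}"
  shows "prod_list (map (\<lambda>i. a (\<sigma> i)) [0..<n]) =
    exterior_scale (of_int (sign \<sigma>)) (prod_list (map a [0..<n]))"
  using assms
proof (induction n arbitrary: a \<sigma>)
  case 0
  then show ?case by (simp add: Modules.module.scale_one[OF module_exterior_scale])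
next
  case (Suc n)
  define m where "m = \<sigma> 0"
  define \<sigma>' where "\<sigma>' = permutation_delete \<sigma> 0"
  have m: "m < Suc n"
    using permutes_in_image[OF Suc.prems(2), of 0] by (simp add: m_def)
  have \<sigma>': "\<sigma>' permutes {0..<n}"
    unfolding \<sigma>'_def by (rule permutation_delete_permutes[OF Suc.prems(2)]) simp
  have sign: "of_int (sign \<sigma>) = ((- 1) ^ m * of_int (sign \<sigma>') :: 'r)"
    using signof_permutation_insert[OF \<sigma>' _ m, of 0, where 'a = 'r]
    by (simp add: m_def \<sigma>'_def permutation_insert_delete[OF Suc.prems(2)])
  have "\<sigma> (Suc j) = insert_index m (\<sigma>' j)" for j
    using permutation_delete_insert_index[OF Suc.prems(2), of 0 j] by (simp add: m_def \<sigma>'_def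
        insert_index_def)
  then have "prod_list (map (\<lambda>i. a (\<sigma> i)) [0..<Suc n])
      = a m * prod_list (map (\<lambda>i. a (insert_index m (\<sigma>' i))) [0..<n])"
    by (simp only: map_upt_Suc) (simp add: m_def)
  also have "prod_list (map (\<lambda>i. a (insert_index m (\<sigma>' i))) [0..<n])
      = exterior_scale (of_int (sign \<sigma>')) (prod_list (map (\<lambda>i. a (insert_index m i)) [0..<n]))"
    by (rule Suc.IH[OF Suc.prems(1) \<sigma>'])
  also have "map (\<lambda>i. a (insert_index m i)) [0..<n] = map a [0..<m] @ map a [Suc m..<Suc n]"
  proof -
    have "[0..<n] = [0..<m] @ [m..<n]"
      using m upt_add_eq_append[of 0 m "n - m"] by simp
    moreover have "map (\<lambda>i. a (insert_index m i)) [m..<n] = map a (map Suc [m..<n])"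
      by (auto simp: insert_index_def)
    then have "map (\<lambda>i. a (insert_index m i)) [m..<n] = map a [Suc m..<Suc n]"
      by (simp only: map_Suc_upt)
    moreover have "map (\<lambda>i. a (insert_index m i)) [0..<m] = map a [0..<m]"
      by (auto simp: insert_index_def)
    ultimately show ?thesis
      by (simp only: map_append)
  qed
  also have "a m * exterior_scale (of_int (sign \<sigma>')) (prod_list (map a [0..<m] @ map a
      [Suc m..<Suc n]))
      = exterior_scale (of_int (sign \<sigma>'))
          ((a m * prod_list (map a [0..<m])) * prod_list (map a [Suc m..<Suc n]))"
    by (simp add: exterior_scale_mult_right mult.assoc)
  also have "a m * prod_list (map a [0..<m])
      = exterior_scale ((- 1) ^ m) (prod_list (map a [0..<m]) * a m)"
    using mult_prod_list_anticommute[of "map a [0..<m]" "a m"] Suc.prems(1) by auto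
  also have "exterior_scale ((- 1) ^ m) (prod_list (map a [0..<m]) * a m) * prod_list
      (map a [Suc m..<Suc n])
      = exterior_scale ((- 1) ^ m) (prod_list (map a [0..<Suc n]))"
  proof -
    have "[0..<Suc n] = [0..<m] @ m # [Suc m..<Suc n]"
      using m upt_add_eq_append[of 0 m "Suc n - m"] upt_conv_Cons[of m "Suc n"] by simp
    then show ?thesis
      by (simp add: exterior_scale_mult_left mult.assoc)
  qed
  finally show ?case
    by (simp add: sign Modules.module.scale_scale[OF module_exterior_scale] mult.commute)
qed

lemma listset_Cons: "listset (S # Ss) = (\<lambda>(x, xs). x # xs) ` (S \<times> listset Ss)"
  by (auto simp: set_Cons_def)

text \<open>The distributive law with the order of the factors kept. It is applied to the letters of
  edge labels and to the edges of a grid.\<close>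

lemma sum_prod_list_listset:
  fixes h :: "nat \<Rightarrow> 'a \<Rightarrow> ('s, 'r::comm_ring_1) exterior"
  assumes "\<And>S. S \<in> set Ss \<Longrightarrow> finite S"
  shows "(\<Sum>js \<in> listset Ss. prod_list (map (\<lambda>i. h i (js ! i)) [0..<length Ss])) =
    prod_list (map (\<lambda>i. \<Sum>j \<in> Ss ! i. h i j) [0..<length Ss])"
  using assms
proof (induction Ss arbitrary: h)
  case (Cons S Ss)
  have "(\<Sum>js \<in> listset (S # Ss). prod_list (map (\<lambda>i. h i (js ! i)) [0..<length (S # Ss)]))
      = (\<Sum>(j, js) \<in> S \<times> listset Ss. h 0 j * prod_list (map (\<lambda>i. h (Suc i) (js ! i))
          [0..<length Ss]))"
    unfolding listset_Cons by (subst sum.reindex) (auto simp: inj_on_def map_upt_Suc simp del: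
        upt_Suc intro!: sum.cong)
  also have "\<dots> = (\<Sum>j \<in> S. h 0 j) *
      (\<Sum>js \<in> listset Ss. prod_list (map (\<lambda>i. h (Suc i) (js ! i)) [0..<length Ss]))"
    by (simp add: sum_product sum.cartesian_product)
  also have "\<dots> = prod_list (map (\<lambda>i. \<Sum>j \<in> (S # Ss) ! i. h i j) [0..<length (S # Ss)])"
    using Cons.IH[of "\<lambda>i. h (Suc i)"] Cons.prems by (simp add: map_upt_Suc del: upt_Suc)
  finally show ?case .
qed simp

section \<open>Labels of parallel edges and the cocycle property\<close>

text \<open>Directions are counted from 1, like the boundary operators.\<close>

definition dir_label :: "('a, 'm) hda \<Rightarrow> nat \<Rightarrow> 'a \<Rightarrow> 'm" where
  "dir_label A i x = label A (edge0 A i x)"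

text \<open>The operator of largest index acts first in \<open>edge0\<close>, so it can be split off
  as the passage to a face.\<close>

lemma edge0_less_last:
  "deg P x = Suc n \<Longrightarrow> deg P (bd P True (Suc n) x) = n \<Longrightarrow> i < Suc n \<Longrightarrow>
    edge0 P i x = edge0 P i (bd P True (Suc n) x)"
  by (cases "n = 0") (simp_all add: edge0_def)

lemma edge0_last:
  assumes "deg P x = Suc n" "deg P (bd P True n x) = n" "0 < n"
  shows "edge0 P (Suc n) x = edge0 P n (bd P True n x)"
proof -
  have "filter (\<lambda>j. j \<noteq> k) [1..<k] = [1..<k]" for k
    by (auto simp: filter_id_conv)
  moreover obtain m where "n = Suc m" using assms(3) by (cases n) auto
  ultimately show ?thesis
    using assms by (simp add: edge0_def)
qed

lemma is_hdaD:
  assumes "is_hda A"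
  shows "precubical_set A"
    "\<And>x i. x \<in> cubes A \<Longrightarrow> deg A x = 2 \<Longrightarrow> i \<in> {1, 2} \<Longrightarrow>
      label A (bd A False i x) = label A (bd A True i x)"
  using assms by (auto simp: is_hda_def cubes_of_deg_def)

text \<open>Parallel edges of a cube have equal labels. Squares have this by axiom. In higher
  degrees two faces in different directions meet in a face of codimension two, to which both labels
  can be pushed by induction.\<close>

lemma dir_label_delete_index:
  assumes A: "is_hda A"
  shows "x \<in> cubes A \<Longrightarrow> 1 \<le> i \<Longrightarrow> i \<le> deg A x \<Longrightarrow> 1 \<le> m \<Longrightarrow> m \<le> deg A x \<Longrightarrow> i \<noteq> m \<Longrightarrow>
    dir_label A (delete_index m i) (bd A k m x) = dir_label A i x"
proof (induction "deg A x" arbitrary: x i m k rule: less_induct)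
  case less
  note P = is_hdaD(1)[OF A]
  have bd: "bd A k m x \<in> cubes A" "deg A (bd A k m x) = deg A x - 1"
    if "1 \<le> m" "m \<le> deg A x" for k m
    using precubical_set_bd[OF P less.prems(1) that] by auto
  consider "deg A x = 2" | "3 \<le> deg A x"
    using less.prems by linarith
  then show ?case
  proof cases
    case 1
    have par: "label A (bd A k j x) = label A (bd A True j x)" if "j \<in> {1, 2}" for j
      using is_hdaD(2)[OF A less.prems(1) 1 that] by (cases k) auto
    have edge: "edge0 A 1 y = y" if "deg A y = 1" for y
      using that by (simp add: edge0_def)
    have edges: "edge0 A 1 x = bd A True 2 x" "edge0 A 2 x = bd A True 1 x"
      using 1 by (simp_all add: edge0_def upt_conv_Cons numeral_2_eq_2)
    consider "i = 1" "m = 2" | "i = 2" "m = 1"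
      using less.prems 1 by linarith
    then show ?thesis
    proof cases
      case 1
      then have "dir_label A (delete_index m i) (bd A k m x) = label A (bd A k 2 x)"
        using edge[of "bd A k 2 x"] bd[of 2 k] \<open>deg A x = 2\<close>
        by (simp add: dir_label_def delete_index_def)
      then show ?thesis
        using par[of 2] edges 1 by (simp add: dir_label_def)
    next
      case 2
      then have "dir_label A (delete_index m i) (bd A k m x) = label A (bd A k 1 x)"
        using edge[of "bd A k 1 x"] bd[of 1 k] \<open>deg A x = 2\<close>
        by (simp add: dir_label_def delete_index_def)
      then show ?thesis
        using par[of 1] edges 2 by (simp add: dir_label_def)
    qed
  next
    case 2
    have lt: "dir_label A (delete_index a i) (bd A k a x) = dir_label A (delete_index b i)
        (bd A l b x)"
      if ab: "1 \<le> a" "a < b" "b \<le> deg A x" "a \<noteq> i" "b \<noteq> i" for a b k l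
    proof -
      have "dir_label A (delete_index (b - 1) (delete_index a i)) (bd A l (b - 1) (bd A k a x))
          = dir_label A (delete_index a i) (bd A k a x)"
        using ab less.prems bd[of a k] by (intro less.hyps) (auto simp: delete_index_def)
      moreover have "dir_label A (delete_index a (delete_index b i)) (bd A k a (bd A l b x))
          = dir_label A (delete_index b i) (bd A l b x)"
        using ab less.prems bd[of b l] by (intro less.hyps) (auto simp: delete_index_def)
      moreover have "delete_index (b - 1) (delete_index a i) = delete_index a (delete_index b i)"
        using ab by (auto simp: delete_index_def)
      moreover have "bd A k a (bd A l b x) = bd A l (b - 1) (bd A k a x)"
        using precubical_set_bd_bd[OF P less.prems(1) ab(1-3)] .
      ultimately show ?thesis by simp
    qed
    then have ne: "dir_label A (delete_index a i) (bd A k a x) = dir_label A (delete_index b i)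
        (bd A l b x)"
      if "a \<noteq> b" "a \<in> {1..deg A x} - {i}" "b \<in> {1..deg A x} - {i}" for a b k l
      using that lt[of a b k l] lt[of b a l k, symmetric] by (cases a b rule: linorder_cases) auto
    have any: "dir_label A (delete_index a i) (bd A k a x) = dir_label A (delete_index b i)
        (bd A l b x)"
      if ab: "a \<in> {1..deg A x} - {i}" "b \<in> {1..deg A x} - {i}" for a b k l
    proof (cases "a = b")
      case True
      \<comment> \<open>Opposite faces do not meet in this way; they are compared through a face in
        a third direction. Three directions suffice to avoid both \<open>i\<close> and
        \<open>a\<close>.\<close>
      have "\<exists>c. 1 \<le> c \<and> c \<le> 3 \<and> c \<noteq> i \<and> c \<noteq> a"
        by presburger
      then obtain c where c: "1 \<le> c" "c \<le> 3" "c \<noteq> i" "c \<noteq> a" by blast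
      then have "c \<in> {1..deg A x} - {i}"
        using 2 by simp
      then show ?thesis
        using ne[of a c k k] ne[of c b k l] ab True c(4) by simp
    qed (use ne ab in blast)
    obtain n where n: "deg A x = Suc n" "0 < n" using 2 by (cases "deg A x") auto
    \<comment> \<open>The edge selected by \<open>edge0\<close> lies in the upper face of the last
      direction other than \<open>i\<close>.\<close>
    have "\<exists>b. b \<in> {1..deg A x} - {i} \<and> dir_label A i x = dir_label A (delete_index b i)
        (bd A True b x)"
    proof (cases "i = Suc n")
      case True
      then show ?thesis
        using n bd[of n True] edge0_last[of A x n]
        by (intro exI[of _ n]) (auto simp: dir_label_def delete_index_def)
    next
      case False
      then show ?thesis
        using n bd[of "Suc n" True] edge0_less_last[of A x n i] less.prems
        by (intro exI[of _ "Suc n"]) (auto simp: dir_label_def delete_index_def)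
    qed
    then obtain b where "b \<in> {1..deg A x} - {i}"
      "dir_label A i x = dir_label A (delete_index b i) (bd A True b x)" by blast
    then show ?thesis
      using any[of m b k True] less.prems by simp
  qed
qed

lemma dir_label_bd:
  assumes "is_hda A" "x \<in> cubes A" "1 \<le> m" "m \<le> deg A x" "1 \<le> i" "i < deg A x"
  shows "dir_label A i (bd A k m x) = dir_label A (insert_index m i) x"
proof -
  have "delete_index m (insert_index m i) = i"
    by (simp add: delete_index_def insert_index_def)
  then show ?thesis
    using dir_label_delete_index[OF assms(1,2), of "insert_index m i" m k] assms
    by (auto simp: insert_index_def split: if_splits)
qed

text \<open>The sum over multi-indices is the expansion of a product of letter sums, one for each
  direction.\<close>

lemma label_value_eq:
  "label_value A x = prod_list (map (\<lambda>i. letter_sum (dir_label A i x)) [1..<Suc (deg A x)])"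
proof -
  define ms where "ms = map (\<lambda>i. dir_label A i x) [1..<Suc (deg A x)]"
  have "label_value A x = (\<Sum>js \<in> listset (map (\<lambda>m. {..<length m}) ms).
           prod_list (map2 (\<lambda>m j. exterior_gen (m ! j)) ms js))"
    by (simp add: label_value_def ms_def dir_label_def)
  also have "\<dots> = (\<Sum>js \<in> listset (map (\<lambda>m. {..<length m}) ms).
      prod_list (map (\<lambda>i. exterior_gen (ms ! i ! (js ! i))) [0..<length (map (\<lambda>m. {..<length m})
          ms)]))"
  proof (rule sum.cong[OF refl])
    fix js assume js: "js \<in> listset (map (\<lambda>m. {..<length m}) ms)"
    have "length ys = length Ss" if "ys \<in> listset Ss" for ys and Ss :: "nat set list"
      using that by (induction Ss arbitrary: ys) (auto simp: set_Cons_def)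
    from this[OF js] have "map2 (\<lambda>m j. exterior_gen (m ! j)) ms js =
        map (\<lambda>i. exterior_gen (ms ! i ! (js ! i))) [0..<length (map (\<lambda>m. {..<length m}) ms)]"
      by (intro nth_equalityI) auto
    then show "prod_list (map2 (\<lambda>m j. exterior_gen (m ! j)) ms js) =
        prod_list (map (\<lambda>i. exterior_gen (ms ! i ! (js ! i))) [0..<length (map (\<lambda>m. {..<length m})
            ms)])"
      by (rule arg_cong)
  qed
  also have "\<dots> = prod_list (map (\<lambda>i. \<Sum>j \<in> map (\<lambda>m. {..<length m}) ms ! i. exterior_gen (ms ! i ! j))
      [0..<length (map (\<lambda>m. {..<length m}) ms)])"
    by (rule sum_prod_list_listset) auto
  also have "map (\<lambda>i. \<Sum>j \<in> map (\<lambda>m. {..<length m}) ms ! i. exterior_gen (ms ! i ! j))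
      [0..<length (map (\<lambda>m. {..<length m}) ms)] = map letter_sum ms"
    by (intro nth_equalityI) (auto simp: letter_sum_conv_sum)
  finally show ?thesis
    by (simp add: ms_def o_def)
qed

text \<open>The right-hand side does not mention \<open>k\<close>: opposite faces have the same
  value and cancel in a boundary, which is the cocycle property.\<close>

lemma label_value_bd:
  assumes A: "is_hda A" and x: "x \<in> cubes A" and m: "1 \<le> m" "m \<le> deg A x"
  shows "label_value A (bd A k m x) =
    prod_list (map (\<lambda>i. letter_sum (dir_label A (insert_index m i) x)) [1..<deg A x])"
proof -
  have "deg A (bd A k m x) = deg A x - 1"
    using precubical_set_bd(2)[OF is_hdaD(1)[OF A] x m] .
  then have "[1..<Suc (deg A (bd A k m x))] = [1..<deg A x]"
    using m by simp
  then show ?thesis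
    unfolding label_value_eq
    using dir_label_bd[OF A x m] by (auto intro!: arg_cong[where f = prod_list] map_cong)
qed

section \<open>Labels of homology classes\<close>

text \<open>All labeling cochains at once, in keeping with the chain complex that is not split by
  degree.\<close>

definition total_label :: "('a, 's list) hda \<Rightarrow> ('a \<Rightarrow>\<^sub>0 'r::comm_ring_1) \<Rightarrow> ('s, 'r) exterior" where
  "total_label A = linear_extension exterior_scale (label_value A)"

lemma sum_label_cochain:
  "(\<Sum>n \<in> deg A ` Poly_Mapping.keys z. label_cochain A n z) = total_label A z"
  unfolding total_label_def linear_extension_def label_cochain_def
  by (rule sum.image_gen[symmetric]) simp

lemma total_label_diff: "total_label A (c - d) = total_label A c - total_label A d"
  unfolding total_label_def by (rule module.linear_extension_diff[OF module_exterior_scale])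

lemma total_label_boundary_cube:
  assumes A: "is_hda A" and x: "x \<in> cubes A"
  shows "total_label A (boundary_cube A x) = 0"
  unfolding boundary_cube_def total_label_def
    module.linear_extension_sum[OF module_exterior_scale]
    module.linear_extension_diff[OF module_exterior_scale]
    module.linear_extension_single[OF module_exterior_scale]
  by (rule sum.neutral) (simp add: label_value_bd[OF A x])

lemma total_label_boundary:
  assumes A: "is_hda A" and c: "c \<in> chains A"
  shows "total_label A (boundary A c) = 0"
proof -
  have "total_label A (boundary A c)
      = linear_extension exterior_scale (\<lambda>x. total_label A (boundary_cube A x)) c"
    unfolding boundary_eq total_label_def
    by (rule module.linear_extension_linear_extension[OF module_exterior_scale])
  also have "\<dots> = linear_extension exterior_scale (\<lambda>_. 0) c"
    by (rule linear_extension_cong, rule total_label_boundary_cube[OF A])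
      (use c in \<open>auto simp: chains_def\<close>)
  finally show ?thesis
    by (simp add: module.linear_extension_zero_fun[OF module_exterior_scale])
qed

text \<open>Representatives differ by a boundary, on which the label vanishes. So the label takes
  one value on the class, and \<open>the_elem\<close> returns it.\<close>

lemma labeling_hom_class:
  assumes A: "is_hda A" and z: "z \<in> cycles A"
  shows "labeling_hom A ({(z, z'). z \<in> cycles A \<and> z' \<in> cycles A \<and> z - z' \<in> boundaries A} `` {z})
    = total_label A z" (is "labeling_hom A ?\<alpha> = _")
proof -
  have "total_label A z' = total_label A z" if "z' \<in> ?\<alpha>" for z'
  proof -
    from that obtain c where "c \<in> chains A" "z - z' = boundary A c"
      by (auto simp: boundaries_def)
    then show ?thesis
      using total_label_boundary[OF A, of c] total_label_diff[of A z z'] by simp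
  qed
  moreover have "z \<in> ?\<alpha>"
    using z by (auto simp: boundaries_def chains_def boundary_def intro!: image_eqI[of _ _ 0])
  ultimately have "total_label A ` ?\<alpha> = {total_label A z}"
    by blast
  then show ?thesis
    by (simp add: labeling_hom_def sum_label_cochain)
qed

lemma homology_obtain_cycle:
  assumes "is_hda A" "\<alpha> \<in> homology A"
  shows "\<exists>z \<in> cycles A. labeling_hom A \<alpha> = total_label A z"
  using assms(2) labeling_hom_class[OF assms(1)] unfolding homology_def by (blast elim: quotientE)

lemma homology_class_of_cycle:
  assumes "is_hda A" "z \<in> cycles A"
  shows "\<exists>\<alpha> \<in> homology A. labeling_hom A \<alpha> = total_label A z"
  using labeling_hom_class[OF assms] assms(2) unfolding homology_def by (blast intro: quotientI)

section \<open>Cross products of chains\<close>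

context Modules.module
begin

lemma linear_extension_fun_add:
  "linear_extension scale (\<lambda>x. h x + k x) c = linear_extension scale h c + linear_extension scale
      k c"
  by (simp add: linear_extension_def scale_right_distrib sum.distrib)

lemma linear_extension_fun_scale:
  "linear_extension scale (\<lambda>x. scale r (h x)) c = scale r (linear_extension scale h c)"
  by (simp add: linear_extension_def scale_sum_right mult.commute)

lemma linear_extension_swap:
  "linear_extension scale (\<lambda>x. linear_extension scale (h x) d) c =
    linear_extension scale (\<lambda>y. linear_extension scale (\<lambda>x. h x y) c) d"
  by (simp add: linear_extension_def scale_sum_right mult.commute sum.swap[of _ "Poly_Mapping.keys
      c"])

end

lemma tensor_hda_Nil [simp]:
  "cubes (tensor_hda []) = {[]}" "deg (tensor_hda []) xs = 0"
  by (simp_all add: tensor_hda_def tensor_pcs_def)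

lemma deg_tensor_hda [simp]:
  "deg (tensor_hda (A # As)) (x # xs) = deg A x + deg (tensor_hda As) xs"
  by (simp add: tensor_hda_def tensor_pcs_def)

lemma bd_tensor_hda:
  "bd (tensor_hda (A # As)) k i (x # xs) =
    (if i \<le> deg A x then bd A k i x # xs else x # bd (tensor_hda As) k (i - deg A x) xs)"
  by (simp add: tensor_hda_def tensor_pcs_def)

lemma label_tensor_hda [simp]:
  "label (tensor_hda (A # As)) (x # xs) = (if deg A x = 1 then label A x else label
      (tensor_hda As) xs)"
  by (simp add: tensor_hda_def)

lemma cubes_tensor_hda:
  "cubes (tensor_hda (A # As)) = {x # xs | x xs. x \<in> cubes A \<and> xs \<in> cubes (tensor_hda As)}"
  by (simp add: tensor_hda_def tensor_pcs_def set_Cons_def)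

lemma precubical_set_tensor_hda:
  assumes A: "precubical_set A" and As: "precubical_set (tensor_hda As)"
  shows "precubical_set (tensor_hda (A # As))"
  unfolding precubical_set_def
proof (intro conjI ballI allI impI)
  fix y k i assume "y \<in> cubes (tensor_hda (A # As))" "i \<in> {1..deg (tensor_hda (A # As)) y}"
  then obtain x xs where y: "y = x # xs" "x \<in> cubes A" "xs \<in> cubes (tensor_hda As)"
    and i: "1 \<le> i" "i \<le> deg A x + deg (tensor_hda As) xs"
    by (auto simp: cubes_tensor_hda)
  show "bd (tensor_hda (A # As)) k i y \<in> cubes (tensor_hda (A # As))"
    "deg (tensor_hda (A # As)) (bd (tensor_hda (A # As)) k i y) = deg (tensor_hda (A # As)) y - 1"
    using y i precubical_set_bd[OF A y(2) i(1)] precubical_set_bd[OF As y(3), of "i - deg A x"]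
    by (auto simp: bd_tensor_hda cubes_tensor_hda)
next
  fix y k l i j assume "y \<in> cubes (tensor_hda (A # As))"
    "1 \<le> i \<and> i < j \<and> j \<le> deg (tensor_hda (A # As)) y"
  then obtain x xs where y: "y = x # xs" "x \<in> cubes A" "xs \<in> cubes (tensor_hda As)"
    and ij: "1 \<le> i" "i < j" "j \<le> deg A x + deg (tensor_hda As) xs"
    by (auto simp: cubes_tensor_hda)
  consider "j \<le> deg A x" | "i \<le> deg A x" "deg A x < j" | "deg A x < i"
    by linarith
  then show "bd (tensor_hda (A # As)) k i (bd (tensor_hda (A # As)) l j y) =
    bd (tensor_hda (A # As)) l (j - 1) (bd (tensor_hda (A # As)) k i y)"
  proof cases
    case 1
    then have "bd A k i (bd A l j x) = bd A l (j - 1) (bd A k i x)"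
      using precubical_set_bd_bd[OF A y(2) ij(1,2)] by blast
    moreover have "i \<le> deg A x - 1" "j - 1 \<le> deg A x - 1"
      using 1 ij by linarith+
    ultimately show ?thesis
      using 1 ij precubical_set_bd(2)[OF A y(2)] unfolding y(1) by (simp add: bd_tensor_hda)
  next
    case 2
    moreover have "j - 1 - (deg A x - 1) = j - deg A x"
      using 2 ij by linarith
    moreover have "\<not> j - 1 \<le> deg A x - 1"
      using 2 ij by linarith
    ultimately show ?thesis
      using ij precubical_set_bd(2)[OF A y(2)] unfolding y(1) by (simp add: bd_tensor_hda)
  next
    case 3
    have "bd (tensor_hda As) k (i - deg A x) (bd (tensor_hda As) l (j - deg A x) xs) =
      bd (tensor_hda As) l (j - deg A x - 1) (bd (tensor_hda As) k (i - deg A x) xs)"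
      using 3 ij by (intro precubical_set_bd_bd[OF As y(3)]) linarith+
    moreover have "j - deg A x - 1 = j - 1 - deg A x" "\<not> j - 1 \<le> deg A x" "\<not> j \<le> deg A x"
      using 3 ij by linarith+
    ultimately show ?thesis
      using 3 unfolding y(1) by (simp add: bd_tensor_hda)
  qed
qed

text \<open>A square is a square of one factor or a product of two edges. In the latter, opposite
  sides are copies of the same edge of one factor.\<close>

lemma is_hda_tensor_hda_Cons:
  fixes A :: "('a, 'm::monoid_add) hda"
  assumes A: "is_hda A" and As: "is_hda (tensor_hda As)"
  shows "is_hda (tensor_hda (A # As))"
proof -
  have "initial (tensor_hda (A # As)) \<subseteq> cubes_of_deg (tensor_hda (A # As)) 0"
    "final (tensor_hda (A # As)) \<subseteq> cubes_of_deg (tensor_hda (A # As)) 0"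
    using A As
    by (force simp: is_hda_def tensor_hda_def tensor_pcs_def cubes_of_deg_def set_Cons_def)+
  moreover have "label (tensor_hda (A # As)) (bd (tensor_hda (A # As)) False i y) =
      label (tensor_hda (A # As)) (bd (tensor_hda (A # As)) True i y)"
    if "y \<in> cubes_of_deg (tensor_hda (A # As)) 2" "i \<in> {1, 2}" for y i
  proof -
    obtain x xs where y: "y = x # xs" "x \<in> cubes A" "xs \<in> cubes (tensor_hda As)"
      and d: "deg A x + deg (tensor_hda As) xs = 2"
      using \<open>y \<in> _\<close> by (auto simp: cubes_of_deg_def cubes_tensor_hda)
    consider "deg A x = 2" | "deg A x = 1" "deg (tensor_hda As) xs = 1"
      | "deg A x = 0" "deg (tensor_hda As) xs = 2"
      using d by linarith
    then show ?thesis
    proof cases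
      case 1
      then show ?thesis
        using is_hdaD(2)[OF A y(2) 1 that(2)] precubical_set_bd(2)[OF is_hdaD(1)[OF A] y(2), of i]
            that(2)
        unfolding y(1) by (auto simp: bd_tensor_hda)
    next
      case 2
      then show ?thesis
        using precubical_set_bd(2)[OF is_hdaD(1)[OF A] y(2), of 1] that(2)
        unfolding y(1) by (auto simp: bd_tensor_hda)
    next
      case 3
      then show ?thesis
        using is_hdaD(2)[OF As y(3) 3(2) that(2)] that(2)
        unfolding y(1) by (auto simp: bd_tensor_hda)
    qed
  qed
  ultimately show ?thesis
    using precubical_set_tensor_hda[OF is_hdaD(1)[OF A] is_hdaD(1)[OF As]]
    unfolding is_hda_def by blast
qed

text \<open>Passing to a face in a direction other than \<open>i\<close> preserves both labels. This
  is repeated until \<open>x\<close> is an edge and \<open>xs\<close> a vertex, where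
  \<open>edge0\<close> leaves the cube unchanged.\<close>

lemma dir_label_tensor_hda_left:
  assumes A: "is_hda A" and As: "is_hda (tensor_hda As)"
  shows "x \<in> cubes A \<Longrightarrow> xs \<in> cubes (tensor_hda As) \<Longrightarrow> 1 \<le> i \<Longrightarrow> i \<le> deg A x \<Longrightarrow>
    dir_label (tensor_hda (A # As)) i (x # xs) = dir_label A i x"
proof (induction "deg A x + deg (tensor_hda As) xs" arbitrary: x xs i rule: less_induct)
  case less
  let ?T = "tensor_hda (A # As)"
  have T: "is_hda ?T" using is_hda_tensor_hda_Cons[OF A As] .
  have xT: "x # xs \<in> cubes ?T" using less.prems by (auto simp: cubes_tensor_hda)
  consider "0 < deg (tensor_hda As) xs" | "deg (tensor_hda As) xs = 0" "1 < deg A x"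
    | "deg (tensor_hda As) xs = 0" "deg A x = 1"
    using less.prems by linarith
  then show ?case
  proof cases
    case 1
    let ?m = "deg (tensor_hda As) xs"
    have b: "bd (tensor_hda As) True ?m xs \<in> cubes (tensor_hda As)"
      "deg (tensor_hda As) (bd (tensor_hda As) True ?m xs) = ?m - 1"
      using precubical_set_bd[OF is_hdaD(1)[OF As] less.prems(2), of ?m] 1 by auto
    have "dir_label ?T i (bd ?T True (deg A x + ?m) (x # xs)) = dir_label ?T (insert_index
        (deg A x + ?m) i) (x # xs)"
      using 1 less.prems by (intro dir_label_bd[OF T xT]) auto
    moreover have "bd ?T True (deg A x + ?m) (x # xs) = x # bd (tensor_hda As) True ?m xs"
      using 1 by (simp add: bd_tensor_hda)
    moreover have "dir_label ?T i (x # bd (tensor_hda As) True ?m xs) = dir_label A i x"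
      using 1 b less.prems by (intro less.hyps) auto
    ultimately show ?thesis
      using 1 less.prems by (simp add: insert_index_def)
  next
    case 2
    \<comment> \<open>A direction of \<open>x\<close> other than \<open>i\<close>, available in
      degree at least 2; \<open>j\<close> is the number of direction \<open>i\<close> in the
      face.\<close>
    define m where "m = (if i = 1 then 2 else 1 :: nat)"
    define j where "j = delete_index m i"
    have m: "1 \<le> m" "m \<le> deg A x" "i \<noteq> m" using 2 less.prems by (auto simp: m_def)
    have j: "1 \<le> j" "j < deg A x" "insert_index m j = i"
      using 2 less.prems by (auto simp: m_def j_def delete_index_def insert_index_def)
    have b: "bd A True m x \<in> cubes A" "deg A (bd A True m x) = deg A x - 1"
      using precubical_set_bd[OF is_hdaD(1)[OF A] less.prems(1) m(1,2)] by auto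
    have "dir_label ?T j (bd ?T True m (x # xs)) = dir_label ?T (insert_index m j) (x # xs)"
      using m j by (intro dir_label_bd[OF T xT]) auto
    moreover have "bd ?T True m (x # xs) = bd A True m x # xs"
      using m by (simp add: bd_tensor_hda)
    moreover have "dir_label ?T j (bd A True m x # xs) = dir_label A j (bd A True m x)"
      using 2 b j less.prems by (intro less.hyps) auto
    moreover have "dir_label A j (bd A True m x) = dir_label A (insert_index m j) x"
      using m j by (intro dir_label_bd[OF A less.prems(1)]) auto
    ultimately show ?thesis
      using j by simp
  next
    case 3
    then show ?thesis
      using less.prems by (simp add: dir_label_def edge0_def)
  qed
qed

lemma dir_label_tensor_hda_right:
  assumes A: "is_hda A" and As: "is_hda (tensor_hda As)"
  shows "x \<in> cubes A \<Longrightarrow> xs \<in> cubes (tensor_hda As) \<Longrightarrow> 1 \<le> i \<Longrightarrow> i \<le> deg (tensor_hda As) xs \<Longrightarrow>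
    dir_label (tensor_hda (A # As)) (deg A x + i) (x # xs) = dir_label (tensor_hda As) i xs"
\<comment> \<open>As for the first factor, faces in other directions are taken until a vertex and an
  edge remain.\<close>
proof (induction "deg A x + deg (tensor_hda As) xs" arbitrary: x xs i rule: less_induct)
  case less
  let ?T = "tensor_hda (A # As)"
  let ?B = "tensor_hda As"
  have T: "is_hda ?T" using is_hda_tensor_hda_Cons[OF A As] .
  have xT: "x # xs \<in> cubes ?T" using less.prems by (auto simp: cubes_tensor_hda)
  consider "0 < deg A x" | "deg A x = 0" "1 < deg ?B xs" | "deg A x = 0" "deg ?B xs = 1"
    using less.prems by linarith
  then show ?case
  proof cases
    case 1
    have b: "bd A True 1 x \<in> cubes A" "deg A (bd A True 1 x) = deg A x - 1"
      using precubical_set_bd[OF is_hdaD(1)[OF A] less.prems(1), of 1] 1 by auto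
    have "dir_label ?T (deg A x - 1 + i) (bd ?T True 1 (x # xs))
        = dir_label ?T (insert_index 1 (deg A x - 1 + i)) (x # xs)"
      using 1 less.prems by (intro dir_label_bd[OF T xT]) auto
    moreover have "bd ?T True 1 (x # xs) = bd A True 1 x # xs"
      using 1 by (simp add: bd_tensor_hda)
    moreover have "dir_label ?T (deg A (bd A True 1 x) + i) (bd A True 1 x # xs) = dir_label ?B i
        xs"
      using 1 b less.prems by (intro less.hyps) auto
    moreover have "insert_index 1 (deg A x - 1 + i) = deg A x + i"
      using 1 less.prems by (simp add: insert_index_def)
    ultimately show ?thesis
      using b by simp
  next
    case 2
    define m where "m = (if i = 1 then 2 else 1 :: nat)"
    define j where "j = delete_index m i"
    have m: "1 \<le> m" "m \<le> deg ?B xs" "i \<noteq> m" using 2 less.prems by (auto simp: m_def)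
    have j: "1 \<le> j" "j < deg ?B xs" "insert_index m j = i"
      using 2 less.prems by (auto simp: m_def j_def delete_index_def insert_index_def)
    have b: "bd ?B True m xs \<in> cubes ?B" "deg ?B (bd ?B True m xs) = deg ?B xs - 1"
      using precubical_set_bd[OF is_hdaD(1)[OF As] less.prems(2) m(1,2)] by auto
    have "dir_label ?T j (bd ?T True m (x # xs)) = dir_label ?T (insert_index m j) (x # xs)"
      using m j 2 by (intro dir_label_bd[OF T xT]) auto
    moreover have "bd ?T True m (x # xs) = x # bd ?B True m xs"
      using m 2 by (simp add: bd_tensor_hda)
    moreover have "dir_label ?T (deg A x + j) (x # bd ?B True m xs) = dir_label ?B j (bd ?B True m
        xs)"
      using 2 b j less.prems by (intro less.hyps) auto
    moreover have "dir_label ?B j (bd ?B True m xs) = dir_label ?B (insert_index m j) xs"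
      using m j by (intro dir_label_bd[OF As less.prems(2)]) auto
    ultimately show ?thesis
      using j 2 by simp
  next
    case 3
    then show ?thesis
      using less.prems by (simp add: dir_label_def edge0_def)
  qed
qed

lemma label_value_tensor_hda:
  assumes "is_hda A" "is_hda (tensor_hda As)" "x \<in> cubes A" "xs \<in> cubes (tensor_hda As)"
  shows "label_value (tensor_hda (A # As)) (x # xs) = label_value A x * label_value
      (tensor_hda As) xs"
proof -
  let ?p = "deg A x" and ?q = "deg (tensor_hda As) xs"
  have "[1..<Suc (?p + ?q)] = [1..<Suc ?p] @ map (\<lambda>i. ?p + i) [1..<Suc ?q]"
    by (intro nth_equalityI) (auto simp: nth_append simp del: upt_Suc)
  then have "label_value (tensor_hda (A # As)) (x # xs) =
      prod_list (map (\<lambda>i. letter_sum (dir_label (tensor_hda (A # As)) i (x # xs))) [1..<Suc ?p]) *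
      prod_list (map (\<lambda>i. letter_sum (dir_label (tensor_hda (A # As)) (?p + i) (x # xs)))
          [1..<Suc ?q])"
    by (simp only: label_value_eq deg_tensor_hda map_append prod_list.append map_map o_def)
  also have "map (\<lambda>i. letter_sum (dir_label (tensor_hda (A # As)) i (x # xs))) [1..<Suc ?p] =
      map (\<lambda>i. letter_sum (dir_label A i x)) [1..<Suc ?p]"
    by (intro map_cong refl) (simp add: dir_label_tensor_hda_left[OF assms] del: upt_Suc)
  also have "map (\<lambda>i. letter_sum (dir_label (tensor_hda (A # As)) (?p + i) (x # xs))) [1..<Suc ?q] =
      map (\<lambda>i. letter_sum (dir_label (tensor_hda As) i xs)) [1..<Suc ?q]"
    by (intro map_cong refl) (simp add: dir_label_tensor_hda_right[OF assms] del: upt_Suc)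
  finally show ?thesis
    by (simp only: label_value_eq)
qed

text \<open>The Leibniz rule. Directions of the second factor are numbered after those of the first,
  which yields the sign.\<close>

lemma boundary_cube_tensor_hda:
  "boundary_cube (tensor_hda (A # As)) (x # xs) =
     linear_extension pm_scale (\<lambda>y. Poly_Mapping.single (y # xs) 1) (boundary_cube A x) +
     pm_scale ((- 1) ^ deg A x)
       (linear_extension pm_scale (\<lambda>ys. Poly_Mapping.single (x # ys) 1) (boundary_cube
           (tensor_hda As) xs))"
proof -
  let ?p = "deg A x" and ?q = "deg (tensor_hda As) xs"
  let ?s = "\<lambda>k i. Poly_Mapping.single (bd (tensor_hda (A # As)) k i (x # xs)) ((- 1) ^ i)"
  have "{1..?p + ?q} = {1..?p} \<union> {?p + 1..?p + ?q}" "{1..?p} \<inter> {?p + 1..?p + ?q} = {}"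
    by auto
  then have "boundary_cube (tensor_hda (A # As)) (x # xs) =
      (\<Sum>i = 1..?p. ?s False i - ?s True i) + (\<Sum>i = ?p + 1..?p + ?q. ?s False i - ?s True i)"
    unfolding boundary_cube_def deg_tensor_hda by (simp add: sum.union_disjoint)
  also have "(\<Sum>i = ?p + 1..?p + ?q. ?s False i - ?s True i) =
      (\<Sum>i = 1..?q. ?s False (?p + i) - ?s True (?p + i))"
    using sum.shift_bounds_cl_nat_ivl[of "\<lambda>i. ?s False i - ?s True i" 1 ?p ?q] by
        (simp add: add.commute)
  also have "\<dots> = pm_scale ((- 1) ^ ?p)
       (linear_extension pm_scale (\<lambda>ys. Poly_Mapping.single (x # ys) 1) (boundary_cube
           (tensor_hda As) xs))"
    unfolding boundary_cube_def module.linear_extension_sum[OF module_pm_scale]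
      module.linear_extension_diff[OF module_pm_scale] module.linear_extension_single[OF
          module_pm_scale]
      Modules.module.scale_sum_right[OF module_pm_scale]
          Modules.module.scale_right_diff_distrib[OF module_pm_scale]
    by (intro sum.cong refl) (simp add: bd_tensor_hda power_add)
  also have "(\<Sum>i = 1..?p. ?s False i - ?s True i) =
      linear_extension pm_scale (\<lambda>y. Poly_Mapping.single (y # xs) 1) (boundary_cube A x)"
    unfolding boundary_cube_def module.linear_extension_sum[OF module_pm_scale]
      module.linear_extension_diff[OF module_pm_scale] module.linear_extension_single[OF
          module_pm_scale]
    by (intro sum.cong refl) (simp add: bd_tensor_hda)
  finally show ?thesis .
qed

text \<open>The bilinear extension of \<open>(x, xs) \<mapsto> x # xs\<close>, that is, the homology
  cross product on the level of chains.\<close>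

definition cross_chain :: "('a \<Rightarrow>\<^sub>0 'r) \<Rightarrow> ('a list \<Rightarrow>\<^sub>0 'r) \<Rightarrow> ('a list \<Rightarrow>\<^sub>0 'r::comm_ring_1)" where
  "cross_chain z w = linear_extension pm_scale
    (\<lambda>x. linear_extension pm_scale (\<lambda>xs. Poly_Mapping.single (x # xs) 1) w) z"

text \<open>Each half of the Leibniz rule vanishes separately. As \<open>z\<close> may mix degrees,
  the sign stays inside the sum over \<open>x\<close>, where it multiplies the boundary of
  \<open>w\<close>; for the other half the order of summation is exchanged first.\<close>

lemma boundary_cross_chain:
  assumes z: "boundary A z = 0" and w: "boundary (tensor_hda As) w = 0"
  shows "boundary (tensor_hda (A # As)) (cross_chain z w) = 0"
proof -
  note [simp] = module.linear_extension_linear_extension[OF module_pm_scale]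
    module.linear_extension_single[OF module_pm_scale] Modules.module.scale_one[OF module_pm_scale]
    module.linear_extension_fun_add[OF module_pm_scale] module.linear_extension_zero_fun[OF
        module_pm_scale]
    module.linear_extension_fun_scale[OF module_pm_scale] module.linear_extension_0[OF
        module_pm_scale]
    Modules.module.scale_zero_right[OF module_pm_scale]
  have "boundary (tensor_hda (A # As)) (cross_chain z w) =
    linear_extension pm_scale (\<lambda>x. linear_extension pm_scale (\<lambda>xs.
      boundary_cube (tensor_hda (A # As)) (x # xs)) w) z"
    by (simp add: boundary_eq cross_chain_def)
  also have "\<dots> =
      linear_extension pm_scale (\<lambda>x. linear_extension pm_scale (\<lambda>xs.
        linear_extension pm_scale (\<lambda>y. Poly_Mapping.single (y # xs) 1) (boundary_cube A x)) w) z +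
      linear_extension pm_scale (\<lambda>x. pm_scale ((- 1) ^ deg A x)
       (linear_extension pm_scale (\<lambda>ys. Poly_Mapping.single (x # ys) 1) (boundary (tensor_hda As)
           w))) z"
    by (simp add: boundary_cube_tensor_hda boundary_eq)
  also have "linear_extension pm_scale (\<lambda>x. linear_extension pm_scale (\<lambda>xs.
        linear_extension pm_scale (\<lambda>y. Poly_Mapping.single (y # xs) 1) (boundary_cube A x)) w) z =
      linear_extension pm_scale (\<lambda>xs.
        linear_extension pm_scale (\<lambda>y. Poly_Mapping.single (y # xs) 1) (boundary A z)) w"
    by (subst module.linear_extension_swap[OF module_pm_scale]) (simp add: boundary_eq)
  finally show ?thesis
    by (simp add: z w)
qed

lemma cross_chain_in_chains:
  assumes "z \<in> chains A" "w \<in> chains (tensor_hda As)"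
  shows "cross_chain z w \<in> chains (tensor_hda (A # As))"
proof -
  have "Poly_Mapping.keys (cross_chain z w) \<subseteq> (\<Union>x \<in> Poly_Mapping.keys z. \<Union>xs \<in> Poly_Mapping.keys w.
      Poly_Mapping.keys (Poly_Mapping.single (x # xs) (1 :: 'b)))"
    unfolding cross_chain_def
    by (rule order_trans[OF keys_linear_extension UN_mono[OF order_refl keys_linear_extension]])
  also have "\<dots> \<subseteq> cubes (tensor_hda (A # As))"
    using assms by (auto simp: chains_def cubes_tensor_hda split: if_splits)
  finally show ?thesis
    by (simp add: chains_def)
qed

lemma linear_extension_mult_left:
  "linear_extension exterior_scale (\<lambda>x. h x * a) c = linear_extension exterior_scale h c * a"
  by (simp add: linear_extension_def sum_distrib_right exterior_scale_mult_left)

lemma linear_extension_mult_right: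
  "linear_extension exterior_scale (\<lambda>x. a * h x) c = a * linear_extension exterior_scale h c"
  by (simp add: linear_extension_def sum_distrib_left exterior_scale_mult_right)

lemma total_label_cross_chain:
  assumes A: "is_hda A" and As: "is_hda (tensor_hda As)"
    and z: "z \<in> chains A" and w: "w \<in> chains (tensor_hda As)"
  shows "total_label (tensor_hda (A # As)) (cross_chain z w) =
    total_label A z * total_label (tensor_hda As) w"
proof -
  have "total_label (tensor_hda (A # As)) (cross_chain z w) =
    linear_extension exterior_scale (\<lambda>x. linear_extension exterior_scale (\<lambda>xs.
      label_value (tensor_hda (A # As)) (x # xs)) w) z"
    by (simp add: total_label_def cross_chain_def
        module.linear_extension_linear_extension[OF module_exterior_scale]
        module.linear_extension_single[OF module_exterior_scale]
        Modules.module.scale_one[OF module_exterior_scale])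
  also have "\<dots> = linear_extension exterior_scale (\<lambda>x. linear_extension exterior_scale (\<lambda>xs.
      label_value A x * label_value (tensor_hda As) xs) w) z"
    using z w by (intro linear_extension_cong label_value_tensor_hda[OF A As])
        (auto simp: chains_def)
  also have "\<dots> = total_label A z * total_label (tensor_hda As) w"
    by (simp add: total_label_def linear_extension_mult_left linear_extension_mult_right)
  finally show ?thesis .
qed

lemma tensor_hda_cycle:
  fixes zs :: "('a \<Rightarrow>\<^sub>0 'r::comm_ring_1) list" and As :: "('a, 's list) hda list"
  assumes "list_all2 (\<lambda>A z. is_hda A \<and> z \<in> cycles A) As zs"
  shows "is_hda (tensor_hda As) \<and> (\<exists>z \<in> cycles (tensor_hda As).
    total_label (tensor_hda As) z = prod_list (map2 total_label As zs))"
  using assms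
proof (induction rule: list_all2_induct)
  case Nil
  have "is_hda (tensor_hda [] :: ('a list, 's list) hda)"
    by (auto simp: is_hda_def precubical_set_def cubes_of_deg_def tensor_hda_def tensor_pcs_def)
  \<comment> \<open>The empty tensor product is a vertex, and its label is the empty wedge product
    1.\<close>
  moreover have "Poly_Mapping.single [] (1 :: 'r) \<in> cycles (tensor_hda [] :: ('a list, 's list)
      hda)"
    by (auto simp: cycles_def chains_def boundary_def boundary_cube_def tensor_hda_def
        tensor_pcs_def
        Modules.module.scale_zero_right[OF module_pm_scale])
  moreover have "total_label (tensor_hda [] :: ('a list, 's list) hda) (Poly_Mapping.single []
      (1 :: 'r)) = 1"
    by (simp add: total_label_def label_value_eq
        module.linear_extension_single[OF module_exterior_scale]
        Modules.module.scale_one[OF module_exterior_scale])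
  ultimately show ?case by auto
next
  case (Cons A As z zs)
  then obtain w where w: "w \<in> cycles (tensor_hda As)"
    "total_label (tensor_hda As) w = prod_list (map2 total_label As zs)" by blast
  have "cross_chain z w \<in> cycles (tensor_hda (A # As))"
    using Cons w by (simp add: cycles_def cross_chain_in_chains boundary_cross_chain)
  moreover have "total_label (tensor_hda (A # As)) (cross_chain z w) =
      prod_list (map2 total_label (A # As) (z # zs))"
    using Cons w by (simp add: total_label_cross_chain cycles_def)
  ultimately show ?case
    using Cons is_hda_tensor_hda_Cons by blast
qed

section \<open>The chain map of an elementary cubical dimap\<close>

text \<open>The choice is immaterial by \<open>dimap_data_unique\<close>.\<close>

definition subdivision_chain ::
    "(('a \<times> real list) set \<Rightarrow> ('b \<times> real list) set) \<Rightarrow> ('a, 'y) precubical_scheme \<Rightarrow>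
     ('b, 'z) precubical_scheme \<Rightarrow> 'a \<Rightarrow> ('b \<Rightarrow>\<^sub>0 'r::comm_ring_1)" where
  "subdivision_chain f Q P x = (SOME c. \<exists>ls g \<sigma>. dimap_data f Q P x ls g \<sigma> \<and>
     c = (\<Sum>js \<in> grid_box ls. Poly_Mapping.single (g (map Edge js)) (of_int (sign \<sigma>))))"

text \<open>By uniqueness any data may be used for the evaluation, in particular the data that a
  face inherits from its cube.\<close>

lemma subdivision_chain_eq:
  fixes f :: "('a \<times> real list) set \<Rightarrow> ('b \<times> real list) set"
  assumes P: "precubical_set P" and D: "dimap_data f Q P x ls g \<sigma>"
  shows "(subdivision_chain f Q P x :: 'b \<Rightarrow>\<^sub>0 'r::comm_ring_1) =
    (\<Sum>js \<in> grid_box ls. Poly_Mapping.single (g (map Edge js)) (of_int (sign \<sigma>)))"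
  unfolding subdivision_chain_def
proof (rule some_equality)
  fix c :: "'b \<Rightarrow>\<^sub>0 'r" assume "\<exists>ls g \<sigma>. dimap_data f Q P x ls g \<sigma> \<and>
     c = (\<Sum>js \<in> grid_box ls. Poly_Mapping.single (g (map Edge js)) (of_int (sign \<sigma>)))"
  then obtain ls' g' \<sigma>' where D': "dimap_data f Q P x ls' g' \<sigma>'"
    and c: "c = (\<Sum>js \<in> grid_box ls'. Poly_Mapping.single (g' (map Edge js)) (of_int (sign \<sigma>')))"
    by blast
  show "c = (\<Sum>js \<in> grid_box ls. Poly_Mapping.single (g (map Edge js)) (of_int (sign \<sigma>)))"
    unfolding c dimap_data_unique(1,2)[OF P D D']
    by (rule sum.cong) (use dimap_data_unique[OF P D D'] in auto)
qed (use D in blast)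

lemma dimap_dataD:
  assumes "dimap_data f Q P x ls g \<sigma>"
  shows "length ls = deg Q x" "precubical_morphism (grid ls) P g" "\<sigma> permutes {..<deg Q x}"
    "\<And>i. i < deg Q x \<Longrightarrow> 1 \<le> ls ! i"
proof -
  show "1 \<le> ls ! i" if "i < deg Q x" for i
    using assms that by (simp add: dimap_data_def)
qed (use assms in \<open>auto simp: dimap_data_def\<close>)

lemma morphism_top_cube:
  assumes g: "precubical_morphism (grid ls) P g" and js: "js \<in> grid_box ls"
  shows "g (map Edge js) \<in> cubes P" "deg P (g (map Edge js)) = length ls"
  using g map_Edge_in_grid[OF js] by (auto simp: precubical_morphism_def)

lemma bd_morphism_top_cube:
  assumes g: "precubical_morphism (grid ls) P g" and i: "i < length ls"
    and js: "insert_at i j js \<in> grid_box ls"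
  shows "bd P k (Suc i) (g (map Edge (insert_at i j js))) =
    g (insert_at i (Vertex (if k then j else j - 1)) (map Edge js))"
proof -
  have len: "length ls = Suc (length js)"
    using js by (simp add: in_grid_box_iff)
  have "bd P k (Suc i) (g (map Edge (insert_at i j js))) =
      g (bd (grid ls) k (Suc i) (map Edge (insert_at i j js)))"
    using g map_Edge_in_grid[OF js] i by (simp add: precubical_morphism_def)
  then show ?thesis
    using bd_top_cube[of i js ls k j] len i by simp
qed

lemma sum_telescope_int:
  fixes h :: "int \<Rightarrow> 'a::ab_group_add"
  assumes "0 \<le> l"
  shows "(\<Sum>j = 1..l. h (j - 1) - h j) = h 0 - h l"
  using assms
proof (induction l rule: int_ge_induct)
  case (step l)
  have "{1..l + 1} = insert (l + 1) {1..l}" using step by auto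
  then show ?case using step by simp
qed simp

lemma sum_from_1_conv_lessThan: "(\<Sum>m = 1..n. h m) = (\<Sum>m < n. h (Suc m))"
  by (rule sum.reindex_bij_witness[of _ Suc "\<lambda>m. m - 1"]) auto

text \<open>After telescoping in grid direction \<open>i\<close> the first and the last slice
  remain. They subdivide the two faces of \<open>x\<close> in direction \<open>\<sigma> i\<close>,
  so what is left to check is the sign.\<close>

lemma boundary_subdivision_chain:
  assumes f: "elementary_cubical_dimap Q P f" and x: "x \<in> cubes Q"
  shows "boundary P (subdivision_chain f Q P x) =
    linear_extension pm_scale (subdivision_chain f Q P) (boundary_cube Q x :: 'a \<Rightarrow>\<^sub>0
        'r::comm_ring_1)"
proof -
  have Q: "precubical_set Q" and P: "precubical_set P"
    using f by (auto simp: elementary_cubical_dimap_def)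
  obtain ls g \<sigma> where D: "dimap_data f Q P x ls g \<sigma>"
    using elementary_cubical_dimap_data[OF f x] by blast
  define n where "n = deg Q x"
  define s where "s = (of_int (sign \<sigma>) :: 'r)"
  have len: "length ls = n" and g: "precubical_morphism (grid ls) P g" and \<sigma>: "\<sigma> permutes {..<n}"
    and l1: "\<And>i. i < n \<Longrightarrow> 1 \<le> ls ! i"
    using dimap_dataD[OF D] by (auto simp: n_def)
  define S where "S i v js r = Poly_Mapping.single (g (insert_at i (Vertex v) (map Edge js)))
      (r :: 'r)"
    for i v js r
  define T where "T i = (\<Sum>js \<in> grid_box (delete_at i ls).
    S i 0 js ((- 1) ^ Suc i * s) - S i (ls ! i) js ((- 1) ^ Suc i * s))" for i
  have "boundary P (subdivision_chain f Q P x) =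
      (\<Sum>js \<in> grid_box ls. pm_scale s (boundary_cube P (g (map Edge js))))"
    unfolding subdivision_chain_eq[OF P D] s_def[symmetric] boundary_eq
      module.linear_extension_sum[OF module_pm_scale] module.linear_extension_single[OF
          module_pm_scale] ..
  also have "\<dots> = (\<Sum>js \<in> grid_box ls. \<Sum>i < n.
      Poly_Mapping.single (bd P False (Suc i) (g (map Edge js))) ((- 1) ^ Suc i * s) -
      Poly_Mapping.single (bd P True (Suc i) (g (map Edge js))) ((- 1) ^ Suc i * s))"
    using morphism_top_cube(2)[OF g]
    by (intro sum.cong refl) (simp add: boundary_cube_def len sum_from_1_conv_lessThan[unfolded
        One_nat_def] mult.commute
        Modules.module.scale_sum_right[OF module_pm_scale]
            Modules.module.scale_right_diff_distrib[OF module_pm_scale]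
        del: power_Suc)
  also have "\<dots> = (\<Sum>i < n. \<Sum>js \<in> grid_box ls.
      Poly_Mapping.single (bd P False (Suc i) (g (map Edge js))) ((- 1) ^ Suc i * s) -
      Poly_Mapping.single (bd P True (Suc i) (g (map Edge js))) ((- 1) ^ Suc i * s))"
    by (rule sum.swap)
  also have "\<dots> = (\<Sum>i < n. T i)"
  proof (rule sum.cong[OF refl])
    fix i assume "i \<in> {..<n}"
    then have i: "i < length ls" by (simp add: len)
    have "(\<Sum>js \<in> grid_box ls.
        Poly_Mapping.single (bd P False (Suc i) (g (map Edge js))) ((- 1) ^ Suc i * s) -
        Poly_Mapping.single (bd P True (Suc i) (g (map Edge js))) ((- 1) ^ Suc i * s)) =
      (\<Sum>js \<in> grid_box (delete_at i ls). \<Sum>j = 1..ls ! i.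
        S i (j - 1) js ((- 1) ^ Suc i * s) - S i j js ((- 1) ^ Suc i * s))"
      unfolding sum_grid_box_insert_at[OF i] S_def
      by (intro sum.cong refl) (simp add: bd_morphism_top_cube[OF g i] insert_at_in_grid_box[OF i])
    also have "\<dots> = T i"
      unfolding T_def using l1[of i] i len by (intro sum.cong refl sum_telescope_int) auto
    finally show "(\<Sum>js \<in> grid_box ls.
        Poly_Mapping.single (bd P False (Suc i) (g (map Edge js))) ((- 1) ^ Suc i * s) -
        Poly_Mapping.single (bd P True (Suc i) (g (map Edge js))) ((- 1) ^ Suc i * s)) = T i" .
  qed
  also have "\<dots> = (\<Sum>i < n. pm_scale ((- 1) ^ Suc (\<sigma> i)) (subdivision_chain f Q P
      (bd Q False (Suc (\<sigma> i)) x)) -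
      pm_scale ((- 1) ^ Suc (\<sigma> i)) (subdivision_chain f Q P (bd Q True (Suc (\<sigma> i)) x)))"
  proof (rule sum.cong[OF refl])
    fix i assume "i \<in> {..<n}"
    then have i: "i < n" by simp
    then obtain n' where n': "n = Suc n'" by (cases n) auto
    have \<sigma>': "\<sigma> permutes {0..<Suc n'}"
      using \<sigma> by (simp add: n' atLeast0LessThan)
    have si: "\<sigma> i < Suc n'" "i < Suc n'"
      using permutes_in_image[OF \<sigma>, of i] i n' by auto
    \<comment> \<open>The cofactor sign: deleting row \<open>i\<close> and column
      \<open>\<sigma> i\<close> changes the sign of the permutation by (-1)^(i + \<sigma>
      i).\<close>
    have "s = (- 1) ^ (i + \<sigma> i) * of_int (sign (permutation_delete \<sigma> i))"
      using signof_permutation_insert[OF permutation_delete_permutes[OF \<sigma>' si(2)] si(2) si(1),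
          where 'a = 'r]
      by (simp add: s_def permutation_insert_delete[OF \<sigma>' si(2)])
    then have sgn: "(- 1) ^ Suc (\<sigma> i) * of_int (sign (permutation_delete \<sigma> i)) = (- 1) ^ Suc i * s"
      by (simp add: power_add minus_one_mult_self flip: mult.assoc)
    have "pm_scale ((- 1) ^ Suc (\<sigma> i)) (subdivision_chain f Q P (bd Q k (Suc (\<sigma> i)) x)) =
      (\<Sum>js \<in> grid_box (delete_at i ls). S i (if k then ls ! i else 0) js ((- 1) ^ Suc i * s))" for k
      unfolding subdivision_chain_eq[OF P dimap_data_face[OF D Q x i[unfolded n_def]]]
        Modules.module.scale_sum_right[OF module_pm_scale] S_def
      using sgn by (intro sum.cong refl) (simp add: o_def del: power_Suc)
    from this[of False] this[of True]
    show "T i = pm_scale ((- 1) ^ Suc (\<sigma> i)) (subdivision_chain f Q P (bd Q False (Suc (\<sigma> i)) x)) -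
        pm_scale ((- 1) ^ Suc (\<sigma> i)) (subdivision_chain f Q P (bd Q True (Suc (\<sigma> i)) x))"
      by (simp add: T_def sum_subtractf del: power_Suc)
  qed
  \<comment> \<open>The sum over grid directions is reindexed by \<open>\<sigma>\<close> to run over
    the directions of \<open>x\<close>.\<close>
  also have "\<dots> = (\<Sum>m < n. pm_scale ((- 1) ^ Suc m) (subdivision_chain f Q P (bd Q False (Suc m)
      x)) -
      pm_scale ((- 1) ^ Suc m) (subdivision_chain f Q P (bd Q True (Suc m) x)))"
    by (rule sum.permute[OF \<sigma>, unfolded o_def, symmetric])
  also have "\<dots> = linear_extension pm_scale (subdivision_chain f Q P) (boundary_cube Q x)"
    unfolding boundary_cube_def n_def[symmetric] sum_from_1_conv_lessThan
      module.linear_extension_sum[OF module_pm_scale] module.linear_extension_diff[OF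
          module_pm_scale]
      module.linear_extension_single[OF module_pm_scale] ..
  finally show ?thesis .
qed

lemma keys_subdivision_chain:
  assumes f: "elementary_cubical_dimap Q P f" and x: "x \<in> cubes Q"
  shows "Poly_Mapping.keys (subdivision_chain f Q P x) \<subseteq> cubes P"
proof -
  obtain ls g \<sigma> where D: "dimap_data f Q P x ls g \<sigma>"
    using elementary_cubical_dimap_data[OF f x] by blast
  have P: "precubical_set P"
    using f by (simp add: elementary_cubical_dimap_def)
  show ?thesis
    unfolding subdivision_chain_eq[OF P D]
    using keys_sum[of "\<lambda>js. Poly_Mapping.single (g (map Edge js)) (of_int (sign \<sigma>))" "grid_box ls"]
      morphism_top_cube(1)[OF dimap_dataD(2)[OF D]]
    by (fastforce split: if_splits)
qed


section \<open>Labels under subdivision\<close>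

text \<open>Neighbouring top cubes in direction \<open>m\<close> share a face, and since
  \<open>m\<close> differs from \<open>i\<close> that face contains edges in direction
  \<open>i\<close>. So the label is constant along the row.\<close>

lemma dir_label_grid_update:
  assumes A: "is_hda A" and g: "precubical_morphism (grid ls) A g"
    and m: "m < length ls" "m \<noteq> i" "i < length ls"
    and js: "js \<in> grid_box ls" and j: "1 \<le> j" "j \<le> ls ! m"
  shows "dir_label A (Suc i) (g (map Edge (js[m := j]))) = dir_label A (Suc i) (g (map Edge js))"
proof -
  have len: "length js = length ls" using js by (simp add: in_grid_box_iff)
  define js' where "js' = delete_at m js"
  define L where "L v = dir_label A (Suc i) (g (map Edge (insert_at m v js')))" for v
  have grid_box: "insert_at m v js' \<in> grid_box ls \<longleftrightarrow> 1 \<le> v \<and> v \<le> ls ! m" for v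
    using js insert_at_in_grid_box[OF m(1), of "js ! m" js'] insert_at_in_grid_box[OF m(1), of v
        js'] m len
    by (auto simp: js'_def insert_at_delete_at)
  have L: "L v = dir_label A (delete_index (Suc m) (Suc i))
      (g (insert_at m (Vertex (if k then v else v - 1)) (map Edge js')))"
    if v: "1 \<le> v" "v \<le> ls ! m" for v k
  proof -
    have b: "insert_at m v js' \<in> grid_box ls" using grid_box v by blast
    show ?thesis
      unfolding L_def bd_morphism_top_cube[OF g m(1) b, symmetric]
      using morphism_top_cube[OF g b] m by (intro dir_label_delete_index[OF A, symmetric]) auto
  qed
  have const: "L v = L 1" if "1 \<le> v" "v \<le> ls ! m" for v
    using that
  proof (induction v rule: int_ge_induct)
    case (step v)
    then show ?case
      using L[of v True] L[of "v + 1" False] by simp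
  qed simp
  have "js[m := j] = insert_at m j js'"
    using m len by (simp add: js'_def insert_at_def delete_at_def upd_conv_take_nth_drop min_def)
  moreover have "js = insert_at m (js ! m) js'"
    using m len by (simp add: js'_def insert_at_delete_at)
  moreover have "1 \<le> js ! m" "js ! m \<le> ls ! m"
    using js m by (auto simp: in_grid_box_iff)
  ultimately show ?thesis
    using const[of j] const[of "js ! m"] j by (metis L_def)
qed

text \<open>The entries of \<open>js\<close> are replaced by those of \<open>js'\<close> one at a
  time from the left; at position \<open>i\<close> nothing changes.\<close>

lemma dir_label_grid:
  assumes A: "is_hda A" and g: "precubical_morphism (grid ls) A g" and i: "i < length ls"
    and js: "js \<in> grid_box ls" "js' \<in> grid_box ls" and eq: "js ! i = js' ! i"
  shows "dir_label A (Suc i) (g (map Edge js)) = dir_label A (Suc i) (g (map Edge js'))"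
proof -
  have len: "length js = length ls" "length js' = length ls" using js by
      (auto simp: in_grid_box_iff)
  have "dir_label A (Suc i) (g (map Edge (take k js' @ drop k js))) = dir_label A (Suc i)
      (g (map Edge js))"
    if "k \<le> length ls" for k
    using that
  proof (induction k)
    case (Suc k)
    let ?h = "take k js' @ drop k js"
    have h: "?h \<in> grid_box ls"
      using js Suc.prems by (auto simp: in_grid_box_iff nth_append min_def)
    have upd: "take (Suc k) js' @ drop (Suc k) js = ?h[k := js' ! k]"
      using Suc.prems len
      by (simp add: take_Suc_conv_app_nth list_update_append min_def Cons_nth_drop_Suc[symmetric])
    show ?case
    proof (cases "k = i")
      case True
      then have "?h[k := js' ! k] = ?h"
        using eq len Suc.prems by (simp add: list_update_id nth_append list_update_same_conv
            min_def)
      then show ?thesis using upd Suc by simp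
    next
      case False
      then have "dir_label A (Suc i) (g (map Edge (?h[k := js' ! k]))) = dir_label A (Suc i)
          (g (map Edge ?h))"
        using Suc.prems i js h by (intro dir_label_grid_update[OF A g]) (auto simp: in_grid_box_iff)
      then show ?thesis using upd Suc by simp
    qed
  qed simp
  from this[of "length ls"] show ?thesis
    using len by simp
qed

text \<open>Paths are grids with one factor, which makes the uniqueness of subdivision data
  available for image paths.\<close>

lemma precubical_morphism_interval_iff:
  "precubical_morphism (interval_pcs 0 l) P \<nu> \<longleftrightarrow> precubical_morphism (grid [l]) P (\<lambda>c. \<nu> (hd c))"
proof -
  have cubes: "cubes (grid [l]) = (\<lambda>c. [c]) ` cubes (interval_pcs 0 l)"
    by (auto simp: grid_def tensor_pcs_def set_Cons_def)
  have deg: "deg (grid [l]) [c] = deg (interval_pcs 0 l) c" for c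
    by (simp add: interval_pcs_def)
  have bd: "bd (grid [l]) k i [c] = [bd (interval_pcs 0 l) k i c]" if "i \<le> deg (interval_pcs 0 l)
      c" for k i c
    using that by (simp add: grid_def tensor_pcs_def)
  show ?thesis
    unfolding precubical_morphism_def cubes by (auto simp: deg bd simp del: deg_grid_Cons)
qed

lemma precubical_morphism_interval_eq:
  assumes \<nu>: "precubical_morphism (interval_pcs 0 l) P \<nu>" and \<nu>': "precubical_morphism
      (interval_pcs 0 l) P \<nu>'"
    and l: "1 \<le> l" and eq: "\<And>j. 1 \<le> j \<Longrightarrow> j \<le> l \<Longrightarrow> \<nu> (Edge j) = \<nu>' (Edge j)"
    and c: "c \<in> cubes (interval_pcs 0 l)"
  shows "\<nu> c = \<nu>' c"
proof (cases c)
  case (Edge j)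
  then show ?thesis using c eq by simp
next
  case (Vertex j)
  \<comment> \<open>Every vertex is the end of the edge of the same number, except vertex 0, which
    is the start of edge 1.\<close>
  define k where "k = (j \<noteq> 0)"
  define e where "e = (if k then j else 1)"
  have e: "1 \<le> e" "e \<le> l" and j: "Vertex j = bd (interval_pcs 0 l) k 1 (Edge e)"
    using c Vertex l by (auto simp: e_def k_def interval_pcs_def)
  have "\<mu> (Vertex j) = bd P k 1 (\<mu> (Edge e))" if "precubical_morphism (interval_pcs 0 l) P \<mu>" for \<mu>
  proof -
    have "Edge e \<in> cubes (interval_pcs 0 l)" "deg (interval_pcs 0 l) (Edge e) = 1"
      using e by (auto simp: interval_pcs_def)
    with that show ?thesis unfolding j by (auto simp: precubical_morphism_def)
  qed
  then show ?thesis
    using \<nu> \<nu>' eq[OF e] Vertex by metis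
qed

text \<open>The label condition of a dimap is applied to the path of length 1 along
  \<open>x\<close>. Its image is a definite description, so the path along the grid of
  \<open>x\<close> must be shown to be the only candidate.\<close>

lemma dimap_label_edge:
  assumes f: "elementary_hda_dimap B A f" and x: "x \<in> cubes B" and d: "deg B x = 1"
    and D: "dimap_data f B A x ls g \<sigma>"
  shows "label B x = sum_list (map (\<lambda>j. label A (g [Edge j])) [1..ls ! 0])"
proof -
  have B: "precubical_set B" and A: "precubical_set A"
    using f by (auto simp: elementary_hda_dimap_def is_hda_def)
  obtain l where ls: "ls = [l]" and l: "1 \<le> l"
    using dimap_dataD(1,4)[OF D] d by (cases ls) auto
  have g: "precubical_morphism (grid [l]) A g"
    using dimap_dataD(2)[OF D] ls by simp
  obtain \<phi> where \<phi>: "increasing_homeo 1 (of_int l) \<phi>" and \<sigma>: "\<sigma> permutes {..<1}"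
    and fx: "\<And>u. u \<in> unit_cube 1 \<Longrightarrow> f (pt B x u) = pt A (g [real_cell (\<phi> (u ! \<sigma> 0))]) (real_coords
        (\<phi> (u ! \<sigma> 0)))"
    using D by (auto simp: dimap_data_def d ls)
  have \<sigma>0: "\<sigma> 0 = 0" using permutes_in_image[OF \<sigma>, of 0] by simp
  have fx: "f (pt B x [t]) = pt A (g [real_cell (\<phi> t)]) (real_coords (\<phi> t))" if "t \<in> {0..1}" for t
    using fx[of "[t]"] that \<sigma>0 by (simp add: unit_cube_iff)
  have im: "\<phi> t \<in> {0..of_int l}" if "t \<in> {0..1}" for t
    using increasing_homeoD(2)[OF \<phi>] l that by auto
  \<comment> \<open>The path along \<open>x\<close>; \<open>restrict\<close> supplies the default
    value that \<open>paths\<close> prescribes outside the interval.\<close>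
  define \<omega> where "\<omega> = restrict (\<lambda>c. case c of Edge _ \<Rightarrow> x | Vertex j \<Rightarrow> bd B (j = 1) 1 x)
      (cubes (interval_pcs 0 1))"
  have bx: "bd B k 1 x \<in> cubes B" "deg B (bd B k 1 x) = 0" for k
    using precubical_set_bd[OF B x, of 1 k] d by auto
  have \<omega>m: "precubical_morphism (interval_pcs 0 1) B \<omega>"
    using x d bx by (auto simp: precubical_morphism_def \<omega>_def interval_pcs_def)
  have "\<omega> \<in> extensional (cubes (interval_pcs 0 1))"
    by (simp add: \<omega>_def)
  then have \<omega>: "(1, \<omega>) \<in> paths B"
    using \<omega>m by (simp add: paths_def)
  have \<omega>t: "realization_path B (1, \<omega>) t = pt B x [t]" if t: "t \<in> {0..1}" for t
  proof -
    have path: "realization_path B (1, \<omega>) t = pt B (\<omega> (real_cell t)) (real_coords t)"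
      using realization_map_pt[OF \<omega>m] by (simp add: realization_path_def interval_point_def)
    have face: "pt B (bd B k 1 x) [] = pt B x [of_bool k]" for k
      using pt_bd[OF x, of 1 "[]" k] d by (simp add: unit_cube_iff coface_def)
    consider "t = 0" | "t = 1" | "0 < t" "t < 1" using t by fastforce
    then show ?thesis
    proof cases
      case 3
      then have "t \<notin> \<int>" by (auto elim!: Ints_cases)
      moreover have "\<lceil>t\<rceil> = 1" "frac t = t" using 3 by (auto simp: ceiling_eq_iff frac_eq)
      ultimately show ?thesis
        using path by (simp add: real_cell_def real_coords_def \<omega>_def)
    qed (use path face[of True] face[of False] in \<open>simp_all add: real_cell_def real_coords_def
        \<omega>_def\<close>)
  qed
  define \<nu> where "\<nu> = restrict (\<lambda>c. g [c]) (cubes (interval_pcs 0 l))"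
  have "precubical_morphism (interval_pcs 0 l) A (\<lambda>c. g [c])"
    unfolding precubical_morphism_interval_iff using g
    by (auto simp: precubical_morphism_def grid_def tensor_pcs_def set_Cons_def)
  then have \<nu>m: "precubical_morphism (interval_pcs 0 l) A \<nu>"
    by (auto simp: precubical_morphism_def \<nu>_def interval_pcs_def)
  have path_map: "path_map B A f (1, \<omega>) = (nat l, \<nu>)"
    unfolding path_map_def
  proof (rule the_equality, intro conjI)
    show "(nat l, \<nu>) \<in> paths A"
      using \<nu>m l by (simp add: paths_def \<nu>_def)
    have "realization_path A (nat l, \<nu>) (\<phi> t) = f (realization_path B (1, \<omega>) t)" if "t \<in> {0..1}"
        for t
      using realization_map_pt[OF \<nu>m] real_cell_in_interval[of "\<phi> t" l] im[OF that] l
      by (simp add: realization_path_def[of A] interval_point_def \<omega>t[OF that, unfolded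
          One_nat_def] fx[OF that] \<nu>_def)
    then show "\<exists>\<phi>. increasing_homeo (real (fst (1, \<omega>))) (real (fst (nat l, \<nu>))) \<phi> \<and>
        (\<forall>t \<in> {0..real (fst (1, \<omega>))}. realization_path A (nat l, \<nu>) (\<phi> t) = f (realization_path B
            (1, \<omega>) t))"
      using \<phi> l by (intro exI[of _ \<phi>]) simp
  next
    fix \<mu> assume "\<mu> \<in> paths A \<and> (\<exists>\<phi>. increasing_homeo (real (fst (1, \<omega>))) (real (fst \<mu>)) \<phi> \<and>
        (\<forall>t \<in> {0..real (fst (1, \<omega>))}. realization_path A \<mu> (\<phi> t) = f (realization_path B (1, \<omega>)
            t)))"
    then obtain k \<mu>' \<psi> where \<mu>: "\<mu> = (k, \<mu>')" and \<mu>m: "precubical_morphism (interval_pcs 0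
        (int k)) A \<mu>'"
      and ext: "\<mu>' \<in> extensional (cubes (interval_pcs 0 (int k)))"
      and \<psi>: "increasing_homeo 1 (real k) \<psi>"
      and eq: "\<And>t. t \<in> {0..1} \<Longrightarrow> realization_path A (k, \<mu>') (\<psi> t) = f (pt B x [t])"
      using \<omega>t by (cases \<mu>) (auto simp: paths_def)
    have "\<psi> 0 = 0" "\<psi> 1 = real k" "inj_on \<psi> {0..1}"
      using increasing_homeoD(3-5)[OF \<psi>] by auto
    \<comment> \<open>Length 0 is impossible because \<open>\<psi>\<close> is injective on the unit
      interval; \<open>dimap_data\<close> asks for positive side lengths.\<close>
    then have k: "1 \<le> k"
      using inj_onD[of \<psi> "{0..1}" 0 1] by (cases k) auto
    have "f (pt B x u) = pt A (\<mu>' (real_cell (\<psi> (u ! 0)))) (real_coords (\<psi> (u ! 0)))" if "u \<in>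
        unit_cube 1" for u
    proof -
      from that obtain t where u: "u = [t]" "t \<in> {0..1}"
        by (cases u) (auto simp: unit_cube_iff)
      show ?thesis
        using eq[OF u(2)] u(1) realization_map_pt[OF \<mu>m] by (simp add: realization_path_def
            interval_point_def)
    qed
    \<comment> \<open>A competing image path is itself subdivision data for \<open>x\<close>, so it
      has the same length and the same edges.\<close>
    then have D': "dimap_data f B A x [int k] (\<lambda>c. \<mu>' (hd c)) id"
      using \<mu>m k \<psi> unfolding dimap_data_def d precubical_morphism_interval_iff
      by (auto simp: permutes_id intro!: exI[of _ "\<lambda>_. \<psi>"])
    have kl: "int k = l"
      using dimap_data_unique(2)[OF A D D'] ls by simp
    have "\<nu> c = \<mu>' c" if "c \<in> cubes (interval_pcs 0 l)" for c
    proof (rule precubical_morphism_interval_eq[OF \<nu>m _ l _ that])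
      show "precubical_morphism (interval_pcs 0 l) A \<mu>'" using \<mu>m kl by simp
      show "\<nu> (Edge j) = \<mu>' (Edge j)" if "1 \<le> j" "j \<le> l" for j
        using dimap_data_unique(3)[OF A D D', of "[j]"] that ls by (simp add: \<nu>_def)
    qed
    then have "\<nu> = \<mu>'"
      using ext kl by (intro extensionalityI[of _ "cubes (interval_pcs 0 l)"]) (auto simp: \<nu>_def)
    then show "\<mu> = (nat l, \<nu>)"
      using \<mu> kl by auto
  qed
  have "label B x = ext_label B (1, \<omega>)"
    by (simp add: ext_label_def \<omega>_def)
  also have "\<dots> = ext_label A (nat l, \<nu>)"
    using f \<omega> path_map unfolding elementary_hda_dimap_def by metis
  also have "\<dots> = sum_list (map (\<lambda>j. label A (g [Edge j])) [1..l])"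
    using l by (auto simp: ext_label_def \<nu>_def intro!: arg_cong[where f = sum_list])
  finally show ?thesis
    by (simp add: ls)
qed

text \<open>Only edges are covered by the label condition of a dimap. Passing to a face in another
  direction, together with its inherited slice of the grid, lowers the degree to that case and keeps
  the labels on both sides.\<close>

lemma dir_label_subdivision:
  assumes f: "elementary_hda_dimap B A f"
  shows "x \<in> cubes B \<Longrightarrow> dimap_data f B A x ls g \<sigma> \<Longrightarrow> i < deg B x \<Longrightarrow> js \<in> grid_box ls \<Longrightarrow>
    dir_label B (Suc (\<sigma> i)) x =
      sum_list (map (\<lambda>j. dir_label A (Suc i) (g (map Edge (js[i := j])))) [1..ls ! i])"
proof (induction "deg B x" arbitrary: x ls g \<sigma> i js)
  case 0
  then show ?case by simp
next
  case (Suc n)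
  have B: "is_hda B" and A: "is_hda A"
    using f by (auto simp: elementary_hda_dimap_def)
  note x = Suc.prems(1) and D = Suc.prems(2)
  have deg: "deg B x = Suc n" using Suc.hyps(2) by simp
  have len: "length ls = Suc n" and g: "precubical_morphism (grid ls) A g" and \<sigma>: "\<sigma> permutes
      {..<Suc n}"
    and l1: "\<And>i. i < Suc n \<Longrightarrow> 1 \<le> ls ! i"
    using dimap_dataD[OF D] deg by auto
  have lenj: "length js = Suc n" using Suc.prems(4) len by (simp add: in_grid_box_iff)
  show ?case
  proof (cases "n = 0")
    case True
    then have i: "i = 0" "\<sigma> 0 = 0"
      using Suc.prems(3) deg permutes_in_image[OF \<sigma>, of 0] by auto
    have "dir_label A (Suc 0) (g [Edge j]) = label A (g [Edge j])" if "1 \<le> j" "j \<le> ls ! 0" for j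
    proof -
      have "[j] \<in> grid_box ls" using that len True by (auto simp: in_grid_box_iff)
      then have "deg A (g [Edge j]) = 1"
        using morphism_top_cube(2)[OF g, of "[j]"] len True by simp
      then show ?thesis by (simp add: dir_label_def edge0_def)
    qed
    moreover have "js[0 := j] = [j]" for j using lenj True by (cases js) auto
    moreover have "dir_label B (Suc 0) x = label B x"
      using deg True by (simp add: dir_label_def edge0_def)
    ultimately show ?thesis
      using dimap_label_edge[OF f x _ D] deg True i
      by (auto intro!: arg_cong[where f = sum_list])
  next
    case False
    define m where "m = (if i = 0 then 1 else 0 :: nat)"
    have m: "m < Suc n" "m \<noteq> i" using False by (auto simp: m_def)
    define i' where "i' = delete_index m i"
    have i': "i' < n" "insert_index m i' = i"
      using Suc.prems(3) deg False by (auto simp: i'_def m_def delete_index_def insert_index_def)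
    define \<sigma>' where "\<sigma>' = permutation_delete \<sigma> m"
    define x' where "x' = bd B True (Suc (\<sigma> m)) x"
    define js' where "js' = delete_at m js"
    define g' where "g' = g \<circ> insert_at m (Vertex (ls ! m))"
    have \<sigma>n: "\<sigma> permutes {0..<Suc n}" using \<sigma> by (simp add: atLeast0LessThan)
    have \<sigma>'n: "\<sigma>' permutes {0..<n}"
      unfolding \<sigma>'_def by (rule permutation_delete_permutes[OF \<sigma>n m(1)])
    have \<sigma>i': "\<sigma>' i' < n" using permutes_in_image[OF \<sigma>'n, of i'] i' by auto
    have \<sigma>m: "\<sigma> m < Suc n" using permutes_in_image[OF \<sigma>, of m] m by auto
    have x': "x' \<in> cubes B" "deg B x' = n"
      using precubical_set_bd[OF is_hdaD(1)[OF B] x, of "Suc (\<sigma> m)"] \<sigma>m deg by (auto simp: x'_def)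
    have js: "js = insert_at m (js ! m) js'"
      using m lenj by (simp add: js'_def insert_at_delete_at)
    have js': "js' \<in> grid_box (delete_at m ls)"
      using Suc.prems(4) insert_at_in_grid_box[of m ls "js ! m" js'] m len js by auto
    have lenj': "length js' = n" using lenj m by (simp add: js'_def length_delete_at)
    have D': "dimap_data f B A x' (delete_at m ls) g' \<sigma>'"
      using dimap_data_face[OF D is_hdaD(1)[OF B] x, of m True] m deg
      by (simp add: x'_def g'_def \<sigma>'_def)
    have "dir_label B (Suc (\<sigma> i)) x = dir_label B (insert_index (Suc (\<sigma> m)) (Suc (\<sigma>' i'))) x"
      using permutation_delete_insert_index[OF \<sigma>n m(1), of i'] i'(2)
      by (simp add: \<sigma>'_def insert_index_def)
    also have "\<dots> = dir_label B (Suc (\<sigma>' i')) x'"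
      unfolding x'_def using \<sigma>m \<sigma>i' deg by (intro dir_label_bd[OF B x, symmetric]) auto
    also have "\<dots> = sum_list (map (\<lambda>j. dir_label A (Suc i') (g' (map Edge (js'[i' := j]))))
        [1..delete_at m ls ! i'])"
      using Suc.hyps(1)[OF x'(2)[symmetric] x'(1) D' _ js'] i' x' by simp
    also have "\<dots> = sum_list (map (\<lambda>j. dir_label A (Suc i) (g (map Edge (js[i := j])))) [1..ls ! i])"
    proof -
      have li: "delete_at m ls ! i' = ls ! i"
        using nth_delete_at_insert_index[of m ls i'] m len i' by simp
      have "dir_label A (Suc i') (g' (map Edge (js'[i' := j]))) = dir_label A (Suc i)
          (g (map Edge (js[i := j])))"
        if j: "1 \<le> j" "j \<le> ls ! i" for j
      proof -
        let ?k = "js'[i' := j]"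
        have "?k \<in> grid_box (delete_at m ls)"
          using js' j li i' len m by (auto simp: in_grid_box_iff nth_list_update length_delete_at)
        then have b: "insert_at m (ls ! m) ?k \<in> grid_box ls"
          using insert_at_in_grid_box[of m ls "ls ! m" ?k] m len l1 by simp
        have b': "js[i := j] \<in> grid_box ls"
          using Suc.prems(3,4) j deg lenj len by (simp add: in_grid_box_iff nth_list_update)
        \<comment> \<open>A top cube of the slice is the upper face of a cube in the last layer of
          the grid. \<open>dir_label_grid\<close> then moves from that layer back to the position of
          \<open>js\<close>.\<close>
        have "g' (map Edge ?k) = bd A True (Suc m) (g (map Edge (insert_at m (ls ! m) ?k)))"
          using bd_morphism_top_cube[OF g _ b, of True] m len by (simp add: g'_def)
        then have "dir_label A (Suc i') (g' (map Edge ?k)) =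
            dir_label A (insert_index (Suc m) (Suc i')) (g (map Edge (insert_at m (ls ! m) ?k)))"
          using m i' len morphism_top_cube[OF g b] by (simp add: dir_label_bd[OF A])
        also have "insert_index (Suc m) (Suc i') = Suc i"
          using i'(2) by (auto simp: insert_index_def)
        also have "dir_label A (Suc i) (g (map Edge (insert_at m (ls ! m) ?k))) =
            dir_label A (Suc i) (g (map Edge (js[i := j])))"
        proof (rule dir_label_grid[OF A g _ b b'])
          have "insert_at m (ls ! m) ?k ! insert_index m i' = ?k ! i'"
            using m lenj' i' by (intro nth_insert_at_insert_index) auto
          then show "insert_at m (ls ! m) ?k ! i = js[i := j] ! i"
            using i' lenj' lenj Suc.prems(3) deg by simp
        qed (use Suc.prems(3) deg len in simp)
        finally show ?thesis .
      qed
      then show ?thesis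
        unfolding li by (auto intro!: arg_cong[where f = sum_list])
    qed
    finally show ?thesis .
  qed
qed

text \<open>The \<open>i\<close>-th factor in the label of a top cube depends only on the
  \<open>i\<close>-th index, so the sum over the grid is a product of sums. These are the letter
  sums of \<open>x\<close> in the order given by \<open>\<sigma>\<close>; sorting them yields a
  second copy of the sign.\<close>

lemma total_label_subdivision_chain:
  assumes f: "elementary_hda_dimap B A f" and x: "x \<in> cubes B"
  shows "total_label A (subdivision_chain f B A x) = (label_value B x :: ('s, 'r::comm_ring_1)
      exterior)"
proof -
  have A: "is_hda A" and e: "elementary_cubical_dimap B A f"
    using f by (auto simp: elementary_hda_dimap_def)
  obtain ls g \<sigma> where D: "dimap_data f B A x ls g \<sigma>"
    using elementary_cubical_dimap_data[OF e x] by blast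
  define n where "n = deg B x"
  define s where "s = (of_int (sign \<sigma>) :: 'r)"
  have len: "length ls = n" and g: "precubical_morphism (grid ls) A g" and \<sigma>: "\<sigma> permutes {0..<n}"
    and l1: "\<And>i. i < n \<Longrightarrow> 1 \<le> ls ! i"
    using dimap_dataD[OF D] by (auto simp: n_def atLeast0LessThan)
  \<comment> \<open>A reference position in the grid. By \<open>dir_label_grid\<close> the label in
    direction \<open>i\<close> at index \<open>j\<close> can be read there after changing entry
    \<open>i\<close> to \<open>j\<close>.\<close>
  define one where "one = replicate n (1 :: int)"
  have one: "one \<in> grid_box ls"
    using len l1 by (auto simp: in_grid_box_iff one_def)
  define a where "a i j = dir_label A (Suc i) (g (map Edge (one[i := j])))" for i j
  define b :: "nat \<Rightarrow> ('s, 'r) exterior" where "b i = letter_sum (dir_label B (Suc i) x)" for i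
  have shift: "prod_list (map h [1..<Suc n]) = prod_list (map (\<lambda>i. h (Suc i)) [0..<n])"
    for h :: "nat \<Rightarrow> ('s, 'r) exterior"
    unfolding map_Suc_upt[of 0 n, unfolded One_nat_def[symmetric], symmetric] map_map o_def ..
  have lv: "(label_value A (g (map Edge js)) :: ('s, 'r) exterior) =
      prod_list (map (\<lambda>i. letter_sum (a i (js ! i))) [0..<n])"
    if js: "js \<in> grid_box ls" for js
  proof -
    have "dir_label A (Suc i) (g (map Edge js)) = a i (js ! i)" if "i < n" for i
      unfolding a_def using that js one len
      by (intro dir_label_grid[OF A g]) (auto simp: in_grid_box_iff nth_list_update)
    then show ?thesis
      unfolding label_value_eq morphism_top_cube(2)[OF g js] len shift
      by (auto intro!: arg_cong[where f = prod_list])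
  qed
  have "total_label A (subdivision_chain f B A x) =
      (\<Sum>js \<in> grid_box ls. exterior_scale s (label_value A (g (map Edge js))))"
    unfolding subdivision_chain_eq[OF is_hdaD(1)[OF A] D] total_label_def s_def
      module.linear_extension_sum[OF module_exterior_scale]
      module.linear_extension_single[OF module_exterior_scale] ..
  also have "\<dots> = exterior_scale s (\<Sum>js \<in> grid_box ls. prod_list
      (map (\<lambda>i. letter_sum (a i (js ! i))) [0..<n]))"
    unfolding Modules.module.scale_sum_right[OF module_exterior_scale]
    by (intro sum.cong refl) (simp add: lv)
  also have "(\<Sum>js \<in> grid_box ls. prod_list (map (\<lambda>i. letter_sum (a i (js ! i))) [0..<n])) =
      prod_list (map (\<lambda>i. \<Sum>j \<in> map (\<lambda>l. {1..l}) ls ! i. letter_sum (a i j)) [0..<n])"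
    using sum_prod_list_listset[of "map (\<lambda>l. {1..l}) ls" "\<lambda>i j. letter_sum (a i j)"] len
    by (auto simp: grid_box_def)
  also have "map (\<lambda>i. \<Sum>j \<in> map (\<lambda>l. {1..l}) ls ! i. letter_sum (a i j)) [0..<n] = map
      (\<lambda>i. b (\<sigma> i)) [0..<n]"
  proof (rule map_cong[OF refl])
    fix i assume "i \<in> set [0..<n]"
    then have i: "i < n" by simp
    have "b (\<sigma> i) = letter_sum (sum_list (map (a i) [1..ls ! i]))"
      using dir_label_subdivision[OF f x D _ one, of i] i by (simp add: b_def a_def[abs_def] n_def)
    also have "\<dots> = (\<Sum>j = 1..ls ! i. letter_sum (a i j))"
      by (simp add: letter_sum_sum_list o_def interv_sum_list_conv_sum_set_int)
    finally show "(\<Sum>j \<in> map (\<lambda>l. {1..l}) ls ! i. letter_sum (a i j)) = b (\<sigma> i)"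
      using i len by simp
  qed
  also have "prod_list (map (\<lambda>i. b (\<sigma> i)) [0..<n]) = exterior_scale s (prod_list (map b [0..<n]))"
    unfolding s_def by (rule prod_list_permute_anticommuting[OF _ \<sigma>]) (unfold b_def, rule
        letter_sum_anticommute)
  also have "exterior_scale s (exterior_scale s (prod_list (map b [0..<n]))) = prod_list
      (map b [0..<n])"
  proof -
    have "s * s = 1"
      by (simp add: s_def sign_def)
    then show ?thesis
      by (simp add: Modules.module.scale_scale[OF module_exterior_scale]
          Modules.module.scale_one[OF module_exterior_scale])
  qed
  also have "prod_list (map b [0..<n]) = label_value B x"
    unfolding label_value_eq n_def[symmetric] shift b_def ..
  finally show ?thesis .
qed

section \<open>Transport of labelled cycles to the ambient automaton\<close>

lemma elementary_hda_dimap_cycle: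
  assumes f: "elementary_hda_dimap B A f" and z: "z \<in> cycles B"
  shows "\<exists>w \<in> cycles A. total_label A w = total_label B z"
proof
  have e: "elementary_cubical_dimap B A f"
    using f by (simp add: elementary_hda_dimap_def)
  let ?F = "linear_extension pm_scale (subdivision_chain f B A)"
  have zB: "Poly_Mapping.keys z \<subseteq> cubes B" and z0: "boundary B z = 0"
    using z by (auto simp: cycles_def chains_def)
  have "boundary A (?F z) = linear_extension pm_scale (\<lambda>x. boundary A (subdivision_chain f B A x))
      z"
    unfolding boundary_eq by (rule module.linear_extension_linear_extension[OF module_pm_scale])
  also have "\<dots> = linear_extension pm_scale (\<lambda>x. ?F (boundary_cube B x)) z"
    using zB by (intro linear_extension_cong boundary_subdivision_chain[OF e]) auto
  also have "\<dots> = ?F (boundary B z)"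
    unfolding boundary_eq by (rule module.linear_extension_linear_extension[OF module_pm_scale,
        symmetric])
  finally have "boundary A (?F z) = 0"
    by (simp add: z0 module.linear_extension_0[OF module_pm_scale])
  moreover have "Poly_Mapping.keys (?F z) \<subseteq> cubes A"
    by (rule order_trans[OF keys_linear_extension]) (use keys_subdivision_chain[OF e] zB in blast)
  ultimately show "?F z \<in> cycles A"
    by (simp add: cycles_def chains_def)
  have "total_label A (?F z) = linear_extension exterior_scale (\<lambda>x. total_label A
      (subdivision_chain f B A x)) z"
    unfolding total_label_def by (rule module.linear_extension_linear_extension[OF
        module_exterior_scale])
  also have "\<dots> = total_label B z"
    unfolding total_label_def[of B]
    using zB by (intro linear_extension_cong total_label_subdivision_chain[OF f]) auto
  finally show "total_label A (?F z) = total_label B z" .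
qed

lemma dimap_chain_cycle:
  assumes "dimap_chain B C f" "z \<in> cycles B"
  shows "\<exists>w \<in> cycles C. total_label C w = total_label B z"
  using assms
proof induction
  case (single C f)
  then show ?case using elementary_hda_dimap_cycle by blast
next
  case (comp C f D g)
  then show ?case using elementary_hda_dimap_cycle by metis
qed

lemma cubical_dimap_cycle:
  assumes "cubical_dimap TYPE('c) B A f" "z \<in> cycles B"
  shows "\<exists>w \<in> cycles A. total_label A w = total_label B z"
  using assms elementary_hda_dimap_cycle dimap_chain_cycle unfolding cubical_dimap_def by metis

text \<open>Labels are assumed to agree on edges only. Both direction labels are pushed to a common
  face in another direction until an edge is reached.\<close>

lemma subautomaton_cycle:
  assumes B: "subautomaton B A" and z: "z \<in> cycles B"
  shows "z \<in> cycles A" "total_label A z = total_label B z"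
proof -
  have hda: "is_hda B" "is_hda A" and sub: "cubes B \<subseteq> cubes A"
    and deg: "\<And>x. x \<in> cubes B \<Longrightarrow> deg A x = deg B x"
    and bd: "\<And>x k i. x \<in> cubes B \<Longrightarrow> 1 \<le> i \<Longrightarrow> i \<le> deg B x \<Longrightarrow> bd A k i x = bd B k i x"
    and label: "\<And>x. x \<in> cubes B \<Longrightarrow> deg B x = 1 \<Longrightarrow> label A x = label B x"
    using B by (auto simp: subautomaton_def cubes_of_deg_def)
  have zB: "Poly_Mapping.keys z \<subseteq> cubes B" and z0: "boundary B z = 0"
    using z by (auto simp: cycles_def chains_def)
  have "boundary A z = boundary B z"
    unfolding boundary_eq using zB by (intro linear_extension_cong) (auto simp: boundary_cube_def
        deg bd intro!: sum.cong)
  then show "z \<in> cycles A"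
    using zB z0 sub by (auto simp: cycles_def chains_def)
  have dir: "dir_label A i x = dir_label B i x" if "x \<in> cubes B" "1 \<le> i" "i \<le> deg B x" for x i
    using that
  proof (induction "deg B x" arbitrary: x i rule: less_induct)
    case less
    show ?case
    proof (cases "deg B x = 1")
      case True
      then show ?thesis using less.prems by (simp add: dir_label_def edge0_def deg label)
    next
      case False
      define m where "m = (if i = 1 then 2 else 1 :: nat)"
      have m: "1 \<le> m" "m \<le> deg B x" "i \<noteq> m" using False less.prems by (auto simp: m_def)
      let ?y = "bd B True m x"
      have y: "?y \<in> cubes B" "deg B ?y = deg B x - 1"
        using precubical_set_bd[OF is_hdaD(1)[OF hda(1)] less.prems(1) m(1,2)] by auto
      have "dir_label A (delete_index m i) ?y = dir_label B (delete_index m i) ?y"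
        using y m less.prems by (intro less.hyps) (auto simp: delete_index_def)
      moreover have "dir_label B (delete_index m i) ?y = dir_label B i x"
        using less.prems m by (intro dir_label_delete_index[OF hda(1)]) auto
      moreover have "dir_label A (delete_index m i) (bd A True m x) = dir_label A i x"
        using less.prems m sub by (intro dir_label_delete_index[OF hda(2)]) (auto simp: deg)
      ultimately show ?thesis
        using bd[OF less.prems(1) m(1,2)] by simp
    qed
  qed
  show "total_label A z = total_label B z"
    unfolding total_label_def
  proof (rule linear_extension_cong)
    fix x assume "x \<in> Poly_Mapping.keys z"
    then have x: "x \<in> cubes B" using zB by blast
    show "label_value A x = (label_value B x :: ('b, 'c) exterior)"
      unfolding label_value_eq deg[OF x]
      using dir[OF x] by (auto intro!: arg_cong[where f = prod_list] simp del: upt_Suc)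
  qed
qed

theorem proposition8p1p1:
  fixes A :: "('a, 's list) hda"
    and B :: "nat \<Rightarrow> ('b, 's list) hda"
    and \<beta> :: "nat \<Rightarrow> ('b \<Rightarrow>\<^sub>0 'r::pid) set"
    and n :: nat
  assumes "is_hda A"
    and "\<And>i. i \<in> {1..n} \<Longrightarrow> is_hda (B i)"
    and "independent_in TYPE('c) (map B [1..<Suc n]) A"
    and "\<And>i. i \<in> {1..n} \<Longrightarrow> \<beta> i \<in> homology (B i)"
  shows "\<exists>\<alpha> \<in> homology A.
    labeling_hom A \<alpha> = prod_list (map (\<lambda>i. labeling_hom (B i) (\<beta> i)) [1..<Suc n])"
proof -
  let ?T = "tensor_hda (map B [1..<Suc n])"
  obtain C f where C: "subautomaton C A" and f: "cubical_dimap TYPE('c) ?T C f"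
    using assms(3) unfolding independent_in_def by blast
  have "\<exists>z. \<forall>i \<in> {1..n}. z i \<in> cycles (B i) \<and> labeling_hom (B i) (\<beta> i) = total_label (B i) (z i)"
    using homology_obtain_cycle[OF assms(2) assms(4)] by (intro bchoice) blast
  then obtain z where z: "\<And>i. i \<in> {1..n} \<Longrightarrow> z i \<in> cycles (B i)"
    and lab: "\<And>i. i \<in> {1..n} \<Longrightarrow> labeling_hom (B i) (\<beta> i) = total_label (B i) (z i)"
    by blast
  \<comment> \<open>Lists replace the indexed families here, to match the recursion of the tensor
    product over its factors.\<close>
  have "list_all2 (\<lambda>A z. is_hda A \<and> z \<in> cycles A) (map B [1..<Suc n]) (map z [1..<Suc n])"
    using assms(2) z by (auto simp: list_all2_conv_all_nth simp del: upt_Suc)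
  then obtain w where w: "w \<in> cycles ?T"
    "total_label ?T w = prod_list (map2 total_label (map B [1..<Suc n]) (map z [1..<Suc n]))"
    using tensor_hda_cycle by blast
  obtain v where v: "v \<in> cycles C" "total_label C v = total_label ?T w"
    using cubical_dimap_cycle[OF f w(1)] by blast
  obtain \<alpha> where \<alpha>: "\<alpha> \<in> homology A" "labeling_hom A \<alpha> = total_label A v"
    using homology_class_of_cycle[OF assms(1) subautomaton_cycle(1)[OF C v(1)]] by blast
  have "map2 total_label (map B [1..<Suc n]) (map z [1..<Suc n]) =
      map (\<lambda>i. labeling_hom (B i) (\<beta> i)) [1..<Suc n]"
    using lab by (intro nth_equalityI) (auto simp del: upt_Suc)
  then show ?thesis
    using \<alpha> subautomaton_cycle(2)[OF C v(1)] v(2) w(2) by metis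
qed

end
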